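(* Consider the regression model $dy_t=S(t)\,dt+d\xi_t$, $0\le t\le n$, with the semi-Markov noise $\xi$ and the family $\mathcal Q_n$ of noise distributions described in the context; that is, $\varsigma_*(n)\le\sigma_Q\le\varsigma^*(n)$ for $Q\in\mathcal Q_n$, where $0<\varsigma_*(n)\le\varsigma^*(n)$ satisfy, for any $\check\epsilon>0$, $\lim_{n\to\infty}n^{\check\epsilon}\varsigma_*(n)=+\infty$ and $\lim_{n\to\infty}\varsigma^*(n)/n^{\check\epsilon}=0$. Let $k\ge1$ be an integer and $r>0$. Then $$\liminf_{n\to\infty}\ \upsilon_n^{2k/(2k+1)}\inf_{\widehat S_n\in\Pi_n}\ \sup_{S\in W^k_r}\mathcal R^*_n(\widehat S_n,S)\ \ge\ r^*_k,$$ where $\upsilon_n=n/\varsigma^*(n)$, $\Pi_n$ is the set of all estimators measurable with respect to $\sigma\{y_t,\,0\le t\le n\}$, and $$r^*_k=\left((2k+1)r\right)^{1/(2k+1)}\left(\frac{k}{(k+1)\pi}\right)^{2k/(2k+1)}.$$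
   Context: Model and noise. $S:\mathbb R\to\mathbb R$ is an unknown $1$-periodic function, $dy_t=S(t)dt+d\xi_t$ on $[0,n]$. The noise is $\xi_t=\varrho_1w_t+\varrho_2L_t+\varrho_3z_t$, with unknown real coefficients $\varrho_1,\varrho_2,\varrho_3$; $w$ is a standard Brownian motion; $L_t=\int_0^t\int_{\mathbb R\setminus\{0\}}x(\mu(ds,dx)-ds\,\Pi(dx))$ is a pure jump Lévy process with jump measure $\mu$ and Lévy measure $\Pi$ with $\int x^2\Pi(dx)=1$, $\int x^8\Pi(dx)<\infty$; $z_t=\sum_{i=1}^{N_t}Y_i$, $N_t=\sum_{k\ge1}1_{\{T_k\le t\}}$, $T_k=\sum_{l=1}^k\tau_l$, where $(\tau_l)_{l\ge1}$ are i.i.d. positive integrable random variables with law $\eta$ and mean $\check\tau>0$. The random variables $(Y_i)_{i\ge1}$ satisfy: $\mathbf E Y_i^2=1$, $\mathbf E Y_{i_1}Y_{i_2}=0$ for $i_1\ne i_2$, $\sup_i\mathbf E Y_i^4<\infty$, and for all $i_1<i_2<i_3<i_4$ and $p_1,\dots,p_4\in\{0,\dots,4\}$ with $p_1+\dots+p_4=4$, $\mathbf E Y_{i_1}^{p_1}Y_{i_2}^{p_2}Y_{i_3}^{p_3}Y_{i_4}^{p_4}=0$ whenever some $p_i$ is odd. The processes $w$, $L$, $(N_t)$ and $(Y_i)$ are mutually independent. $\Pi$, $\eta$ and the law of $(Y_i)$ are fixed; $Q$ denotes the distribution of $(\xi_t)_{0\le t\le n}$ in the Skorokhod space $\mathcal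 D[0,n]$ (so it varies with $\varrho_1,\varrho_2,\varrho_3$). Put $\sigma_Q=\varrho_1^2+\varrho_2^2+\varrho_3^2/\check\tau$. $\mathcal Q_n$ is the family of all distributions $Q$ of the noise with $\varsigma_*(n)\le\sigma_Q\le\varsigma^*(n)$. $\mathbf E_{Q,S}$ is expectation under the law of $y$ with noise law $Q$ and function $S$. Robust risk. $\mathcal R_Q(\widetilde S,S)=\mathbf E_{Q,S}\|\widetilde S-S\|^2$, $\|f\|^2=\int_0^1f^2(s)ds$, and $\mathcal R^*_n(\widetilde S,S)=\sup_{Q\in\mathcal Q_n}\mathcal R_Q(\widetilde S,S)$. Sobolev ball. $W^k_r=\{f\in C^k_{per}[0,1]:\sum_{j=0}^k\|f^{(j)}\|^2\le r\}$, where $C^k_{per}[0,1]$ is the set of $k$ times continuously differentiable $f:[0,1]\to\mathbb R$ with $f^{(i)}(0)=f^{(i)}(1)$ for $0\le i\le k$; elements are identified with their $1$-periodic extensions. *)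

theory Defs
  imports "HOL-Probability.Probability"
begin

definition cadlag_on :: "real set \<Rightarrow> (real \<Rightarrow> real) \<Rightarrow> bool" where
  "cadlag_on I f \<longleftrightarrow>
     (\<forall>t\<in>I. (f \<longlongrightarrow> f t) (at t within I \<inter> {t..})) \<and>
     (\<forall>t\<in>I. \<exists>l. (f \<longlongrightarrow> l) (at t within I \<inter> {..<t}))"

text \<open>
  The space of cadlag paths on \<open>[0, T]\<close> with the \<open>\<sigma>\<close>-algebra generated by the coordinate
  maps, which is also the Borel \<open>\<sigma>\<close>-algebra of the Skorokhod topology. As usual for
  product spaces, paths are extensional outside \<open>[0, T]\<close>.
\<close>

definition skorokhod_space :: "real \<Rightarrow> (real \<Rightarrow> real) measure" where
  "skorokhod_space T =
     restrict_space (PiM {0..T} (\<lambda>_. borel)) {x. cadlag_on {0..T} x}"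

definition independent_increments :: "'a measure \<Rightarrow> (real \<Rightarrow> 'a \<Rightarrow> real) \<Rightarrow> bool" where
  "independent_increments M X \<longleftrightarrow>
     (\<forall>(t :: nat \<Rightarrow> real) m. 0 \<le> t 0 \<longrightarrow> mono t \<longrightarrow>
        prob_space.indep_vars M (\<lambda>_. borel) (\<lambda>i \<omega>. X (t (Suc i)) \<omega> - X (t i) \<omega>) {..<m})"

definition brownian_motion :: "'a measure \<Rightarrow> (real \<Rightarrow> 'a \<Rightarrow> real) \<Rightarrow> bool" where
  "brownian_motion M w \<longleftrightarrow>
     (\<forall>t\<ge>0. w t \<in> borel_measurable M) \<and>
     (AE \<omega> in M. w 0 \<omega> = 0) \<and>
     independent_increments M w \<and>
     (\<forall>s t. 0 \<le> s \<longrightarrow> s < t \<longrightarrow>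
        distributed M lborel (\<lambda>\<omega>. w t \<omega> - w s \<omega>) (normal_density 0 (sqrt (t - s)))) \<and>
     (\<forall>\<omega>\<in>space M. continuous_on {0..} (\<lambda>t. w t \<omega>))"

definition levy_process :: "'a measure \<Rightarrow> (real \<Rightarrow> 'a \<Rightarrow> real) \<Rightarrow> bool" where
  "levy_process M X \<longleftrightarrow>
     (\<forall>t\<ge>0. X t \<in> borel_measurable M) \<and>
     (AE \<omega> in M. X 0 \<omega> = 0) \<and>
     independent_increments M X \<and>
     (\<forall>s\<ge>0. \<forall>h\<ge>0. distr M borel (\<lambda>\<omega>. X (s + h) \<omega> - X s \<omega>) = distr M borel (X h)) \<and>
     (\<forall>\<omega>\<in>space M. cadlag_on {0..} (\<lambda>t. X t \<omega>))"

definition jump :: "(real \<Rightarrow> real) \<Rightarrow> real \<Rightarrow> real" where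
  "jump f t = f t - Lim (at_left t) f"

text \<open>The sum of the point masses at \<open>(s, jump f s)\<close> over all jump times \<open>s\<close> of \<open>f\<close>.\<close>

definition jump_measure :: "(real \<Rightarrow> real) \<Rightarrow> (real \<times> real) measure" where
  "jump_measure f =
     distr (count_space {s. 0 < s \<and> jump f s \<noteq> 0}) borel (\<lambda>s. (s, jump f s))"

text \<open>
  Expected number of jumps per unit of time with size in a given Borel set. The measure lives on
  all of \<open>\<real>\<close>; the condition forces it to vanish on \<open>{0}\<close>.
\<close>

definition levy_measure :: "'a measure \<Rightarrow> (real \<Rightarrow> 'a \<Rightarrow> real) \<Rightarrow> real measure \<Rightarrow> bool" where
  "levy_measure M X \<nu> \<longleftrightarrow>
     sets \<nu> = sets borel \<and>
     (\<forall>A\<in>sets borel. emeasure \<nu> A =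
        (\<integral>\<^sup>+\<omega>. emeasure (jump_measure (\<lambda>t. X t \<omega>)) ({0<..1} \<times> A) \<partial>M))"

text \<open>
  \<open>X\<^sub>t = \<integral>\<^sub>0\<^sup>t \<integral> x (\<mu>(ds, dx) - ds \<nu>(dx))\<close> for the jump measure \<open>\<mu>\<close> of \<open>X\<close>: the compensated
  integral is, as usual, the \<open>L\<^sup>2\<close>-limit for \<open>e \<rightarrow> 0\<close> of its truncations to jumps of
  size larger than \<open>e\<close>.
\<close>

definition compensated_truncation ::
  "real measure \<Rightarrow> real \<Rightarrow> (real \<Rightarrow> real) \<Rightarrow> real \<Rightarrow> real" where
  "compensated_truncation \<nu> e f t =
     set_lebesgue_integral (jump_measure f) ({0<..t} \<times> {x. e < \<bar>x\<bar>}) snd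
     - set_lebesgue_integral (lborel \<Otimes>\<^sub>M \<nu>) ({0<..t} \<times> {x. e < \<bar>x\<bar>}) snd"

definition compensated_jump_integral ::
  "'a measure \<Rightarrow> real measure \<Rightarrow> (real \<Rightarrow> 'a \<Rightarrow> real) \<Rightarrow> bool" where
  "compensated_jump_integral M \<nu> X \<longleftrightarrow>
     (\<forall>t\<ge>0. ((\<lambda>e. \<integral>\<^sup>+\<omega>. ennreal ((X t \<omega> - compensated_truncation \<nu> e (\<lambda>u. X u \<omega>) t)\<^sup>2) \<partial>M)
        \<longlongrightarrow> 0) (at_right 0))"

definition arrival_time :: "(nat \<Rightarrow> 'a \<Rightarrow> real) \<Rightarrow> nat \<Rightarrow> 'a \<Rightarrow> real" where
  "arrival_time \<tau> k \<omega> = (\<Sum>l=1..k. \<tau> l \<omega>)"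

text \<open>
  On the null event where the arrival times do not tend to infinity (so that infinitely many of them
  might fall into a bounded interval) the counting process is set to \<open>0\<close>; in this way all of its
  paths are cadlag.
\<close>

definition renewal_process :: "(nat \<Rightarrow> 'a \<Rightarrow> real) \<Rightarrow> real \<Rightarrow> 'a \<Rightarrow> nat" where
  "renewal_process \<tau> t \<omega> =
     (if filterlim (\<lambda>k. arrival_time \<tau> k \<omega>) at_top sequentially
      then card {k. 1 \<le> k \<and> arrival_time \<tau> k \<omega> \<le> t} else 0)"

definition semi_markov_process ::
  "(nat \<Rightarrow> 'a \<Rightarrow> real) \<Rightarrow> (nat \<Rightarrow> 'a \<Rightarrow> real) \<Rightarrow> real \<Rightarrow> 'a \<Rightarrow> real" where
  "semi_markov_process \<tau> Y t \<omega> = (\<Sum>i=1..renewal_process \<tau> t \<omega>. Y i \<omega>)"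

definition generated_events ::
  "'a measure \<Rightarrow> 'i set \<Rightarrow> ('i \<Rightarrow> 'a \<Rightarrow> 'b::topological_space) \<Rightarrow> 'a set set" where
  "generated_events M I X =
     sigma_sets (space M) {X i -` A \<inter> space M | i A. i \<in> I \<and> A \<in> sets borel}"

locale semi_markov_noise = prob_space M
  for M :: "'a measure" +
  fixes w L :: "real \<Rightarrow> 'a \<Rightarrow> real"
    and \<tau> Y :: "nat \<Rightarrow> 'a \<Rightarrow> real"
    and \<nu> \<eta> :: "real measure"
  assumes brownian: "brownian_motion M w"
    and levy: "levy_process M L" "levy_measure M L \<nu>" "compensated_jump_integral M \<nu> L"
    and levy_moments: "(\<integral>\<^sup>+x. ennreal (x ^ 2) \<partial>\<nu>) = 1" "(\<integral>\<^sup>+x. ennreal (x ^ 8) \<partial>\<nu>) < \<infinity>"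
    and tau_indep: "indep_vars (\<lambda>_. borel) \<tau> {1..}"
    and tau_law: "\<And>l. 1 \<le> l \<Longrightarrow> distr M borel (\<tau> l) = \<eta>"
    and tau_pos: "AE x in \<eta>. 0 < x"
    and tau_integrable: "integrable \<eta> (\<lambda>x. x)"
    and Y_measurable: "\<And>i. 1 \<le> i \<Longrightarrow> Y i \<in> borel_measurable M"
    and Y_variance: "\<And>i. 1 \<le> i \<Longrightarrow> expectation (\<lambda>\<omega>. (Y i \<omega>)\<^sup>2) = 1"
    and Y_uncorrelated:
      "\<And>i j. 1 \<le> i \<Longrightarrow> 1 \<le> j \<Longrightarrow> i \<noteq> j \<Longrightarrow> expectation (\<lambda>\<omega>. Y i \<omega> * Y j \<omega>) = 0"
    and Y_fourth_moment: "(SUP i\<in>{1..}. \<integral>\<^sup>+\<omega>. ennreal ((Y i \<omega>) ^ 4) \<partial>M) < \<infinity>"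
    and Y_odd_moments:
      "\<And>i1 i2 i3 i4 p1 p2 p3 p4 :: nat.
         1 \<le> i1 \<Longrightarrow> i1 < i2 \<Longrightarrow> i2 < i3 \<Longrightarrow> i3 < i4 \<Longrightarrow> p1 + p2 + p3 + p4 = 4 \<Longrightarrow>
         odd p1 \<or> odd p2 \<or> odd p3 \<or> odd p4 \<Longrightarrow>
         expectation (\<lambda>\<omega>. Y i1 \<omega> ^ p1 * Y i2 \<omega> ^ p2 * Y i3 \<omega> ^ p3 * Y i4 \<omega> ^ p4) = 0"
    and processes_indep:
      "indep_sets (\<lambda>j::nat. [generated_events M {0..} w, generated_events M {0..} L,
          generated_events M {0..} (renewal_process \<tau>), generated_events M {1..} Y] ! j) {..<4}"

definition noise_law ::
  "'a measure \<Rightarrow> (real \<Rightarrow> 'a \<Rightarrow> real) \<Rightarrow> (real \<Rightarrow> 'a \<Rightarrow> real) \<Rightarrow> (nat \<Rightarrow> 'a \<Rightarrow> real) \<Rightarrow> (nat \<Rightarrow> 'a \<Rightarrow> real)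
    \<Rightarrow> real \<Rightarrow> real \<Rightarrow> real \<Rightarrow> real \<Rightarrow> (real \<Rightarrow> real) measure" where
  "noise_law M w L \<tau> Y T \<rho>1 \<rho>2 \<rho>3 =
     distr M (skorokhod_space T)
       (\<lambda>\<omega>. \<lambda>t\<in>{0..T}. \<rho>1 * w t \<omega> + \<rho>2 * L t \<omega> + \<rho>3 * semi_markov_process \<tau> Y t \<omega>)"

definition noise_variance :: "real measure \<Rightarrow> real \<Rightarrow> real \<Rightarrow> real \<Rightarrow> real" where
  "noise_variance \<eta> \<rho>1 \<rho>2 \<rho>3 = \<rho>1\<^sup>2 + \<rho>2\<^sup>2 + \<rho>3\<^sup>2 / (\<integral>x. x \<partial>\<eta>)"

definition noise_family ::
  "'a measure \<Rightarrow> (real \<Rightarrow> 'a \<Rightarrow> real) \<Rightarrow> (real \<Rightarrow> 'a \<Rightarrow> real) \<Rightarrow> (nat \<Rightarrow> 'a \<Rightarrow> real) \<Rightarrow> (nat \<Rightarrow> 'a \<Rightarrow> real)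
    \<Rightarrow> real measure \<Rightarrow> real \<Rightarrow> real \<Rightarrow> real \<Rightarrow> (real \<Rightarrow> real) measure set" where
  "noise_family M w L \<tau> Y \<eta> T lo hi =
     {noise_law M w L \<tau> Y T \<rho>1 \<rho>2 \<rho>3 | \<rho>1 \<rho>2 \<rho>3.
        lo \<le> noise_variance \<eta> \<rho>1 \<rho>2 \<rho>3 \<and> noise_variance \<eta> \<rho>1 \<rho>2 \<rho>3 \<le> hi}"

text \<open>The law of \<open>y\<^sub>t = \<integral>\<^sub>0\<^sup>t S(u) du + \<xi>\<^sub>t\<close> on \<open>[0, T]\<close> when \<open>\<xi>\<close> has law \<open>Q\<close>.\<close>

definition observation_law ::
  "real \<Rightarrow> (real \<Rightarrow> real) measure \<Rightarrow> (real \<Rightarrow> real) \<Rightarrow> (real \<Rightarrow> real) measure" where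
  "observation_law T Q S =
     distr Q (skorokhod_space T) (\<lambda>x. \<lambda>t\<in>{0..T}. integral {0..t} S + x t)"

text \<open>
  An estimator maps the observed path \<open>y\<close> to a function on \<open>[0, 1]\<close>. Joint measurability
  in \<open>y\<close> and the argument of that function makes the integrated risk meaningful.
\<close>

definition estimators :: "real \<Rightarrow> ((real \<Rightarrow> real) \<Rightarrow> real \<Rightarrow> real) set" where
  "estimators T =
     {E. (\<lambda>(y, s). E y s) \<in> borel_measurable (skorokhod_space T \<Otimes>\<^sub>M restrict_space borel {0..1})}"

definition risk ::
  "real \<Rightarrow> (real \<Rightarrow> real) measure \<Rightarrow> ((real \<Rightarrow> real) \<Rightarrow> real \<Rightarrow> real) \<Rightarrow> (real \<Rightarrow> real) \<Rightarrow> ennreal" where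
  "risk T Q E S =
     (\<integral>\<^sup>+y. (\<integral>\<^sup>+s\<in>{0..1}. ennreal ((E y s - S s)\<^sup>2) \<partial>lborel) \<partial>observation_law T Q S)"

definition robust_risk ::
  "real \<Rightarrow> (real \<Rightarrow> real) measure set \<Rightarrow> ((real \<Rightarrow> real) \<Rightarrow> real \<Rightarrow> real) \<Rightarrow> (real \<Rightarrow> real) \<Rightarrow> ennreal" where
  "robust_risk T QQ E S = (SUP Q\<in>QQ. risk T Q E S)"

text \<open>Iterated derivatives on \<open>[0, 1]\<close>, one-sided at the end points.\<close>

definition deriv01 :: "nat \<Rightarrow> (real \<Rightarrow> real) \<Rightarrow> real \<Rightarrow> real" where
  "deriv01 j f = ((\<lambda>g x. vector_derivative g (at x within {0..1})) ^^ j) f"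

text \<open>Elements are represented by their 1-periodic extensions to \<open>\<real>\<close>.\<close>

definition C_per :: "nat \<Rightarrow> (real \<Rightarrow> real) set" where
  "C_per k = {f. (\<forall>x. f (x + 1) = f x) \<and>
     (\<forall>j<k. deriv01 j f differentiable_on {0..1}) \<and>
     (\<forall>j\<le>k. continuous_on {0..1} (deriv01 j f)) \<and>
     (\<forall>j\<le>k. deriv01 j f 0 = deriv01 j f 1)}"

definition sobolev_ball :: "nat \<Rightarrow> real \<Rightarrow> (real \<Rightarrow> real) set" where
  "sobolev_ball k r =
     {f \<in> C_per k. (\<Sum>j=0..k. integral {0..1} (\<lambda>x. (deriv01 j f x)\<^sup>2)) \<le> r}"

definition pinsker_constant :: "nat \<Rightarrow> real \<Rightarrow> real" where
  "pinsker_constant k r =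
     ((2 * real k + 1) * r) powr (1 / (2 * real k + 1))
     * (real k / ((real k + 1) * pi)) powr (2 * real k / (2 * real k + 1))"

end

theory Submission
  imports Defs
begin

text \<open>
  Choosing \<open>\<rho>1 = sqrt (\<sigma>hi n)\<close> and \<open>\<rho>2 = \<rho>3 = 0\<close> puts the Gaussian white noise model of
  intensity \<open>\<sigma>hi n\<close> into the family, so a Bayesian lower bound for that model suffices. Put
  independent centred Gaussian priors on the Fourier coefficients \<open>\<theta>\<^sub>j\<close> of \<open>S\<close> at the frequencies
  \<open>1, \<dots>, N - 1\<close>, with Pinsker's least favourable variances. Given all coefficients except the
  \<open>j\<close>-th one, the model is a one-parameter Gaussian shift, so the risk of estimating \<open>\<theta>\<^sub>j\<close> from the
  whole path is at least \<open>1 / (1 / \<tau>\<^sub>j\<^sup>2 + n / \<sigma>hi n)\<close>: for estimators that see the path at finitely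
  many times this is an explicit posterior computation, in which discretisation can only reduce
  the information \<open>n / \<sigma>hi n\<close>, and a bounded functional of the path is an \<open>L\<^sup>1\<close>-limit of such
  estimators. The prior leaves the Sobolev ball with exponentially small probability (a Chernoff
  bound), so conditioning on the ball costs nothing in the limit. With
  \<open>N \<sim> A (n / \<sigma>hi n) powr (1 / (2 k + 1))\<close> and the largest admissible \<open>A\<close>, the sum of the
  coordinatewise bounds has the asserted asymptotics.
\<close>

section \<open>Gaussian Bayes risk with finitely many observations\<close>

text \<open>Pinsker's variances come from maximising the sum of the bounds
  \<open>1 / (1 / \<tau>\<^sup>2 + v)\<close>, \<open>v = n / \<sigma>hi n\<close>, at a fixed
  expected squared Sobolev norm. With weights proportional to \<open>l ^ (2 * k)\<close> the
  Lagrange condition makes \<open>1 + v * \<tau>\<^sup>2\<close> a multiple of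
  \<open>1 / l ^ k\<close>; hence \<open>\<tau>\<^sup>2 = ((N / l) ^ k - 1) / v\<close>, which is
  positive exactly for \<open>l < N\<close>. The obstacle is that this prior has unbounded support,
  while the supremum controls the risk on the ball only. No normalised conditional prior is formed:
  the Bayes integral is split according to whether the coefficients lie in the ball. Off the ball,
  estimated coefficients clipped to \<open>[- sqrt r, sqrt r]\<close> have a loss bounded by a
  multiple of the squared Sobolev norm, whose truncated expectation is exponentially small. Clipping
  also supplies the boundedness used in the approximation by finitely many observation times. The
  Chernoff bound needs an expected norm strictly below \<open>r\<close>, so the prior aims at
  \<open>(1 - \<delta>) * r\<close>, and \<delta> tends to 0 only at the very end.\<close>

lemma nn_integral_PiM_density:
  fixes p :: "'i \<Rightarrow> real \<Rightarrow> ennreal"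
  assumes "finite I" and p: "\<And>i. p i \<in> borel_measurable borel"
    and sf: "\<And>i. sigma_finite_measure (density lborel (p i))"
    and f: "f \<in> borel_measurable (PiM I (\<lambda>_. borel))"
  shows "(\<integral>\<^sup>+u. f u \<partial>PiM I (\<lambda>i. density lborel (p i)))
      = (\<integral>\<^sup>+u. (\<Prod>i\<in>I. p i (u i)) * f u \<partial>PiM I (\<lambda>_. lborel))"
  using assms(1) f
proof (induction I arbitrary: f rule: finite_induct)
  case empty
  interpret A: product_sigma_finite "\<lambda>i. density lborel (p i)"
    using sf by (simp add: product_sigma_finite_def)
  interpret B: product_sigma_finite "\<lambda>_::'i. lborel :: real measure"
    by (simp add: product_sigma_finite_def lborel.sigma_finite_measure_axioms)
  show ?case using empty by (simp add: A.nn_integral_empty B.nn_integral_empty)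
next
  case (insert i I)
  interpret A: product_sigma_finite "\<lambda>i. density lborel (p i)"
    using sf by (simp add: product_sigma_finite_def)
  interpret B: product_sigma_finite "\<lambda>_::'i. lborel :: real measure"
    by (simp add: product_sigma_finite_def lborel.sigma_finite_measure_axioms)
  note [measurable] = p insert.prems
  have sets1: "sets (PiM J (\<lambda>i. density lborel (p i))) = sets (PiM J (\<lambda>_. borel))" for J
    by (intro sets_PiM_cong) auto
  have sets2: "sets (PiM J (\<lambda>_. lborel)) = sets (PiM J (\<lambda>_. borel :: real measure))" for J :: "'i set"
    by (intro sets_PiM_cong) auto
  have fm: "f \<in> borel_measurable (PiM (insert i I) (\<lambda>i. density lborel (p i)))"
    using insert.prems by (simp cong: measurable_cong_sets add: measurable_cong_sets[OF sets1 refl])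
  have fm1: "(\<lambda>(u, x). f (u(i := x))) \<in> borel_measurable (PiM I (\<lambda>_. borel) \<Otimes>\<^sub>M borel)"
    by measurable
  have "(\<integral>\<^sup>+u. f u \<partial>PiM (insert i I) (\<lambda>i. density lborel (p i)))
     = (\<integral>\<^sup>+u. (\<integral>\<^sup>+x. f (u(i := x)) \<partial>density lborel (p i)) \<partial>PiM I (\<lambda>i. density lborel (p i)))"
    by (rule A.product_nn_integral_insert[OF insert.hyps fm])
  also have "\<dots> = (\<integral>\<^sup>+u. (\<Prod>j\<in>I. p j (u j)) * (\<integral>\<^sup>+x. f (u(i := x)) \<partial>density lborel (p i)) \<partial>PiM I (\<lambda>_. lborel))"
  proof (rule insert.IH)
    have "(\<lambda>(u, x). f (u(i := x))) \<in> borel_measurable (PiM I (\<lambda>_. borel) \<Otimes>\<^sub>M density lborel (p i))"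
      using fm1 by (simp cong: measurable_cong_sets add: measurable_cong_sets[OF sets_pair_measure_cong[OF refl sets_density] refl])
    from sigma_finite_measure.borel_measurable_nn_integral[OF sf this]
    show "(\<lambda>u. \<integral>\<^sup>+x. f (u(i := x)) \<partial>density lborel (p i)) \<in> borel_measurable (PiM I (\<lambda>_. borel))"
      by simp
  qed
  also have "\<dots> = (\<integral>\<^sup>+u. (\<integral>\<^sup>+x. (\<Prod>j\<in>insert i I. p j ((u(i := x)) j)) * f (u(i := x)) \<partial>lborel) \<partial>PiM I (\<lambda>_. lborel))"
  proof (rule nn_integral_cong)
    fix u :: "'i \<Rightarrow> real" assume "u \<in> space (PiM I (\<lambda>_. lborel))"
    then have u: "u \<in> space (PiM I (\<lambda>_. borel))" by (simp add: space_PiM)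
    have m: "(\<lambda>x. f (u(i := x))) \<in> borel_measurable lborel"
      using measurable_Pair_compose_split[OF fm1 measurable_const[OF u] measurable_ident_sets[OF sets_lborel]] by simp
    have "(\<Prod>j\<in>I. p j (u j)) * (\<integral>\<^sup>+x. f (u(i := x)) \<partial>density lborel (p i))
       = (\<integral>\<^sup>+x. (\<Prod>j\<in>I. p j (u j)) * (p i x * f (u(i := x))) \<partial>lborel)"
      using m by (subst nn_integral_density) (auto simp: nn_integral_cmult)
    also have "\<dots> = (\<integral>\<^sup>+x. (\<Prod>j\<in>insert i I. p j ((u(i := x)) j)) * f (u(i := x)) \<partial>lborel)"
    proof (rule nn_integral_cong)
      fix x
      have "(\<Prod>j\<in>I. p j ((u(i := x)) j)) = (\<Prod>j\<in>I. p j (u j))"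
        using insert.hyps by (intro prod.cong) auto
      then show "(\<Prod>j\<in>I. p j (u j)) * (p i x * f (u(i := x))) = (\<Prod>j\<in>insert i I. p j ((u(i := x)) j)) * f (u(i := x))"
        using insert.hyps by (simp add: mult_ac)
    qed
    finally show "(\<Prod>j\<in>I. p j (u j)) * (\<integral>\<^sup>+x. f (u(i := x)) \<partial>density lborel (p i)) = \<dots>" .
  qed
  also have "\<dots> = (\<integral>\<^sup>+u. (\<Prod>j\<in>insert i I. p j (u j)) * f u \<partial>PiM (insert i I) (\<lambda>_. lborel))"
  proof (rule B.product_nn_integral_insert[OF insert.hyps, symmetric])
    have "(\<lambda>u. (\<Prod>j\<in>insert i I. p j (u j)) * f u) \<in> borel_measurable (PiM (insert i I) (\<lambda>_. borel))"
      by measurable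
    then show "(\<lambda>u. (\<Prod>j\<in>insert i I. p j (u j)) * f u) \<in> borel_measurable (PiM (insert i I) (\<lambda>_. lborel))"
      by (simp add: measurable_cong_sets[OF sets2 refl])
  qed
  finally show ?case .
qed

text \<open>\<open>K\<close> is the marginal density of the data, \<open>m\<close> the posterior mean and \<open>v\<close> the posterior variance.\<close>

lemma gaussian_posterior:
  fixes d e s :: "'i \<Rightarrow> real"
  assumes "finite I" "0 < \<tau>" "\<And>i. 0 < s i"
  defines "v \<equiv> 1 / (1 / \<tau>\<^sup>2 + (\<Sum>i\<in>I. (d i)\<^sup>2 / (s i)\<^sup>2))"
  shows "\<exists>K m. K \<in> borel_measurable (PiM I (\<lambda>_. borel)) \<and> m \<in> borel_measurable (PiM I (\<lambda>_. borel)) \<and>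
    (\<forall>u. 0 \<le> K u) \<and>
    (\<forall>x u. normal_density 0 \<tau> x * (\<Prod>i\<in>I. normal_density (x * d i + e i) (s i) (u i))
       = K u * normal_density (m u) (sqrt v) x)"
proof -
  define m where "m u = v * (\<Sum>i\<in>I. d i * (u i - e i) / (s i)\<^sup>2)" for u :: "'i \<Rightarrow> real"
  \<comment> \<open>The normalising factors of prior and likelihood, divided by that of the
    posterior density.\<close>
  define c where "c = 1 / sqrt (2 * pi * \<tau>\<^sup>2) * (\<Prod>i\<in>I. 1 / sqrt (2 * pi * (s i)\<^sup>2)) * sqrt (2 * pi * v)"
  define K where "K u = c * exp (- ((\<Sum>i\<in>I. (u i - e i)\<^sup>2 / (s i)\<^sup>2) - (m u)\<^sup>2 / v) / 2)" for u
  have v0: "0 < v" unfolding v_def using \<open>0 < \<tau>\<close>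
    by (intro divide_pos_pos add_pos_nonneg sum_nonneg) auto
  have vinv: "1 / v = 1 / \<tau>\<^sup>2 + (\<Sum>i\<in>I. (d i)\<^sup>2 / (s i)\<^sup>2)" by (simp add: v_def)
  have cn: "0 \<le> c" unfolding c_def using v0 by (intro mult_nonneg_nonneg prod_nonneg) auto
  have eq: "normal_density 0 \<tau> x * (\<Prod>i\<in>I. normal_density (x * d i + e i) (s i) (u i))
       = K u * normal_density (m u) (sqrt v) x" for x u
  proof -
    let ?A = "\<Sum>i\<in>I. (u i - e i)\<^sup>2 / (s i)\<^sup>2" and ?B = "\<Sum>i\<in>I. d i * (u i - e i) / (s i)\<^sup>2"
      and ?C = "\<Sum>i\<in>I. (d i)\<^sup>2 / (s i)\<^sup>2"
    have "(\<Sum>i\<in>I. - (u i - (x * d i + e i))\<^sup>2 / (2 * (s i)\<^sup>2)) = (\<Sum>i\<in>I. - ((u i - e i)\<^sup>2 / (s i)\<^sup>2) / 2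
      + x * (d i * (u i - e i) / (s i)\<^sup>2) - x\<^sup>2 * ((d i)\<^sup>2 / (s i)\<^sup>2) / 2)"
    proof (rule sum.cong[OF refl])
      fix i assume "i \<in> I"
      then have "s i \<noteq> 0" using assms(3)[of i] by auto
      then show "- (u i - (x * d i + e i))\<^sup>2 / (2 * (s i)\<^sup>2) = - ((u i - e i)\<^sup>2 / (s i)\<^sup>2) / 2
      + x * (d i * (u i - e i) / (s i)\<^sup>2) - x\<^sup>2 * ((d i)\<^sup>2 / (s i)\<^sup>2) / 2"
        by (simp add: field_simps) (simp add: power2_eq_square algebra_simps)
    qed
    also have "\<dots> = - ?A / 2 + x * ?B - x\<^sup>2 * ?C / 2"
      by (simp add: sum.distrib sum_subtractf sum_distrib_left sum_divide_distrib sum_negf)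
    finally have S: "(\<Sum>i\<in>I. - (u i - (x * d i + e i))\<^sup>2 / (2 * (s i)\<^sup>2)) = - ?A / 2 + x * ?B - x\<^sup>2 * ?C / 2" .
    have P: "(\<Prod>i\<in>I. normal_density (x * d i + e i) (s i) (u i))
       = (\<Prod>i\<in>I. 1 / sqrt (2 * pi * (s i)\<^sup>2)) * exp (- ?A / 2 + x * ?B - x\<^sup>2 * ?C / 2)"
      unfolding normal_density_def S[symmetric] exp_sum[OF assms(1)] prod.distrib by simp
    have B: "?B = m u / v" using v0 by (simp add: m_def)
    \<comment> \<open>Completing the square in \<open>x\<close>: after adding the precisions of
      prior and data the quadratic coefficient is \<open>- 1 / (2 * v)\<close> and the linear one is
      \<open>b / v\<close>, so the vertex \<open>b\<close> is the posterior mean.\<close>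
    have sq: "- x\<^sup>2 / (2 * t) + (- a / 2 + x * (b / v) - x\<^sup>2 * (1 / v - 1 / t) / 2)
         = - (a - b\<^sup>2 / v) / 2 + (- (x - b)\<^sup>2 / (2 * v))" for a b t :: real
      by (simp add: power2_diff diff_divide_distrib add_divide_distrib right_diff_distrib)
    have C: "?C = 1 / v - 1 / \<tau>\<^sup>2" using vinv by simp
    have ex: "- x\<^sup>2 / (2 * \<tau>\<^sup>2) + (- ?A / 2 + x * ?B - x\<^sup>2 * ?C / 2) = - (?A - (m u)\<^sup>2 / v) / 2 + (- (x - m u)\<^sup>2 / (2 * v))"
      unfolding B C by (rule sq)
    have "normal_density 0 \<tau> x * (\<Prod>i\<in>I. normal_density (x * d i + e i) (s i) (u i))
      = 1 / sqrt (2 * pi * \<tau>\<^sup>2) * (\<Prod>i\<in>I. 1 / sqrt (2 * pi * (s i)\<^sup>2))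
        * exp (- x\<^sup>2 / (2 * \<tau>\<^sup>2) + (- ?A / 2 + x * ?B - x\<^sup>2 * ?C / 2))"
      unfolding P unfolding normal_density_def diff_0_right exp_add[of "- x\<^sup>2 / (2 * \<tau>\<^sup>2)"] by (simp only: mult_ac)
    also have "\<dots> = K u * normal_density (m u) (sqrt v) x"
      unfolding ex K_def c_def normal_density_def exp_add using v0 by simp
    finally show ?thesis .
  qed
  have [measurable]: "m \<in> borel_measurable (PiM I (\<lambda>_. borel))"
    unfolding m_def[abs_def] by measurable
  have "K \<in> borel_measurable (PiM I (\<lambda>_. borel))" unfolding K_def[abs_def] by measurable
  moreover have "0 \<le> K u" for u by (simp add: K_def cn)
  ultimately show ?thesis using eq \<open>m \<in> _\<close> by blast
qed

lemma nn_integral_normal_square: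
  assumes "0 < \<sigma>"
  shows "(\<integral>\<^sup>+x. ennreal (normal_density \<mu> \<sigma> x) * ennreal ((a - x)\<^sup>2) \<partial>lborel) = ennreal (\<sigma>\<^sup>2 + (a - \<mu>)\<^sup>2)"
proof -
  have 1: "has_bochner_integral lborel (\<lambda>x. normal_density \<mu> \<sigma> x * (x - \<mu>)\<^sup>2) (\<sigma>\<^sup>2)"
    using normal_moment_even[OF assms, of \<mu> 1] by simp
  have 2: "has_bochner_integral lborel (\<lambda>x. normal_density \<mu> \<sigma> x * (x - \<mu>)) 0"
    using normal_moment_odd[OF assms, of \<mu> 0] by simp
  have 3: "has_bochner_integral lborel (\<lambda>x. normal_density \<mu> \<sigma> x) 1"
    using assms by (simp add: has_bochner_integral_iff)
  have "has_bochner_integral lborel (\<lambda>x. normal_density \<mu> \<sigma> x * (x - \<mu>)\<^sup>2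
     + (- 2 * (a - \<mu>)) * (normal_density \<mu> \<sigma> x * (x - \<mu>)) + (a - \<mu>)\<^sup>2 * normal_density \<mu> \<sigma> x)
     (\<sigma>\<^sup>2 + (- 2 * (a - \<mu>)) * 0 + (a - \<mu>)\<^sup>2 * 1)"
    by (intro has_bochner_integral_add has_bochner_integral_mult_right 1 2 3)
  also have "(\<lambda>x. normal_density \<mu> \<sigma> x * (x - \<mu>)\<^sup>2
     + (- 2 * (a - \<mu>)) * (normal_density \<mu> \<sigma> x * (x - \<mu>)) + (a - \<mu>)\<^sup>2 * normal_density \<mu> \<sigma> x)
     = (\<lambda>x. normal_density \<mu> \<sigma> x * (a - x)\<^sup>2)"
    by (auto simp: fun_eq_iff power2_eq_square algebra_simps)
  finally have "(\<integral>\<^sup>+x. ennreal (normal_density \<mu> \<sigma> x * (a - x)\<^sup>2) \<partial>lborel) = ennreal (\<sigma>\<^sup>2 + (a - \<mu>)\<^sup>2)"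
    by (subst nn_integral_eq_integral) (auto simp: has_bochner_integral_iff)
  then show ?thesis by (simp add: ennreal_mult)
qed

text \<open>The joint density of parameter and data factors into \<open>K u\<close> and a normal
  density in \<open>x\<close> of variance \<open>v\<close>. For fixed \<open>u\<close>, the
  decomposition into variance and squared bias shows that no value \<open>H u\<close> has posterior
  mean squared error below \<open>v\<close>. As \<open>v\<close> is the same for all data,
  integrating against the marginal density \<open>K\<close> preserves the bound. The known offsets
  \<open>e\<close> shift the data and leave the information unchanged.\<close>

lemma gaussian_bayes_risk:
  fixes d e s :: "'i \<Rightarrow> real"
  assumes "finite I" "0 < \<tau>" "\<And>i. 0 < s i"
    and H: "H \<in> borel_measurable (PiM I (\<lambda>_. borel))"
  shows "ennreal (1 / (1 / \<tau>\<^sup>2 + (\<Sum>i\<in>I. (d i)\<^sup>2 / (s i)\<^sup>2)))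
     \<le> (\<integral>\<^sup>+x. (\<integral>\<^sup>+u. ennreal ((H u - x)\<^sup>2)
          \<partial>PiM I (\<lambda>i. density lborel (normal_density (x * d i + e i) (s i)))) \<partial>density lborel (normal_density 0 \<tau>))"
proof -
  define v where "v = 1 / (1 / \<tau>\<^sup>2 + (\<Sum>i\<in>I. (d i)\<^sup>2 / (s i)\<^sup>2))"
  have v0: "0 < v" unfolding v_def using \<open>0 < \<tau>\<close>
    by (intro divide_pos_pos add_pos_nonneg sum_nonneg) auto
  obtain K m where K[measurable]: "K \<in> borel_measurable (PiM I (\<lambda>_. borel))" and m[measurable]: "m \<in> borel_measurable (PiM I (\<lambda>_. borel))"
    and K0: "\<And>u. 0 \<le> K u"
    and Km: "\<And>x u. normal_density 0 \<tau> x * (\<Prod>i\<in>I. normal_density (x * d i + e i) (s i) (u i))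
       = K u * normal_density (m u) (sqrt v) x"
    using gaussian_posterior[where s=s and d=d and e=e, OF assms(1,2,3)] unfolding v_def by blast
  interpret B: product_sigma_finite "\<lambda>_::'i. lborel :: real measure"
    by (simp add: product_sigma_finite_def lborel.sigma_finite_measure_axioms)
  interpret BI: sigma_finite_measure "PiM I (\<lambda>_. lborel :: real measure)"
    by (rule B.sigma_finite[OF assms(1)])
  interpret PP: pair_sigma_finite lborel "PiM I (\<lambda>_. lborel :: real measure)" ..
  have sf: "sigma_finite_measure (density lborel (\<lambda>x. ennreal (normal_density a (s i) x)))" for a i
    using prob_space_normal_density[OF assms(3)] by (simp add: prob_space_imp_sigma_finite)
  have sets2: "sets (PiM I (\<lambda>_. lborel)) = sets (PiM I (\<lambda>_. borel :: real measure))"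
    by (intro sets_PiM_cong) auto
  note [measurable] = H
  have Hm[measurable]: "H \<in> borel_measurable (PiM I (\<lambda>_. lborel))"
     and Km'[measurable]: "K \<in> borel_measurable (PiM I (\<lambda>_. lborel))"
     and mm'[measurable]: "m \<in> borel_measurable (PiM I (\<lambda>_. lborel))"
    using H K m by (simp_all add: measurable_cong_sets[OF sets2 refl])
  let ?L = "PiM I (\<lambda>_. lborel :: real measure)"
  have nn2: "(\<lambda>z. normal_density (m (snd z)) (sqrt v) (fst z)) \<in> borel_measurable (lborel \<Otimes>\<^sub>M ?L)"
    unfolding normal_density_def by measurable
  have inner: "(\<integral>\<^sup>+u. ennreal ((H u - x)\<^sup>2) \<partial>PiM I (\<lambda>i. density lborel (normal_density (x * d i + e i) (s i))))
     = (\<integral>\<^sup>+u. ennreal (\<Prod>i\<in>I. normal_density (x * d i + e i) (s i) (u i)) * ennreal ((H u - x)\<^sup>2) \<partial>?L)" for x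
    by (subst nn_integral_PiM_density[OF assms(1) _ sf]) (auto simp: prod_ennreal)
  have pm: "(\<lambda>(x, u). ennreal (\<Prod>i\<in>I. normal_density (x * d i + e i) (s i) (u i)) * ennreal ((H u - x)\<^sup>2))
     \<in> borel_measurable (lborel \<Otimes>\<^sub>M ?L)"
    unfolding normal_density_def by measurable
  have joint: "ennreal (normal_density 0 \<tau> x) * (ennreal (\<Prod>i\<in>I. normal_density (x * d i + e i) (s i) (u i)) * z)
    = ennreal (K u) * (ennreal (normal_density (m u) (sqrt v) x) * z)" for x u z
  proof -
    have "ennreal (normal_density 0 \<tau> x) * (ennreal (\<Prod>i\<in>I. normal_density (x * d i + e i) (s i) (u i)) * z)
      = ennreal (normal_density 0 \<tau> x * (\<Prod>i\<in>I. normal_density (x * d i + e i) (s i) (u i))) * z"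
      by (simp add: ennreal_mult prod_nonneg mult.assoc)
    also have "\<dots> = ennreal (K u) * (ennreal (normal_density (m u) (sqrt v) x) * z)"
      unfolding Km by (simp add: ennreal_mult K0 mult.assoc)
    finally show ?thesis .
  qed
  \<comment> \<open>Multiplying by the posterior density, which has mass 1 in \<open>x\<close>,
    turns \<open>K\<close> back into prior times likelihood; in the other order of integration both
    factors have mass 1.\<close>
  have mass: "(\<integral>\<^sup>+u. ennreal (K u) \<partial>?L) = 1"
  proof -
    have "(\<integral>\<^sup>+u. ennreal (K u) \<partial>?L) = (\<integral>\<^sup>+u. (\<integral>\<^sup>+x. ennreal (K u) * ennreal (normal_density (m u) (sqrt v) x) \<partial>lborel) \<partial>?L)"
    proof (rule nn_integral_cong)
      fix u
      have "(\<integral>\<^sup>+x. ennreal (normal_density (m u) (sqrt v) x) \<partial>lborel) = 1"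
        using v0 by (subst nn_integral_eq_integral) auto
      then show "ennreal (K u) = (\<integral>\<^sup>+x. ennreal (K u) * ennreal (normal_density (m u) (sqrt v) x) \<partial>lborel)"
        by (subst nn_integral_cmult) auto
    qed
    also have "\<dots> = (\<integral>\<^sup>+x. (\<integral>\<^sup>+u. ennreal (K u) * ennreal (normal_density (m u) (sqrt v) x) \<partial>?L) \<partial>lborel)"
      using nn2 by (intro PP.Fubini') (auto simp: split_beta')
    also have "\<dots> = (\<integral>\<^sup>+x. ennreal (normal_density 0 \<tau> x) * (\<integral>\<^sup>+u. ennreal (\<Prod>i\<in>I. normal_density (x * d i + e i) (s i) (u i)) \<partial>?L) \<partial>lborel)"
    proof (rule nn_integral_cong)
      fix x
      show "(\<integral>\<^sup>+u. ennreal (K u) * ennreal (normal_density (m u) (sqrt v) x) \<partial>?L) = ennreal (normal_density 0 \<tau> x) * (\<integral>\<^sup>+u. ennreal (\<Prod>i\<in>I. normal_density (x * d i + e i) (s i) (u i)) \<partial>?L)"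
        using joint[of x _ 1] by (subst nn_integral_cmult[symmetric]) auto
    qed
    also have "\<dots> = (\<integral>\<^sup>+x. ennreal (normal_density 0 \<tau> x) \<partial>lborel)"
    proof (rule nn_integral_cong)
      fix x
      have "(\<integral>\<^sup>+u. ennreal (\<Prod>i\<in>I. normal_density (x * d i + e i) (s i) (u i)) \<partial>?L)
         = (\<integral>\<^sup>+u. (\<Prod>i\<in>I. ennreal (normal_density (x * d i + e i) (s i) (u i))) \<partial>?L)"
        by (simp add: prod_ennreal)
      also have "\<dots> = (\<Prod>i\<in>I. \<integral>\<^sup>+y. ennreal (normal_density (x * d i + e i) (s i) y) \<partial>lborel)"
        by (rule B.product_nn_integral_prod[OF assms(1)]) auto
      also have "\<dots> = 1"
        using assms(3) by (intro prod.neutral ballI) (subst nn_integral_eq_integral, auto)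
      finally show "ennreal (normal_density 0 \<tau> x) * (\<integral>\<^sup>+u. ennreal (\<Prod>i\<in>I. normal_density (x * d i + e i) (s i) (u i)) \<partial>?L) = ennreal (normal_density 0 \<tau> x)"
        by simp
    qed
    also have "\<dots> = 1" using assms(2) by (subst nn_integral_eq_integral) auto
    finally show ?thesis .
  qed
  have "ennreal v = (\<integral>\<^sup>+u. ennreal (K u) * ennreal v \<partial>?L)"
    by (simp add: nn_integral_multc mass)
  also have "\<dots> \<le> (\<integral>\<^sup>+u. (\<integral>\<^sup>+x. ennreal (K u) * (ennreal (normal_density (m u) (sqrt v) x) * ennreal ((H u - x)\<^sup>2)) \<partial>lborel) \<partial>?L)"
  proof (rule nn_integral_mono)
    fix u
    have "ennreal v \<le> (\<integral>\<^sup>+x. ennreal (normal_density (m u) (sqrt v) x) * ennreal ((H u - x)\<^sup>2) \<partial>lborel)"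
      using v0 by (subst nn_integral_normal_square) (auto intro: ennreal_leI)
    then show "ennreal (K u) * ennreal v \<le> (\<integral>\<^sup>+x. ennreal (K u) * (ennreal (normal_density (m u) (sqrt v) x) * ennreal ((H u - x)\<^sup>2)) \<partial>lborel)"
      by (subst nn_integral_cmult) (auto intro: mult_left_mono)
  qed
  also have "\<dots> = (\<integral>\<^sup>+x. (\<integral>\<^sup>+u. ennreal (K u) * (ennreal (normal_density (m u) (sqrt v) x) * ennreal ((H u - x)\<^sup>2)) \<partial>?L) \<partial>lborel)"
    using nn2 by (intro PP.Fubini') (auto simp: split_beta')
  also have "\<dots> = (\<integral>\<^sup>+x. ennreal (normal_density 0 \<tau> x) * (\<integral>\<^sup>+u. ennreal ((H u - x)\<^sup>2)
          \<partial>PiM I (\<lambda>i. density lborel (normal_density (x * d i + e i) (s i)))) \<partial>lborel)"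
    unfolding inner joint[symmetric]
    by (intro nn_integral_cong nn_integral_cmult) (auto simp: normal_density_def)
  also have "\<dots> = (\<integral>\<^sup>+x. (\<integral>\<^sup>+u. ennreal ((H u - x)\<^sup>2)
          \<partial>PiM I (\<lambda>i. density lborel (normal_density (x * d i + e i) (s i)))) \<partial>density lborel (normal_density 0 \<tau>))"
    unfolding inner using sigma_finite_measure.borel_measurable_nn_integral[OF B.sigma_finite[OF assms(1)] pm]
    by (subst nn_integral_density) auto
  finally show ?thesis unfolding v_def .
qed

section \<open>Approximation by cylinder functions\<close>

text \<open>Membership in the L1 closure of the functions of finitely many coordinates.
  Integrability of the approximant is demanded because the Bochner integral of a non-integrable
  function is 0 by default, which would make the distance condition vacuous.\<close>

definition cylinder_approximable ::
  "('i \<Rightarrow> real) measure \<Rightarrow> 'i set \<Rightarrow> (('i \<Rightarrow> real) \<Rightarrow> real) \<Rightarrow> bool" where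
  "cylinder_approximable N I f \<longleftrightarrow> (\<forall>e>0. \<exists>G h. finite G \<and> G \<subseteq> I \<and> h \<in> borel_measurable (PiM G (\<lambda>_. borel)) \<and>
     integrable N (\<lambda>y. h (restrict y G)) \<and> (\<integral>y. \<bar>f y - h (restrict y G)\<bar> \<partial>N) < e)"

lemma cylinder_approximableI:
  assumes "\<And>e. 0 < e \<Longrightarrow> \<exists>G h. finite G \<and> G \<subseteq> I \<and> h \<in> borel_measurable (PiM G (\<lambda>_. borel)) \<and>
     integrable N (\<lambda>y. h (restrict y G)) \<and> (\<integral>y. \<bar>f y - h (restrict y G)\<bar> \<partial>N) < e"
  shows "cylinder_approximable N I f"
  using assms unfolding cylinder_approximable_def by blast

text \<open>\<open>\<Omega>\<close> stands for a path property such as being cadlag. It constrains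
  uncountably many coordinates and need not be measurable in the product, hence the trace
  \<sigma>-algebra.\<close>

locale path_measure = prob_space N for N :: "('i \<Rightarrow> real) measure" +
  fixes I :: "'i set" and \<Omega> :: "('i \<Rightarrow> real) set"
  assumes sets_N: "sets N = sets (restrict_space (PiM I (\<lambda>_. borel)) \<Omega>)"
begin

lemma coord_measurable:
  assumes "i \<in> I" shows "(\<lambda>y. y i) \<in> borel_measurable N"
proof -
  have "(\<lambda>y. y i) \<in> borel_measurable (restrict_space (PiM I (\<lambda>_. borel)) \<Omega>)"
    by (intro measurable_restrict_space1 measurable_component_singleton assms)
  then show ?thesis by (simp add: measurable_cong_sets[OF sets_N refl])
qed

lemma restrict_measurable:
  assumes "G \<subseteq> I" shows "(\<lambda>y. restrict y G) \<in> N \<rightarrow>\<^sub>M PiM G (\<lambda>_. borel)"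
  using assms by (intro measurable_restrict coord_measurable) auto

text \<open>One closure property for several operations: complements (\<open>1 - a\<close>), finite
  unions (\<open>max\<close>), scaling and sums are all Lipschitz. The Lipschitz bound transfers
  both the L1 distance and integrability.\<close>

lemma cylinder_approximable_lipschitz2:
  fixes F :: "real \<Rightarrow> real \<Rightarrow> real"
  assumes f: "integrable N f" "cylinder_approximable N I f"
    and g: "integrable N g" "cylinder_approximable N I g"
    and F[measurable]: "(\<lambda>(a, b). F a b) \<in> borel_measurable (borel \<Otimes>\<^sub>M borel)"
    and lip: "\<And>a b a' b'. \<bar>F a b - F a' b'\<bar> \<le> C * (\<bar>a - a'\<bar> + \<bar>b - b'\<bar>)"
  shows "cylinder_approximable N I (\<lambda>y. F (f y) (g y))"
proof (rule cylinder_approximableI)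
  fix e :: real assume e: "0 < e"
  have C0: "0 \<le> C" using lip[of 0 0 1 0] abs_ge_zero[of "F 0 0 - F 1 0"] by auto
  \<comment> \<open>\<open>C + 1\<close> instead of \<open>C\<close> keeps the denominator positive
    when \<open>C = 0\<close>.\<close>
  define \<delta> where "\<delta> = e / (2 * (C + 1))"
  have \<delta>: "0 < \<delta>" "C * (2 * \<delta>) < e" using e C0 by (auto simp: \<delta>_def field_simps)
  obtain G1 h1 where 1: "finite G1" "G1 \<subseteq> I" "h1 \<in> borel_measurable (PiM G1 (\<lambda>_. borel))"
     "integrable N (\<lambda>y. h1 (restrict y G1))" "(\<integral>y. \<bar>f y - h1 (restrict y G1)\<bar> \<partial>N) < \<delta>"
    using f(2) \<delta>(1) unfolding cylinder_approximable_def by blast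
  obtain G2 h2 where 2: "finite G2" "G2 \<subseteq> I" "h2 \<in> borel_measurable (PiM G2 (\<lambda>_. borel))"
     "integrable N (\<lambda>y. h2 (restrict y G2))" "(\<integral>y. \<bar>g y - h2 (restrict y G2)\<bar> \<partial>N) < \<delta>"
    using g(2) \<delta>(1) unfolding cylinder_approximable_def by blast
  note [measurable] = 1(3) 2(3)
  define h where "h y = F (h1 (restrict y G1)) (h2 (restrict y G2))" for y
  have r1: "(\<lambda>y. restrict y G1) \<in> PiM (G1 \<union> G2) (\<lambda>_. borel :: real measure) \<rightarrow>\<^sub>M PiM G1 (\<lambda>_. borel)"
    and r2: "(\<lambda>y. restrict y G2) \<in> PiM (G1 \<union> G2) (\<lambda>_. borel :: real measure) \<rightarrow>\<^sub>M PiM G2 (\<lambda>_. borel)"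
    by (intro measurable_restrict_subset; auto)+
  have hm[measurable]: "h \<in> borel_measurable (PiM (G1 \<union> G2) (\<lambda>_. borel))"
    unfolding h_def[abs_def]
    using measurable_compose[OF measurable_Pair[OF measurable_compose[OF r1 1(3)] measurable_compose[OF r2 2(3)]] F] by simp
  have hr: "h (restrict y (G1 \<union> G2)) = F (h1 (restrict y G1)) (h2 (restrict y G2))" for y
    by (simp add: h_def Int_absorb1 Int_commute Int_Un_distrib)
  have mN: "(\<lambda>y. h (restrict y (G1 \<union> G2))) \<in> borel_measurable N"
    using 1(2) 2(2) by (intro measurable_compose[OF restrict_measurable hm]) auto
  have bound: "\<bar>F a b\<bar> \<le> \<bar>F 0 0\<bar> + C * (\<bar>a\<bar> + \<bar>b\<bar>)" for a b
    using lip[of a b 0 0] by auto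
  have intb: "integrable N (\<lambda>y. \<bar>F 0 0\<bar> + C * (\<bar>h1 (restrict y G1)\<bar> + \<bar>h2 (restrict y G2)\<bar>))"
    using 1(4) 2(4) by auto
  have int: "integrable N (\<lambda>y. h (restrict y (G1 \<union> G2)))"
    by (rule Bochner_Integration.integrable_bound[OF intb mN])
       (use bound C0 in \<open>auto simp: hr intro!: order.trans[OF bound]\<close>)
  have intfb: "integrable N (\<lambda>y. \<bar>F 0 0\<bar> + C * (\<bar>f y\<bar> + \<bar>g y\<bar>))"
    using f(1) g(1) by auto
  have mf[measurable]: "f \<in> borel_measurable N" "g \<in> borel_measurable N" using f(1) g(1) by auto
  have intf: "integrable N (\<lambda>y. F (f y) (g y))"
  proof (rule Bochner_Integration.integrable_bound[OF intfb])
    show "(\<lambda>y. F (f y) (g y)) \<in> borel_measurable N"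
      using measurable_compose[OF measurable_Pair[OF mf] F] by simp
  qed (use bound C0 in \<open>auto intro!: order.trans[OF bound]\<close>)
  have "(\<integral>y. \<bar>F (f y) (g y) - h (restrict y (G1 \<union> G2))\<bar> \<partial>N)
     \<le> (\<integral>y. C * (\<bar>f y - h1 (restrict y G1)\<bar> + \<bar>g y - h2 (restrict y G2)\<bar>) \<partial>N)"
    using lip intf int f(1) g(1) 1(4) 2(4) by (intro integral_mono) (auto simp: hr)
  also have "\<dots> = C * ((\<integral>y. \<bar>f y - h1 (restrict y G1)\<bar> \<partial>N) + (\<integral>y. \<bar>g y - h2 (restrict y G2)\<bar> \<partial>N))"
    using f(1) g(1) 1(4) 2(4) by (subst Bochner_Integration.integral_mult_right_zero, subst Bochner_Integration.integral_add) auto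
  also have "\<dots> \<le> C * (2 * \<delta>)" using 1(5) 2(5) C0 by (intro mult_left_mono) auto
  also have "\<dots> < e" by (rule \<delta>(2))
  finally show "\<exists>G h. finite G \<and> G \<subseteq> I \<and> h \<in> borel_measurable (PiM G (\<lambda>_. borel)) \<and>
     integrable N (\<lambda>y. h (restrict y G)) \<and> (\<integral>y. \<bar>F (f y) (g y) - h (restrict y G)\<bar> \<partial>N) < e"
    using 1(1,2) 2(1,2) hm int by (intro exI[of _ "G1 \<union> G2"] exI[of _ h]) auto
qed

lemma cylinder_approximable_cong:
  assumes "cylinder_approximable N I f" and "\<And>y. y \<in> space N \<Longrightarrow> f y = g y"
  shows "cylinder_approximable N I g"
proof -
  have "(\<integral>y. \<bar>g y - h (restrict y G)\<bar> \<partial>N) = (\<integral>y. \<bar>f y - h (restrict y G)\<bar> \<partial>N)" for h G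
    using assms(2) by (intro Bochner_Integration.integral_cong) auto
  then show ?thesis using assms(1) by (simp add: cylinder_approximable_def)
qed

lemma cylinder_approximable_limit:
  assumes f: "integrable N f" and s: "\<And>i :: nat. integrable N (s i)" "\<And>i. cylinder_approximable N I (s i)"
    and lim: "(\<lambda>i. \<integral>y. \<bar>f y - s i y\<bar> \<partial>N) \<longlonglongrightarrow> 0"
  shows "cylinder_approximable N I f"
proof (rule cylinder_approximableI)
  fix e :: real assume e: "0 < e"
  then have "\<forall>\<^sub>F i in sequentially. (\<integral>y. \<bar>f y - s i y\<bar> \<partial>N) < e / 2"
    using order_tendstoD(2)[OF lim, of "e / 2"] by simp
  then obtain i where i: "(\<integral>y. \<bar>f y - s i y\<bar> \<partial>N) < e / 2"
    by (auto simp: eventually_sequentially)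
  obtain G h where G: "finite G" "G \<subseteq> I" "h \<in> borel_measurable (PiM G (\<lambda>_. borel))"
     "integrable N (\<lambda>y. h (restrict y G))" "(\<integral>y. \<bar>s i y - h (restrict y G)\<bar> \<partial>N) < e / 2"
    using s(2)[of i] half_gt_zero[OF e] unfolding cylinder_approximable_def by blast
  have "(\<integral>y. \<bar>f y - h (restrict y G)\<bar> \<partial>N) \<le> (\<integral>y. \<bar>f y - s i y\<bar> + \<bar>s i y - h (restrict y G)\<bar> \<partial>N)"
    using f s(1) G(4) by (intro integral_mono) auto
  also have "\<dots> = (\<integral>y. \<bar>f y - s i y\<bar> \<partial>N) + (\<integral>y. \<bar>s i y - h (restrict y G)\<bar> \<partial>N)"
    using f s(1) G(4) by (intro Bochner_Integration.integral_add) auto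
  also have "\<dots> < e" using i G(5) by simp
  finally show "\<exists>G h. finite G \<and> G \<subseteq> I \<and> h \<in> borel_measurable (PiM G (\<lambda>_. borel)) \<and>
     integrable N (\<lambda>y. h (restrict y G)) \<and> (\<integral>y. \<bar>f y - h (restrict y G)\<bar> \<partial>N) < e"
    using G by blast
qed

lemma cylinder_approximable_cylinder:
  assumes "finite G" "G \<subseteq> I" "h \<in> borel_measurable (PiM G (\<lambda>_. borel))" "integrable N (\<lambda>y. h (restrict y G))"
    and "\<And>y. y \<in> space N \<Longrightarrow> f y = h (restrict y G)"
  shows "cylinder_approximable N I f"
proof (rule cylinder_approximableI)
  fix e :: real assume "0 < e"
  moreover have "(\<integral>y. \<bar>f y - h (restrict y G)\<bar> \<partial>N) = (\<integral>y. 0 \<partial>N)"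
    using assms(5) by (intro Bochner_Integration.integral_cong) auto
  ultimately show "\<exists>G h. finite G \<and> G \<subseteq> I \<and> h \<in> borel_measurable (PiM G (\<lambda>_. borel)) \<and>
     integrable N (\<lambda>y. h (restrict y G)) \<and> (\<integral>y. \<bar>f y - h (restrict y G)\<bar> \<partial>N) < e"
    using assms by (intro exI[of _ G] exI[of _ h]) auto
qed

text \<open>Induction along the generation of the product \<sigma>-algebra: one-coordinate events
  are cylinders, complements and possibly overlapping finite unions are Lipschitz operations on
  indicators, and the finite unions exhaust a countable one in L1 by dominated convergence.\<close>

lemma cylinder_approximable_indicator:
  assumes "A \<in> sets (PiM I (\<lambda>_. borel))"
  shows "A \<inter> space N \<in> sets N \<and> cylinder_approximable N I (indicator (A \<inter> space N))"
proof -
  have spN: "space N = \<Omega> \<inter> space (PiM I (\<lambda>_. borel))"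
    using sets_eq_imp_space_eq[OF sets_N] by (simp add: space_restrict_space)
  have inter: "A \<inter> space N \<in> sets N" if "A \<in> sets (PiM I (\<lambda>_. borel))" for A
  proof -
    have "A \<inter> space N = \<Omega> \<inter> A" using sets.sets_into_space[OF that] spN by auto
    then show ?thesis unfolding sets_N using that by (auto simp: sets_restrict_space)
  qed
  have ind: "integrable N (indicator (A \<inter> space N) :: _ \<Rightarrow> real)" if "A \<in> sets (PiM I (\<lambda>_. borel))" for A
    using inter[OF that] by (intro integrable_real_indicator emeasure_finite) (auto simp: less_top[symmetric])
  have "A \<in> sigma_sets (\<Pi>\<^sub>E i\<in>I. UNIV) {{f \<in> \<Pi>\<^sub>E i\<in>I. UNIV. f i \<in> B} |i B. i \<in> I \<and> B \<in> sets (borel :: real measure)}"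
    using assms by (simp add: sets_PiM_single)
  then have "cylinder_approximable N I (indicator (A \<inter> space N))"
  proof (induction A rule: sigma_sets.induct)
    case (Basic A)
    then obtain i B where A: "A = {f \<in> \<Pi>\<^sub>E i\<in>I. UNIV. f i \<in> B}" "i \<in> I" "B \<in> sets borel" by blast
    show ?case
    proof (rule cylinder_approximable_cylinder[of "{i}" "\<lambda>y. indicator B (y i)"])
      show "(\<lambda>y. indicator B (y i)) \<in> borel_measurable (PiM {i} (\<lambda>_. borel))"
        using A(3) by measurable
      have "(\<lambda>y. indicator B (y i) :: real) \<in> borel_measurable N"
        using coord_measurable[OF A(2)] A(3) by measurable
      then show "integrable N (\<lambda>y. indicator B ((restrict y {i}) i) :: real)"
        by (intro integrable_const_bound[of _ 1]) (auto simp: indicator_def)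
    qed (use A spN in \<open>auto simp: indicator_def space_PiM\<close>)
  next
    case Empty
    show ?case
      by (rule cylinder_approximable_cylinder[of "{}" "\<lambda>_. 0"]) auto
  next
    case (Compl A)
    have A: "A \<in> sets (PiM I (\<lambda>_. borel))" using Compl(1) by (simp add: sets_PiM_single)
    have "cylinder_approximable N I (\<lambda>y. (\<lambda>a b. 1 - a) (indicator (A \<inter> space N) y) (indicator (A \<inter> space N) y :: real))"
      by (rule cylinder_approximable_lipschitz2[where C=1]) (use ind[OF A] Compl(2) in auto)
    then show ?case
      by (rule cylinder_approximable_cong) (auto simp: indicator_def spN space_PiM)
  next
    case (Union A)
    have A: "A i \<in> sets (PiM I (\<lambda>_. borel))" for i using Union(1)[of i] by (simp add: sets_PiM_single)
    have fin: "cylinder_approximable N I (indicator ((\<Union>i<m. A i) \<inter> space N))" for m :: nat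
    proof (induction m)
      case 0
      show ?case by (rule cylinder_approximable_cylinder[of "{}" "\<lambda>_. 0"]) auto
    next
      case (Suc m)
      have U: "(\<Union>i<m. A i) \<in> sets (PiM I (\<lambda>_. borel))" using A by auto
      have "cylinder_approximable N I (\<lambda>y. max (indicator ((\<Union>i<m. A i) \<inter> space N) y) (indicator (A m \<inter> space N) y :: real))"
        by (rule cylinder_approximable_lipschitz2[where C=1]) (use ind[OF A] ind[OF U] Suc Union in auto)
      also have "(\<lambda>y. max (indicator ((\<Union>i<m. A i) \<inter> space N) y) (indicator (A m \<inter> space N) y :: real))
         = indicator ((\<Union>i<Suc m. A i) \<inter> space N)"
        by (auto simp: fun_eq_iff indicator_def lessThan_Suc max_def)
      finally show ?case .
    qed
    have U: "(\<Union>i<m. A i) \<in> sets (PiM I (\<lambda>_. borel))" for m :: nat using A by auto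
    have U': "(\<Union>i. A i) \<in> sets (PiM I (\<lambda>_. borel))" using A by auto
    show ?case
    proof (rule cylinder_approximable_limit[where s = "\<lambda>m. indicator ((\<Union>i<m. A i) \<inter> space N)"])
      show "(\<lambda>m. \<integral>y. \<bar>indicator ((\<Union>i. A i) \<inter> space N) y - indicator ((\<Union>i<m. A i) \<inter> space N) y :: real\<bar> \<partial>N) \<longlonglongrightarrow> 0"
      proof -
        have "(\<lambda>m. \<integral>y. \<bar>indicator ((\<Union>i. A i) \<inter> space N) y - indicator ((\<Union>i<m. A i) \<inter> space N) y\<bar> \<partial>N) \<longlonglongrightarrow> (\<integral>y. (0::real) \<partial>N)"
        proof (rule integral_dominated_convergence[where w = "\<lambda>_. 1"])
          show "AE y in N. (\<lambda>m. \<bar>indicator ((\<Union>i. A i) \<inter> space N) y - indicator ((\<Union>i<m. A i) \<inter> space N) y\<bar>) \<longlonglongrightarrow> (0::real)"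
          proof (rule AE_I2)
            fix y assume y: "y \<in> space N"
            have "\<forall>\<^sub>F m in sequentially. \<bar>indicator ((\<Union>i. A i) \<inter> space N) y - indicator ((\<Union>i<m. A i) \<inter> space N) y :: real\<bar> = 0"
            proof (cases "\<exists>i. y \<in> A i")
              case True
              then obtain i where "y \<in> A i" by blast
              then show ?thesis using y
                by (intro eventually_sequentiallyI[of "Suc i"]) (auto simp: indicator_def intro: Suc_le_lessD)
            qed (auto simp: indicator_def)
            then show "(\<lambda>m. \<bar>indicator ((\<Union>i. A i) \<inter> space N) y - indicator ((\<Union>i<m. A i) \<inter> space N) y\<bar>) \<longlonglongrightarrow> (0::real)"
              by (rule tendsto_eventually)
          qed
        next
          show "(\<lambda>y. \<bar>indicator ((\<Union>i. A i) \<inter> space N) y - indicator ((\<Union>i<m. A i) \<inter> space N) y :: real\<bar>) \<in> borel_measurable N" for m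
            using ind[OF U[of m]] ind[OF U'] by auto
        qed (auto simp: indicator_def)
        then show ?thesis by simp
      qed
    qed (use fin ind[OF U] ind[OF U'] in auto)
  qed
  then show ?thesis using inter assms by blast
qed

lemma cylinder_approximable_integrable:
  assumes "integrable N f"
  shows "cylinder_approximable N I f"
  using assms
proof (induction rule: integrable_induct)
  case (base A c)
  from base(1) obtain B where B: "A = \<Omega> \<inter> B" "B \<in> sets (PiM I (\<lambda>_. borel))"
    unfolding sets_N by (auto simp: sets_restrict_space)
  have "A = B \<inter> space N"
    using B sets.sets_into_space[OF B(2)] sets_eq_imp_space_eq[OF sets_N] by (auto simp: space_restrict_space)
  then have ap: "cylinder_approximable N I (indicator A)"
    using cylinder_approximable_indicator[OF B(2)] by simp
  have int: "integrable N (indicator A :: _ \<Rightarrow> real)" using base by (intro integrable_real_indicator) auto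
  have lip: "\<bar>a * c - a' * c\<bar> \<le> \<bar>c\<bar> * (\<bar>a - a'\<bar> + \<bar>b - b'\<bar>)" for a a' b b' :: real
    by (simp add: left_diff_distrib[symmetric] abs_mult distrib_left mult.commute)
  have "cylinder_approximable N I (\<lambda>y. indicator A y * c)"
    by (rule cylinder_approximable_lipschitz2[where F = "\<lambda>a b. a * c", OF int ap int ap _ lip]) measurable
  then show ?case by (simp add: real_scaleR_def)
next
  case (add f g)
  show ?case
    by (rule cylinder_approximable_lipschitz2[where C=1 and F="(+)" and f=f and g=g]) (use add in auto)
next
  case (lim f s)
  show ?case
  proof (rule cylinder_approximable_limit[OF lim(4), where s=s])
    have "(\<lambda>i. \<integral>y. \<bar>f y - s i y\<bar> \<partial>N) \<longlonglongrightarrow> (\<integral>y. (0::real) \<partial>N)"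
    \<comment> \<open>The simple functions of \<open>integrable_induct\<close> satisfy
      \<open>norm (s i y) \<le> 2 * norm (f y)\<close>, so the difference is at most three times
      \<open>norm (f y)\<close>.\<close>
    proof (rule integral_dominated_convergence[where w = "\<lambda>y. 3 * norm (f y)"])
      show "AE y in N. (\<lambda>i. \<bar>f y - s i y\<bar>) \<longlonglongrightarrow> 0"
      proof (rule AE_I2)
        fix y assume "y \<in> space N"
        from tendsto_diff[OF tendsto_const[of "f y"] lim(2)[OF this]]
        show "(\<lambda>i. \<bar>f y - s i y\<bar>) \<longlonglongrightarrow> 0" by (auto intro: tendsto_rabs_zero)
      qed
      show "AE y in N. norm \<bar>f y - s i y\<bar> \<le> 3 * norm (f y)" for i
      proof (rule AE_I2)
        fix y assume "y \<in> space N"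
        from lim(3)[OF this, of i] show "norm \<bar>f y - s i y\<bar> \<le> 3 * norm (f y)" by auto
      qed
    qed (use lim in auto)
    then show "(\<lambda>i. \<integral>y. \<bar>f y - s i y\<bar> \<partial>N) \<longlonglongrightarrow> 0" by simp
  qed (use lim in auto)
qed

end

section \<open>Gaussian shift of a Brownian path\<close>

text \<open>Adding 0 anchors the path at a known value, and adding \<open>T\<close> makes the grid
  cover the whole observation interval. Beyond index \<open>m\<close> the sequence stays at
  \<open>T\<close>, so that it is monotone on all of \<open>nat\<close>, as
  \<open>independent_increments\<close> asks.\<close>

lemma finite_time_grid:
  fixes T :: real
  assumes "finite F" "F \<subseteq> {0..T}" "0 < T"
  obtains t m where "0 < m" "t 0 = 0" "t m = T" "mono t" "\<forall>i<m. t i < t (Suc i)"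
    "\<forall>i. t i \<in> {0..T}" "F \<subseteq> t ` {..m}"
proof -
  define xs where "xs = sorted_list_of_set (insert 0 (insert T F))"
  have fin: "finite (insert 0 (insert T F))" using assms by simp
  have set: "set xs = insert 0 (insert T F)" and srt: "sorted_wrt (<) xs"
    unfolding xs_def using fin by (simp_all del: sorted_list_of_set_insert_remove)
  define m where "m = length xs - 1"
  have "card (set xs) \<ge> card {0, T}" unfolding set using fin by (intro card_mono) auto
  then have "2 \<le> length xs" using assms(3) card_length[of xs] by simp
  then have m: "0 < m" "m < length xs" "length xs = Suc m" by (auto simp: m_def)
  have le: "xs ! i \<le> xs ! j" if "i \<le> j" "j \<le> m" for i j
    using that m(3) srt by (cases "i = j") (auto simp: sorted_wrt_iff_nth_less less_imp_le)
  have mem: "xs ! i \<in> {0..T}" if "i \<le> m" for i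
    using nth_mem[of i xs] that m(3) assms(2,3) unfolding set by auto
  have "0 \<in> set xs" "T \<in> set xs" by (auto simp: set)
  then obtain i0 iT where "i0 \<le> m" "xs ! i0 = 0" "iT \<le> m" "xs ! iT = T"
    using m(3) by (metis in_set_conv_nth less_Suc_eq_le)
  then have ends: "xs ! 0 = 0" "xs ! m = T"
    using le[of 0 i0] le[of iT m] mem[of 0] mem[of m] by auto
  define t where "t i = (if i \<le> m then xs ! i else T)" for i
  show ?thesis
  proof (rule that[of m t])
    show "mono t"
      using le mem by (intro monoI) (auto simp: t_def)
    show "\<forall>i<m. t i < t (Suc i)"
      using srt m(3) by (auto simp: t_def sorted_wrt_iff_nth_less)
    show "F \<subseteq> t ` {..m}"
    proof
      fix x assume "x \<in> F"
      then have "x \<in> set xs" by (simp add: set)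
      then obtain i where "i < length xs" "xs ! i = x" by (auto simp: in_set_conv_nth)
      then show "x \<in> t ` {..m}" using m(3) by (intro image_eqI[of _ _ i]) (auto simp: t_def)
    qed
    show "\<forall>i. t i \<in> {0..T}" using mem assms(3) by (auto simp: t_def)
  qed (use m ends in \<open>auto simp: t_def\<close>)
qed

lemma continuous_imp_cadlag_on:
  assumes "continuous_on I f"
  shows "cadlag_on I f"
proof -
  have "(f \<longlongrightarrow> f t) (at t within I)" if "t \<in> I" for t
    using assms that by (simp add: continuous_on_def)
  then show ?thesis unfolding cadlag_on_def by (meson tendsto_within_subset inf_le1)
qed

lemma cadlag_on_add_continuous:
  assumes "continuous_on I f" "cadlag_on I g"
  shows "cadlag_on I (\<lambda>t. f t + g t)"
proof -
  have f: "(f \<longlongrightarrow> f t) (at t within I \<inter> J)" if "t \<in> I" for t J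
    using assms(1) that by (auto simp: continuous_on_def intro: tendsto_within_subset)
  show ?thesis
    unfolding cadlag_on_def
  proof (intro conjI ballI)
    fix t assume t: "t \<in> I"
    have "(g \<longlongrightarrow> g t) (at t within I \<inter> {t..})" using assms(2) t by (simp add: cadlag_on_def)
    then show "((\<lambda>t. f t + g t) \<longlongrightarrow> f t + g t) (at t within I \<inter> {t..})"
      by (intro tendsto_add f t)
    obtain l where "(g \<longlongrightarrow> l) (at t within I \<inter> {..<t})"
      using assms(2) t unfolding cadlag_on_def by blast
    then have "((\<lambda>t. f t + g t) \<longlongrightarrow> f t + l) (at t within I \<inter> {..<t})"
      by (intro tendsto_add f t)
    then show "\<exists>l. ((\<lambda>t. f t + g t) \<longlongrightarrow> l) (at t within I \<inter> {..<t})" by blast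
  qed
qed

lemma cadlag_on_restrict [simp]: "cadlag_on I (restrict f I) \<longleftrightarrow> cadlag_on I f"
proof -
  have "(restrict f I \<longlongrightarrow> l) (at t within I \<inter> J) \<longleftrightarrow> (f \<longlongrightarrow> l) (at t within I \<inter> J)" for l t J
    by (intro tendsto_cong) (auto simp: eventually_at_filter)
  then show ?thesis by (simp add: cadlag_on_def cong: conj_cong)
qed

lemma space_skorokhod_space:
  "space (skorokhod_space T) = {x \<in> extensional {0..T}. cadlag_on {0..T} x}"
  by (auto simp: skorokhod_space_def space_restrict_space space_PiM PiE_def)

lemma measurable_skorokhod_space:
  assumes "\<And>t. t \<in> {0..T} \<Longrightarrow> (\<lambda>z. f z t) \<in> borel_measurable A"
    and "\<And>z. z \<in> space A \<Longrightarrow> cadlag_on {0..T} (f z)"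
  shows "(\<lambda>z. \<lambda>t\<in>{0..T}. f z t) \<in> A \<rightarrow>\<^sub>M skorokhod_space T"
  unfolding skorokhod_space_def
proof (rule measurable_restrict_space2)
  show "(\<lambda>z. \<lambda>t\<in>{0..T}. f z t) \<in> A \<rightarrow>\<^sub>M PiM {0..T} (\<lambda>_. borel)"
    using assms(1) by (intro measurable_restrict) auto
qed (use assms(2) in auto)

lemma measurable_skorokhod_coord:
  assumes "t \<in> {0..T}"
  shows "(\<lambda>x. x t) \<in> borel_measurable (skorokhod_space T)"
  unfolding skorokhod_space_def
  by (intro measurable_restrict_space1 measurable_component_singleton assms)

text \<open>Cauchy-Schwarz against the constant 1, read off from the nonnegative integral of
  \<open>(f t - c)\<^sup>2\<close> with \<open>c\<close> the mean value of \<open>f\<close>.\<close>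

lemma integral_square_le:
  fixes f :: "real \<Rightarrow> real"
  assumes f: "continuous_on {a..b} f" and "a < b"
  shows "(integral {a..b} f)\<^sup>2 / (b - a) \<le> integral {a..b} (\<lambda>t. (f t)\<^sup>2)"
proof -
  define c where "c = integral {a..b} f / (b - a)"
  have i1: "f integrable_on {a..b}" and i2: "(\<lambda>t. (f t)\<^sup>2) integrable_on {a..b}"
    using f by (auto intro!: integrable_continuous_real continuous_intros)
  have "((\<lambda>t. (f t)\<^sup>2 - (2 * c) * f t + c\<^sup>2) has_integral
     integral {a..b} (\<lambda>t. (f t)\<^sup>2) - (2 * c) * integral {a..b} f + (b - a) * c\<^sup>2) {a..b}"
    using i1 i2 \<open>a < b\<close> has_integral_const_real[of "c\<^sup>2" a b]
    by (intro has_integral_add has_integral_diff has_integral_mult_right) (auto simp: integrable_integral)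
  then have "0 \<le> integral {a..b} (\<lambda>t. (f t)\<^sup>2) - (2 * c) * integral {a..b} f + (b - a) * c\<^sup>2"
  proof (rule has_integral_nonneg)
    fix t
    have "(f t)\<^sup>2 - 2 * c * f t + c\<^sup>2 = (f t - c)\<^sup>2" by (simp add: power2_diff)
    then show "0 \<le> (f t)\<^sup>2 - 2 * c * f t + c\<^sup>2" by simp
  qed
  moreover have "(2 * c) * integral {a..b} f - (b - a) * c\<^sup>2 = (integral {a..b} f)\<^sup>2 / (b - a)"
  proof -
    have "integral {a..b} f = c * (b - a)" "b - a \<noteq> 0" using \<open>a < b\<close> by (auto simp: c_def)
    then show ?thesis by (simp add: power2_eq_square)
  qed
  ultimately show ?thesis by linarith
qed

text \<open>Discretisation loses information: up to the noise intensity, the left side is the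
  information about the amplitude of \<open>f\<close> carried by the increments over the grid, the
  right side that carried by the full path.\<close>

lemma grid_energy_le:
  fixes f :: "real \<Rightarrow> real" and t :: "nat \<Rightarrow> real"
  assumes f: "continuous_on {0..t m} f" and t0: "t 0 = 0" and "\<And>i. i < m \<Longrightarrow> t i < t (Suc i)"
  shows "(\<Sum>i<m. (integral {0..t (Suc i)} f - integral {0..t i} f)\<^sup>2 / (t (Suc i) - t i))
     \<le> integral {0..t m} (\<lambda>x. (f x)\<^sup>2)"
  using assms(1,3)
proof (induction m)
  case (Suc m)
  have lt: "t m < t (Suc m)" using Suc.prems by auto
  have nn: "0 \<le> t i" if "i \<le> m" for i
    using that
  proof (induction i)
    case (Suc i)
    then show ?case using Suc_le_lessD[OF Suc.prems] Suc.IH \<open>\<And>i. i < Suc m \<Longrightarrow> t i < t (Suc i)\<close>[of i] by simp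
  qed (simp add: t0)
  have c1: "continuous_on {0..t m} f" and c2: "continuous_on {t m..t (Suc m)} f"
    using Suc.prems(1) lt nn[of m] by (auto intro: continuous_on_subset)
  have "integral {0..t (Suc m)} f - integral {0..t m} f = integral {t m..t (Suc m)} f"
    using Suc.prems(1) lt nn[of m] Henstock_Kurzweil_Integration.integral_combine[of 0 "t m" "t (Suc m)" f]
    by (auto simp: integrable_continuous_real)
  then have "(integral {0..t (Suc m)} f - integral {0..t m} f)\<^sup>2 / (t (Suc m) - t m)
     \<le> integral {t m..t (Suc m)} (\<lambda>x. (f x)\<^sup>2)"
    using integral_square_le[OF c2 lt] by simp
  moreover have sq: "(\<lambda>x. (f x)\<^sup>2) integrable_on {0..t (Suc m)}"
    using Suc.prems(1) by (auto intro!: integrable_continuous_real continuous_intros)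
  moreover have "integral {0..t (Suc m)} (\<lambda>x. (f x)\<^sup>2) = integral {0..t m} (\<lambda>x. (f x)\<^sup>2) + integral {t m..t (Suc m)} (\<lambda>x. (f x)\<^sup>2)"
    using Suc.prems(1) lt nn[of m] Henstock_Kurzweil_Integration.integral_combine[of 0 "t m" "t (Suc m)" "\<lambda>x. (f x)\<^sup>2"] sq
    by auto
  ultimately show ?case using Suc.IH[OF c1] Suc.prems(2) by simp
qed (simp add: t0)

text \<open>Over a grid containing \<open>G\<close> the increments of the path are independent
  normal variables with means affine in \<open>x\<close>, and partial sums recover the path at the
  times in \<open>G\<close>. The estimator is therefore a function of these increments and
  \<open>gaussian_bayes_risk\<close> applies.\<close>

lemma brownian_bayes_risk_cylinder:
  fixes M :: "'a measure" and \<phi> \<Psi> :: "real \<Rightarrow> real"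
  assumes M: "prob_space M" and w: "brownian_motion M w"
    and pos: "0 < T" "0 < s" "0 < \<tau>"
    and \<phi>: "continuous_on {0..T} \<phi>" "integral {0..T} (\<lambda>t. (\<phi> t)\<^sup>2) \<le> V"
    and G: "finite G" "G \<subseteq> {0..T}" and h: "h \<in> borel_measurable (PiM G (\<lambda>_. borel))"
  shows "ennreal (1 / (1 / \<tau>\<^sup>2 + V / s\<^sup>2)) \<le>
    (\<integral>\<^sup>+x. (\<integral>\<^sup>+\<omega>. ennreal ((h (\<lambda>t\<in>G. x * integral {0..t} \<phi> + \<Psi> t + s * w t \<omega>) - x)\<^sup>2) \<partial>M)
      \<partial>density lborel (normal_density 0 \<tau>))"
proof -
  interpret prob_space M by (rule M)
  obtain t m where tm: "0 < m" "t 0 = 0" "t m = T" "mono t" "\<forall>i<m. t i < t (Suc i)"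
    "\<forall>i. t i \<in> {0..T}" "G \<subseteq> t ` {..m}"
    by (rule finite_time_grid[OF G pos(1)]) (rule that; assumption)
  have t: "0 < m" "t 0 = 0" "t m = T" "mono t" "\<And>i. i < m \<Longrightarrow> t i < t (Suc i)"
    "\<And>i. t i \<in> {0..T}" "G \<subseteq> t ` {..m}"
    using tm by auto
  define idx where "idx p = (SOME i. i \<le> m \<and> t i = p)" for p
  have idx: "idx p \<le> m \<and> t (idx p) = p" if "p \<in> G" for p
  proof -
    obtain i where "i \<le> m" "t i = p" using \<open>p \<in> G\<close> t(7) by (metis atMost_iff imageE subsetD)
    then have "i \<le> m \<and> t i = p" by simp
    then show ?thesis unfolding idx_def by (rule someI)
  qed
  define \<Phi> where "\<Phi> u = integral {0..u} \<phi>" for u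
  define d where "d i = \<Phi> (t (Suc i)) - \<Phi> (t i)" for i
  define e where "e i = \<Psi> (t (Suc i)) - \<Psi> (t i)" for i
  \<comment> \<open>The value 1 from \<open>m\<close> on only keeps every standard deviation
    positive.\<close>
  define \<sigma> where "\<sigma> i = (if i < m then s * sqrt (t (Suc i) - t i) else 1)" for i
  have \<sigma>: "0 < \<sigma> i" for i using t(5)[of i] pos by (auto simp: \<sigma>_def)
  define D where "D i \<omega> = w (t (Suc i)) \<omega> - w (t i) \<omega>" for i \<omega>
  define X where "X x i \<omega> = (x * d i + e i) + s * D i \<omega>" for x i \<omega>
  have wm: "w u \<in> borel_measurable M" if "0 \<le> u" for u
    using w that unfolding brownian_motion_def by auto
  have Dm[measurable]: "D i \<in> borel_measurable M" for i
    unfolding D_def[abs_def] using wm t(6) by (intro borel_measurable_diff) auto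
  have Dind: "indep_vars (\<lambda>_. borel) D {..<m}"
  proof -
    have "independent_increments M w" using w by (simp add: brownian_motion_def)
    then show ?thesis
      unfolding independent_increments_def D_def[abs_def] using t(2,4) by auto
  qed
  have Xm: "X x i \<in> borel_measurable M" for x i
    unfolding X_def[abs_def] by measurable
  have Xind: "indep_vars (\<lambda>_. borel) (X x) {..<m}" for x
    using indep_vars_compose2[OF Dind, of "\<lambda>i y. (x * d i + e i) + s * y" "\<lambda>_. borel"]
    by (simp add: X_def[abs_def])
  have Xlaw: "distr M borel (X x i) = density lborel (normal_density (x * d i + e i) (\<sigma> i))" if "i < m" for x i
  proof -
    have "distributed M lborel (D i) (normal_density 0 (sqrt (t (Suc i) - t i)))"
      using w t(5)[OF that] t(6)[of i] unfolding brownian_motion_def D_def[abs_def] by auto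
    then have "distributed M lborel (X x i) (normal_density ((x * d i + e i) + s * 0) (\<bar>s\<bar> * sqrt (t (Suc i) - t i)))"
      unfolding X_def[abs_def] using t(5)[OF that] pos by (intro normal_density_affine) auto
    then have "distr M lborel (X x i) = density lborel (normal_density (x * d i + e i) (\<sigma> i))"
      using that pos by (simp add: distributed_def \<sigma>_def)
    moreover have "distr M lborel (X x i) = distr M borel (X x i)"
      by (intro distr_cong) auto
    ultimately show ?thesis by simp
  qed
  have law: "distr M (PiM {..<m} (\<lambda>_. borel)) (\<lambda>\<omega>. \<lambda>i\<in>{..<m}. X x i \<omega>)
     = PiM {..<m} (\<lambda>i. density lborel (normal_density (x * d i + e i) (\<sigma> i)))" for x
  proof -
    have "distr M (PiM {..<m} (\<lambda>_. borel)) (\<lambda>\<omega>. \<lambda>i\<in>{..<m}. X x i \<omega>) = PiM {..<m} (\<lambda>i. distr M borel (X x i))"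
      using indep_vars_iff_distr_eq_PiM[where I="{..<m}" and M'="\<lambda>_. borel" and X="X x"] Xind Xm t(1) by (auto simp: lessThan_empty_iff)
    also have "\<dots> = PiM {..<m} (\<lambda>i. density lborel (normal_density (x * d i + e i) (\<sigma> i)))"
      using Xlaw by (intro PiM_cong) auto
    finally show ?thesis .
  qed
  \<comment> \<open>The partial sums start at \<open>\<Psi> 0\<close>, the value of the path at time
    0: there the integral vanishes, and so does \<open>w\<close> almost surely.\<close>
  define P where "P u = (\<lambda>p\<in>G. \<Psi> 0 + (\<Sum>i<idx p. u i))" for u :: "nat \<Rightarrow> real"
  define H where "H u = h (P u)" for u
  have Pm: "P \<in> PiM {..<m} (\<lambda>_. borel) \<rightarrow>\<^sub>M PiM G (\<lambda>_. borel)"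
    unfolding P_def[abs_def]
  proof (rule measurable_restrict)
    fix p assume "p \<in> G"
    with idx have "idx p \<le> m" by auto
    then show "(\<lambda>u. \<Psi> 0 + (\<Sum>i<idx p. u i)) \<in> borel_measurable (PiM {..<m} (\<lambda>_. borel))"
      by (intro borel_measurable_add borel_measurable_sum measurable_component_singleton) auto
  qed
  have Hm: "H \<in> borel_measurable (PiM {..<m} (\<lambda>_. borel))"
    unfolding H_def[abs_def] by (rule measurable_compose[OF Pm h])
  have path: "P (\<lambda>i\<in>{..<m}. X x i \<omega>) = (\<lambda>t\<in>G. x * integral {0..t} \<phi> + \<Psi> t + s * w t \<omega>)"
    if "w 0 \<omega> = 0" for x \<omega>
  proof (rule ext)
    fix p
    show "P (\<lambda>i\<in>{..<m}. X x i \<omega>) p = (\<lambda>t\<in>G. x * integral {0..t} \<phi> + \<Psi> t + s * w t \<omega>) p"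
    proof (cases "p \<in> G")
      case True
      have "(\<Sum>i<idx p. (\<lambda>i\<in>{..<m}. X x i \<omega>) i) = (\<Sum>i<idx p. X x i \<omega>)"
        using idx[OF True] by (intro sum.cong) auto
      also have "\<dots> = (\<Sum>i<idx p. (x * \<Phi> (t (Suc i)) + \<Psi> (t (Suc i)) + s * w (t (Suc i)) \<omega>) - (x * \<Phi> (t i) + \<Psi> (t i) + s * w (t i) \<omega>))"
        by (intro sum.cong) (auto simp: X_def D_def d_def e_def algebra_simps)
      also have "\<dots> = x * \<Phi> p + \<Psi> p + s * w p \<omega> - \<Psi> 0"
        using idx[OF True] that by (subst sum_lessThan_telescope) (auto simp: t(2) \<Phi>_def)
      finally show ?thesis using True by (simp add: P_def \<Phi>_def)
    qed (simp add: P_def)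
  qed
  have "(\<integral>\<^sup>+x. (\<integral>\<^sup>+\<omega>. ennreal ((h (\<lambda>t\<in>G. x * integral {0..t} \<phi> + \<Psi> t + s * w t \<omega>) - x)\<^sup>2) \<partial>M)
      \<partial>density lborel (normal_density 0 \<tau>))
    = (\<integral>\<^sup>+x. (\<integral>\<^sup>+u. ennreal ((H u - x)\<^sup>2)
          \<partial>PiM {..<m} (\<lambda>i. density lborel (normal_density (x * d i + e i) (\<sigma> i)))) \<partial>density lborel (normal_density 0 \<tau>))"
  proof (rule nn_integral_cong)
    fix x :: real
    have "AE \<omega> in M. w 0 \<omega> = 0" using w by (simp add: brownian_motion_def)
    then have "(\<integral>\<^sup>+\<omega>. ennreal ((h (\<lambda>t\<in>G. x * integral {0..t} \<phi> + \<Psi> t + s * w t \<omega>) - x)\<^sup>2) \<partial>M)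
       = (\<integral>\<^sup>+\<omega>. ennreal ((H (\<lambda>i\<in>{..<m}. X x i \<omega>) - x)\<^sup>2) \<partial>M)"
      by (intro nn_integral_cong_AE, elim eventually_mono) (auto simp: H_def path)
    also have "\<dots> = (\<integral>\<^sup>+u. ennreal ((H u - x)\<^sup>2) \<partial>distr M (PiM {..<m} (\<lambda>_. borel)) (\<lambda>\<omega>. \<lambda>i\<in>{..<m}. X x i \<omega>))"
      using Hm Xm by (subst nn_integral_distr) (auto intro!: measurable_restrict)
    finally show "(\<integral>\<^sup>+\<omega>. ennreal ((h (\<lambda>t\<in>G. x * integral {0..t} \<phi> + \<Psi> t + s * w t \<omega>) - x)\<^sup>2) \<partial>M)
       = (\<integral>\<^sup>+u. ennreal ((H u - x)\<^sup>2) \<partial>PiM {..<m} (\<lambda>i. density lborel (normal_density (x * d i + e i) (\<sigma> i))))"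
      unfolding law .
  qed
  \<comment> \<open>By \<open>grid_energy_le\<close> the grid carries at most the information
    \<open>V / s\<^sup>2\<close>, and less information means a larger Bayes risk.\<close>
  moreover have "ennreal (1 / (1 / \<tau>\<^sup>2 + V / s\<^sup>2)) \<le> ennreal (1 / (1 / \<tau>\<^sup>2 + (\<Sum>i\<in>{..<m}. (d i)\<^sup>2 / (\<sigma> i)\<^sup>2)))"
  proof (rule ennreal_leI)
    have "(\<Sum>i\<in>{..<m}. (d i)\<^sup>2 / (\<sigma> i)\<^sup>2) = (\<Sum>i\<in>{..<m}. (d i)\<^sup>2 / (t (Suc i) - t i)) / s\<^sup>2"
      unfolding sum_divide_distrib
    proof (rule sum.cong[OF refl])
      fix i assume "i \<in> {..<m}"
      then have "(\<sigma> i)\<^sup>2 = s\<^sup>2 * (t (Suc i) - t i)"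
        using t(5)[of i] by (simp add: \<sigma>_def power_mult_distrib)
      then show "(d i)\<^sup>2 / (\<sigma> i)\<^sup>2 = (d i)\<^sup>2 / (t (Suc i) - t i) / s\<^sup>2" by (simp add: mult.commute)
    qed
    also have "\<dots> \<le> V / s\<^sup>2"
      using grid_energy_le[of t m \<phi>] t(2,3,5) \<phi> unfolding d_def \<Phi>_def
      by (intro divide_right_mono) (auto intro: order.trans)
    finally have "(\<Sum>i\<in>{..<m}. (d i)\<^sup>2 / (\<sigma> i)\<^sup>2) \<le> V / s\<^sup>2" .
    moreover have "0 < 1 / \<tau>\<^sup>2 + (\<Sum>i\<in>{..<m}. (d i)\<^sup>2 / (\<sigma> i)\<^sup>2)"
      using pos by (intro add_pos_nonneg sum_nonneg) auto
    ultimately show "1 / (1 / \<tau>\<^sup>2 + V / s\<^sup>2) \<le> 1 / (1 / \<tau>\<^sup>2 + (\<Sum>i\<in>{..<m}. (d i)\<^sup>2 / (\<sigma> i)\<^sup>2))"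
      by (intro divide_left_mono) auto
  qed
  ultimately show ?thesis
    using gaussian_bayes_risk[of "{..<m}" \<tau> \<sigma> H d e] \<sigma> pos Hm by (auto intro: order.trans)
qed

text \<open>Weighted Young inequality. The free weight \<delta> keeps the main factor close to 1,
  where the usual factor 2 would spoil the sharp constant.\<close>

lemma square_diff_le_weighted:
  fixes a b x \<delta> :: real
  assumes "0 < \<delta>"
  shows "(b - x)\<^sup>2 \<le> (1 + \<delta>) * (a - x)\<^sup>2 + (1 + 1 / \<delta>) * (a - b)\<^sup>2"
proof -
  have "0 \<le> (sqrt \<delta> * (a - x) + (a - b) / sqrt \<delta>)\<^sup>2" by simp
  also have "\<dots> = \<delta> * (a - x)\<^sup>2 + 2 * (a - x) * (a - b) + (a - b)\<^sup>2 / \<delta>"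
    using assms by (simp add: power2_sum power_mult_distrib power_divide)
  finally show ?thesis by (simp add: power2_eq_square algebra_simps add_divide_distrib diff_divide_distrib)
qed

text \<open>From finitely many times to the whole path: \<open>g\<close> is approximated by a
  cylinder function, to which \<open>brownian_bayes_risk_cylinder\<close> applies with the same
  bound, uniformly in the chosen times. Boundedness of \<open>g\<close> turns the L1 approximation
  into a mean square one.\<close>

lemma brownian_bayes_risk:
  fixes M :: "'a measure" and \<phi> \<Psi> :: "real \<Rightarrow> real"
  assumes M: "prob_space M" and w: "brownian_motion M w"
    and pos: "0 < T" "0 < s" "0 < \<tau>"
    and \<phi>: "continuous_on {0..T} \<phi>" "integral {0..T} (\<lambda>t. (\<phi> t)\<^sup>2) \<le> V"
    and \<Psi>: "continuous_on {0..T} \<Psi>"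
    and g: "g \<in> borel_measurable (skorokhod_space T)" "\<And>y. \<bar>g y\<bar> \<le> B"
  shows "ennreal (1 / (1 / \<tau>\<^sup>2 + V / s\<^sup>2)) \<le>
    (\<integral>\<^sup>+x. (\<integral>\<^sup>+\<omega>. ennreal ((g (\<lambda>t\<in>{0..T}. x * integral {0..t} \<phi> + \<Psi> t + s * w t \<omega>) - x)\<^sup>2) \<partial>M)
      \<partial>density lborel (normal_density 0 \<tau>))" (is "ennreal ?v \<le> ?R")
proof -
  interpret prob_space M by (rule M)
  let ?\<nu> = "density lborel (normal_density 0 \<tau>)"
  interpret \<nu>: prob_space ?\<nu> by (rule prob_space_normal_density[OF pos(3)])
  interpret \<nu>M: pair_prob_space ?\<nu> M ..
  define path where "path = (\<lambda>z. \<lambda>t\<in>{0..T}. fst z * integral {0..t} \<phi> + \<Psi> t + s * w t (snd z))"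
  have w_meas: "w t \<in> borel_measurable M" if "0 \<le> t" for t
    using w that unfolding brownian_motion_def by auto
  have w_cont: "continuous_on {0..} (\<lambda>t. w t \<omega>)" if "\<omega> \<in> space M" for \<omega>
    using w that unfolding brownian_motion_def by auto
  have path_meas: "path \<in> ?\<nu> \<Otimes>\<^sub>M M \<rightarrow>\<^sub>M skorokhod_space T"
    unfolding path_def
  proof (rule measurable_skorokhod_space)
    fix t assume "t \<in> {0..T}"
    then have [measurable]: "w t \<in> borel_measurable M" using w_meas by auto
    show "(\<lambda>z. fst z * integral {0..t} \<phi> + \<Psi> t + s * w t (snd z)) \<in> borel_measurable (?\<nu> \<Otimes>\<^sub>M M)"
      by measurable
  next
    fix z assume "z \<in> space (?\<nu> \<Otimes>\<^sub>M M)"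
    then have "continuous_on {0..T} (\<lambda>t. w t (snd z))"
      by (intro continuous_on_subset[OF w_cont]) (auto simp: space_pair_measure)
    then show "cadlag_on {0..T} (\<lambda>t. fst z * integral {0..t} \<phi> + \<Psi> t + s * w t (snd z))"
      using \<Psi> \<phi>(1)
      by (intro continuous_imp_cadlag_on continuous_intros indefinite_integral_continuous_1 integrable_continuous_real)
  qed
  \<comment> \<open>The law of the path with \<open>x\<close> drawn from the prior, so that a single
    approximation in L1 of \<open>N\<close> serves all values of \<open>x\<close> at once.\<close>
  define N where "N = distr (?\<nu> \<Otimes>\<^sub>M M) (skorokhod_space T) path"
  interpret N: prob_space N unfolding N_def by (rule \<nu>M.prob_space_distr[OF path_meas])
  interpret N: path_measure N "{0..T}" "{x. cadlag_on {0..T} x}"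
    by unfold_locales (simp add: N_def skorokhod_space_def)
  have B0: "0 \<le> B" using g(2)[of undefined] by linarith
  have gN: "g \<in> borel_measurable N" using g(1) by (simp add: N_def)
  have g_int: "integrable N g" using g(2) gN by (intro N.integrable_const_bound[of _ B]) auto
  have R: "?R = (\<integral>\<^sup>+z. ennreal ((g (path z) - fst z)\<^sup>2) \<partial>(?\<nu> \<Otimes>\<^sub>M M))"
    using measurable_compose[OF path_meas g(1)]
    by (subst nn_integral_fst[symmetric]) (auto simp: path_def)
  have main: "ennreal ?v \<le> ennreal (1 + \<delta>) * ?R + ennreal ((1 + 1 / \<delta>) * (2 * B * e))" if "0 < \<delta>" "0 < e" for \<delta> e
  proof -
    obtain G h where G: "finite G" "G \<subseteq> {0..T}" "h \<in> borel_measurable (PiM G (\<lambda>_. borel))"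
      "integrable N (\<lambda>y. h (restrict y G))" "(\<integral>y. \<bar>g y - h (restrict y G)\<bar> \<partial>N) < e"
      using N.cylinder_approximable_integrable[OF g_int] \<open>0 < e\<close> unfolding cylinder_approximable_def by blast
    \<comment> \<open>Clipping to the range of \<open>g\<close> cannot increase the distance to
      \<open>g\<close> and bounds it by \<open>2 * B\<close>; hence the squared distance is at most
      \<open>2 * B\<close> times the L1 integrand.\<close>
    define h' where "h' y = max (- B) (min B (h y))" for y
    have h'_meas: "h' \<in> borel_measurable (PiM G (\<lambda>_. borel))"
      unfolding h'_def[abs_def] using G(3) by measurable
    have h'N: "(\<lambda>y. h' (restrict y G)) \<in> borel_measurable N"
      by (rule measurable_compose[OF N.restrict_measurable[OF G(2)] h'_meas])
    have h'S: "(\<lambda>y. h' (restrict y G)) \<in> borel_measurable (skorokhod_space T)"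
      using h'N by (simp add: N_def)
    have sq: "(g y - h' (restrict y G))\<^sup>2 \<le> 2 * B * \<bar>g y - h (restrict y G)\<bar>" for y
    proof -
      have 1: "\<bar>g y - h' (restrict y G)\<bar> \<le> 2 * B"
        using g(2)[of y] by (auto simp: h'_def abs_le_iff max_def min_def)
      have 2: "\<bar>g y - h' (restrict y G)\<bar> \<le> \<bar>g y - h (restrict y G)\<bar>"
        using g(2)[of y] by (auto simp: h'_def abs_le_iff max_def min_def)
      have "\<bar>g y - h' (restrict y G)\<bar> * \<bar>g y - h' (restrict y G)\<bar> \<le> 2 * B * \<bar>g y - h (restrict y G)\<bar>"
        using B0 by (intro mult_mono 1 2) auto
      then show ?thesis by (simp add: power2_eq_square)
    qed
    have small: "(\<integral>\<^sup>+z. ennreal ((g (path z) - h' (restrict (path z) G))\<^sup>2) \<partial>(?\<nu> \<Otimes>\<^sub>M M)) \<le> ennreal (2 * B * e)"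
    proof -
      have "(\<integral>\<^sup>+z. ennreal ((g (path z) - h' (restrict (path z) G))\<^sup>2) \<partial>(?\<nu> \<Otimes>\<^sub>M M)) = (\<integral>\<^sup>+y. ennreal ((g y - h' (restrict y G))\<^sup>2) \<partial>N)"
        unfolding N_def using g(1) h'S by (subst nn_integral_distr[OF path_meas]) auto
      also have "\<dots> \<le> (\<integral>\<^sup>+y. ennreal (2 * B * \<bar>g y - h (restrict y G)\<bar>) \<partial>N)"
        by (intro nn_integral_mono ennreal_leI sq)
      also have "\<dots> = ennreal (\<integral>y. 2 * B * \<bar>g y - h (restrict y G)\<bar> \<partial>N)"
        using g_int G(4) B0 by (intro nn_integral_eq_integral) auto
      also have "\<dots> \<le> ennreal (2 * B * e)"
        using G(5) B0 by (intro ennreal_leI) (auto intro!: mult_left_mono)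
      finally show ?thesis .
    qed
    have rp: "restrict (path (x, \<omega>)) G = (\<lambda>t\<in>G. x * integral {0..t} \<phi> + \<Psi> t + s * w t \<omega>)" for x \<omega>
      using G(2) by (auto simp: path_def fun_eq_iff)
    have m1: "(\<lambda>z. g (path z)) \<in> borel_measurable (?\<nu> \<Otimes>\<^sub>M M)" and m2: "(\<lambda>z. h' (restrict (path z) G)) \<in> borel_measurable (?\<nu> \<Otimes>\<^sub>M M)"
      using measurable_compose[OF path_meas g(1)] measurable_compose[OF path_meas h'S] by auto
    have m3: "fst \<in> borel_measurable (?\<nu> \<Otimes>\<^sub>M M)" by measurable
    note [measurable] = m1 m2 m3
    have "ennreal ?v \<le> (\<integral>\<^sup>+x. (\<integral>\<^sup>+\<omega>. ennreal ((h' (\<lambda>t\<in>G. x * integral {0..t} \<phi> + \<Psi> t + s * w t \<omega>) - x)\<^sup>2) \<partial>M) \<partial>?\<nu>)"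
      by (rule brownian_bayes_risk_cylinder[OF M w pos \<phi> G(1,2) h'_meas])
    also have "\<dots> = (\<integral>\<^sup>+z. ennreal ((h' (restrict (path z) G) - fst z)\<^sup>2) \<partial>(?\<nu> \<Otimes>\<^sub>M M))"
      by (subst nn_integral_fst[symmetric]) (auto simp: rp)
    also have "\<dots> \<le> (\<integral>\<^sup>+z. ennreal (1 + \<delta>) * ennreal ((g (path z) - fst z)\<^sup>2)
        + ennreal (1 + 1 / \<delta>) * ennreal ((g (path z) - h' (restrict (path z) G))\<^sup>2) \<partial>(?\<nu> \<Otimes>\<^sub>M M))"
    proof (rule nn_integral_mono)
      fix z
      have "ennreal ((h' (restrict (path z) G) - fst z)\<^sup>2) \<le> ennreal ((1 + \<delta>) * (g (path z) - fst z)\<^sup>2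
        + (1 + 1 / \<delta>) * (g (path z) - h' (restrict (path z) G))\<^sup>2)"
        by (intro ennreal_leI square_diff_le_weighted \<open>0 < \<delta>\<close>)
      then show "ennreal ((h' (restrict (path z) G) - fst z)\<^sup>2) \<le> ennreal (1 + \<delta>) * ennreal ((g (path z) - fst z)\<^sup>2)
        + ennreal (1 + 1 / \<delta>) * ennreal ((g (path z) - h' (restrict (path z) G))\<^sup>2)"
        using \<open>0 < \<delta>\<close> by (simp add: ennreal_plus ennreal_mult)
    qed
    also have "\<dots> = ennreal (1 + \<delta>) * ?R + ennreal (1 + 1 / \<delta>) * (\<integral>\<^sup>+z. ennreal ((g (path z) - h' (restrict (path z) G))\<^sup>2) \<partial>(?\<nu> \<Otimes>\<^sub>M M))"
      unfolding R by (subst nn_integral_add, measurable) (simp add: nn_integral_cmult)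
    also have "\<dots> \<le> ennreal (1 + \<delta>) * ?R + ennreal (1 + 1 / \<delta>) * ennreal (2 * B * e)"
      by (intro add_left_mono mult_left_mono small) auto
    also have "\<dots> = ennreal (1 + \<delta>) * ?R + ennreal ((1 + 1 / \<delta>) * (2 * B * e))"
      using B0 that by (simp add: ennreal_mult)
    finally show ?thesis .
  qed
  show ?thesis
  proof (cases ?R)
    case (real R')
    have 1: "?v \<le> (1 + \<delta>) * R' + (1 + 1 / \<delta>) * (2 * B * e)" if "0 < \<delta>" "0 < e" for \<delta> e
    proof -
      have "ennreal ?v \<le> ennreal ((1 + \<delta>) * R' + (1 + 1 / \<delta>) * (2 * B * e))"
        using main[OF that] real B0 that by (simp add: ennreal_plus ennreal_mult)
      then show ?thesis using real B0 that by (subst (asm) ennreal_le_iff) auto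
    qed
    \<comment> \<open>The approximation error \<open>e\<close> goes to 0 first, with \<delta> fixed,
      because its coefficient \<open>1 + 1 / \<delta>\<close> blows up as \<delta>
      decreases.\<close>
    have 2: "?v \<le> (1 + \<delta>) * R'" if "0 < \<delta>" for \<delta>
    proof (rule tendsto_lowerbound)
      show "((\<lambda>e. (1 + \<delta>) * R' + (1 + 1 / \<delta>) * (2 * B * e)) \<longlongrightarrow> (1 + \<delta>) * R') (at_right 0)"
        by (auto intro!: tendsto_eq_intros)
      show "\<forall>\<^sub>F e in at_right 0. ?v \<le> (1 + \<delta>) * R' + (1 + 1 / \<delta>) * (2 * B * e)"
        using 1[OF that] by (auto simp: eventually_at_right_less eventually_at_filter)
    qed simp
    have "?v \<le> R'"
    proof (rule tendsto_lowerbound)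
      show "((\<lambda>\<delta>. (1 + \<delta>) * R') \<longlongrightarrow> R') (at_right 0)"
        by (auto intro!: tendsto_eq_intros)
      show "\<forall>\<^sub>F \<delta> in at_right 0. ?v \<le> (1 + \<delta>) * R'"
        using 2 by (auto simp: eventually_at_filter)
    qed simp
    then show ?thesis using real by (simp add: ennreal_leI)
  qed simp
qed

section \<open>Trigonometric polynomials\<close>

text \<open>The index is a frequency with a flag choosing between cosine and negative sine, the
  latter written as a phase shift by \<open>pi / 2\<close>. Each differentiation adds another such
  shift and a factor \<open>2 * pi * l\<close>, so one formula covers all orders. The factor
  \<open>sqrt 2\<close> normalises in L2 of the unit interval for frequencies at least 1.\<close>

definition fourier_deriv :: "nat \<Rightarrow> nat \<times> bool \<Rightarrow> real \<Rightarrow> real" where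
  "fourier_deriv i j x = sqrt 2 * (2 * pi * real (fst j)) ^ i *
     cos (2 * pi * real (fst j) * x + (if snd j then pi / 2 else 0) + real i * (pi / 2))"

abbreviation fourier_fun :: "nat \<times> bool \<Rightarrow> real \<Rightarrow> real" where
  "fourier_fun \<equiv> fourier_deriv 0"

definition trig_poly :: "(nat \<times> bool) set \<Rightarrow> (nat \<times> bool \<Rightarrow> real) \<Rightarrow> real \<Rightarrow> real" where
  "trig_poly J \<theta> x = (\<Sum>j\<in>J. \<theta> j * fourier_fun j x)"

text \<open>The squared Sobolev norm of a basis function of frequency
  \<open>l \<ge> 1\<close>.\<close>

definition sobolev_weight :: "nat \<Rightarrow> nat \<Rightarrow> real" where
  "sobolev_weight k l = (\<Sum>i=0..k. (2 * pi * real l) ^ (2 * i))"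

lemma fourier_deriv_has_derivative:
  "(fourier_deriv i j has_real_derivative fourier_deriv (Suc i) j x) (at x within A)"
proof -
  have "cos (y + real (Suc i) * (pi / 2)) = - sin (y + real i * (pi / 2))" for y :: real
  proof -
    have "y + real (Suc i) * (pi / 2) = (y + real i * (pi / 2)) + pi / 2" by (simp add: field_simps)
    then show ?thesis by (simp only: cos_add) simp
  qed
  then show ?thesis
    unfolding fourier_deriv_def[abs_def] by (auto intro!: derivative_eq_intros)
qed

lemma continuous_on_fourier_deriv: "continuous_on A (fourier_deriv i j)"
  unfolding fourier_deriv_def[abs_def] by (intro continuous_intros)

lemma cos_add_2pi_nat: "cos (x + 2 * pi * real n) = cos x"
  using cos.plus_of_nat[of x n] by (simp add: mult_ac)

lemma fourier_deriv_periodic: "fourier_deriv i j (x + 1) = fourier_deriv i j x"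
proof -
  have "2 * pi * real (fst j) * (x + 1) + (if snd j then pi / 2 else 0) + real i * (pi / 2)
    = (2 * pi * real (fst j) * x + (if snd j then pi / 2 else 0) + real i * (pi / 2)) + 2 * pi * real (fst j)"
    by (simp add: algebra_simps)
  then show ?thesis unfolding fourier_deriv_def by (simp only: cos_add_2pi_nat)
qed

text \<open>The case \<open>n = 1\<close> gives orthogonality on the unit interval; general
  \<open>n\<close> gives the energy over the observation time.\<close>

lemma cos_full_periods_has_integral_0:
  fixes p :: int and n :: nat
  assumes "p \<noteq> 0"
  shows "((\<lambda>x. cos (2 * pi * real_of_int p * x + a)) has_integral 0) {0..real n}"
proof -
  let ?w = "2 * pi * real_of_int p"
  have w: "?w \<noteq> 0" using assms by simp
  have "((\<lambda>x. cos (?w * x + a)) has_integral sin (?w * real n + a) / ?w - sin (?w * 0 + a) / ?w) {0..real n}"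
    by (rule fundamental_theorem_of_calculus)
       (use w in \<open>auto intro!: derivative_eq_intros simp: has_real_derivative_iff_has_vector_derivative[symmetric]\<close>)
  moreover have "sin (?w * real n + a) = sin a"
  proof -
    have "?w * real n + a = a + 2 * pi * real_of_int (p * int n)" by simp
    then show ?thesis using sin.plus_of_int[of a "p * int n"] by (simp add: ac_simps)
  qed
  ultimately show ?thesis by simp
qed

lemma cos_orthogonal:
  fixes l m :: nat
  assumes "1 \<le> l"
  shows "((\<lambda>x. cos (2 * pi * real l * x + a) * cos (2 * pi * real m * x + b)) has_integral
     (if l = m then cos (a - b) / 2 else 0)) {0..1}"
proof -
  have eq: "cos (2 * pi * real l * x + a) * cos (2 * pi * real m * x + b)
     = (cos (2 * pi * real_of_int (int l - int m) * x + (a - b)) + cos (2 * pi * real_of_int (int l + int m) * x + (a + b))) / 2" for x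
    unfolding cos_times_cos by (simp add: algebra_simps)
  have "int l + int m \<noteq> 0" using assms by simp
  from cos_full_periods_has_integral_0[OF this, of "a + b" 1]
  have 2: "((\<lambda>x. cos (2 * pi * real_of_int (int l + int m) * x + (a + b))) has_integral 0) {0..1}"
    by simp
  have 1: "((\<lambda>x. cos (2 * pi * real_of_int (int l - int m) * x + (a - b))) has_integral (if l = m then cos (a - b) else 0)) {0..1}"
  proof (cases "l = m")
    case True
    then show ?thesis using has_integral_const_real[of "cos (a - b)" 0 1] by simp
  next
    case False
    then have "int l - int m \<noteq> 0" by simp
    from cos_full_periods_has_integral_0[OF this, of "a - b" 1] False show ?thesis by simp
  qed
  have "((\<lambda>x. (cos (2 * pi * real_of_int (int l - int m) * x + (a - b)) + cos (2 * pi * real_of_int (int l + int m) * x + (a + b))) / 2)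
     has_integral ((if l = m then cos (a - b) else 0) + 0) / 2) {0..1}"
    by (intro has_integral_divide has_integral_add 1 2)
  then show ?thesis unfolding eq by (auto split: if_splits)
qed

text \<open>Different frequencies are orthogonal by the product-to-sum formula. At equal frequency
  the phases due to differentiation cancel in the difference, and the two flags differ by
  \<open>pi / 2\<close>, where cosine vanishes.\<close>

lemma fourier_deriv_orthogonal:
  assumes "1 \<le> fst j"
  shows "((\<lambda>x. fourier_deriv i j x * fourier_deriv i j' x) has_integral
     (if j = j' then (2 * pi * real (fst j)) ^ (2 * i) else 0)) {0..1}"
proof -
  let ?c = "\<lambda>j. (if snd j then pi / 2 else 0) + real i * (pi / 2)"
  have eq: "fourier_deriv i j x * fourier_deriv i j' x = (2 * (2 * pi * real (fst j)) ^ i * (2 * pi * real (fst j')) ^ i) *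
     (cos (2 * pi * real (fst j) * x + ?c j) * cos (2 * pi * real (fst j') * x + ?c j'))" for x
  proof -
    have "sqrt 2 * sqrt 2 = (2::real)" by simp
    moreover have "(sqrt 2 * a * u) * (sqrt 2 * b * v) = (sqrt 2 * sqrt 2) * a * b * (u * v)" for a b u v :: real
      by (simp only: mult_ac)
    ultimately have "(sqrt 2 * a * u) * (sqrt 2 * b * v) = 2 * a * b * (u * v)" for a b u v :: real
      by simp
    then show ?thesis unfolding fourier_deriv_def add.assoc by blast
  qed
  have main: "((\<lambda>x. fourier_deriv i j x * fourier_deriv i j' x) has_integral
     (2 * (2 * pi * real (fst j)) ^ i * (2 * pi * real (fst j')) ^ i) *
       (if fst j = fst j' then cos (?c j - ?c j') / 2 else 0)) {0..1}"
    unfolding eq by (intro has_integral_mult_right cos_orthogonal assms)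
  have val: "(2 * (2 * pi * real (fst j)) ^ i * (2 * pi * real (fst j')) ^ i) *
       (if fst j = fst j' then cos (?c j - ?c j') / 2 else 0) = (if j = j' then (2 * pi * real (fst j)) ^ (2 * i) else 0)"
  proof (cases "j = j'")
    case True
    then show ?thesis by (simp add: power_even_eq power2_eq_square)
  next
    case False
    show ?thesis
    proof (cases "fst j = fst j'")
      case True
      with False have "snd j \<noteq> snd j'" by (simp add: prod_eq_iff)
      then have "cos (?c j - ?c j') = 0" by (cases "snd j") auto
      then show ?thesis using False by simp
    qed (use False in auto)
  qed
  show ?thesis using main unfolding val .
qed

text \<open>The energy of a basis function over the whole observation time; divided by
  \<open>s\<^sup>2\<close> it is the information about one coefficient in
  \<open>coordinate_bayes_risk\<close>.\<close>

lemma fourier_fun_square_has_integral: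
  assumes "1 \<le> fst j"
  shows "((\<lambda>x. (fourier_fun j x)\<^sup>2) has_integral real n) {0..real n}"
proof -
  let ?c = "if snd j then pi / 2 else 0 :: real"
  have eq: "(fourier_fun j x)\<^sup>2 = 1 + cos (2 * pi * real_of_int (2 * int (fst j)) * x + 2 * ?c)" for x
  proof -
    have "cos (2 * (2 * pi * real (fst j) * x + ?c)) = 2 * (cos (2 * pi * real (fst j) * x + ?c))\<^sup>2 - 1"
      by (rule cos_double_cos)
    then show ?thesis by (simp add: fourier_deriv_def power_mult_distrib algebra_simps)
  qed
  have "2 * int (fst j) \<noteq> 0" using assms by simp
  from has_integral_add[OF has_integral_const_real[of "1::real" 0 "real n"] cos_full_periods_has_integral_0[OF this, of "2 * ?c" n]]
  show ?thesis unfolding eq by simp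
qed

lemma deriv01_trig_poly:
  assumes "x \<in> {0..1}"
  shows "deriv01 i (trig_poly J \<theta>) x = (\<Sum>j\<in>J. \<theta> j * fourier_deriv i j x)"
  using assms
proof (induction i arbitrary: x)
  case 0
  then show ?case by (simp add: deriv01_def trig_poly_def)
next
  case (Suc i)
  have "((\<lambda>x. \<Sum>j\<in>J. \<theta> j * fourier_deriv i j x) has_real_derivative (\<Sum>j\<in>J. \<theta> j * fourier_deriv (Suc i) j x)) (at x within {0..1})"
    by (intro DERIV_sum DERIV_cmult fourier_deriv_has_derivative)
  then have *: "((\<lambda>x. \<Sum>j\<in>J. \<theta> j * fourier_deriv i j x) has_vector_derivative (\<Sum>j\<in>J. \<theta> j * fourier_deriv (Suc i) j x)) (at x within {0..1})"
    by (simp only: has_real_derivative_iff_has_vector_derivative)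
  have "(deriv01 i (trig_poly J \<theta>) has_vector_derivative (\<Sum>j\<in>J. \<theta> j * fourier_deriv (Suc i) j x)) (at x within {0..1})"
    by (rule has_vector_derivative_transform[OF Suc.prems Suc.IH *])
  from vector_derivative_within_closed_interval[OF zero_less_one Suc.prems this]
  show ?case by (simp add: deriv01_def)
qed

lemma trig_poly_in_C_per: "trig_poly J \<theta> \<in> C_per k"
proof -
  have eq: "deriv01 i (trig_poly J \<theta>) x = (\<Sum>j\<in>J. \<theta> j * fourier_deriv i j x)" if "x \<in> {0..1}" for i x
    by (rule deriv01_trig_poly[OF that])
  have d: "deriv01 i (trig_poly J \<theta>) differentiable_on {0..1}" for i
    unfolding differentiable_on_def
  proof
    fix x :: real assume x: "x \<in> {0..1}"
    have "((\<lambda>x. \<Sum>j\<in>J. \<theta> j * fourier_deriv i j x) has_real_derivative (\<Sum>j\<in>J. \<theta> j * fourier_deriv (Suc i) j x)) (at x within {0..1})"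
      by (intro DERIV_sum DERIV_cmult fourier_deriv_has_derivative)
    then have *: "((\<lambda>x. \<Sum>j\<in>J. \<theta> j * fourier_deriv i j x) has_vector_derivative (\<Sum>j\<in>J. \<theta> j * fourier_deriv (Suc i) j x)) (at x within {0..1})"
      by (simp only: has_real_derivative_iff_has_vector_derivative)
    show "deriv01 i (trig_poly J \<theta>) differentiable (at x within {0..1})"
      by (rule differentiableI_vector[OF has_vector_derivative_transform[OF x eq *]])
  qed
  have "continuous_on {0..1} (\<lambda>x. \<Sum>j\<in>J. \<theta> j * fourier_deriv i j x)" for i
    by (intro continuous_intros continuous_on_fourier_deriv)
  then have c: "continuous_on {0..1} (deriv01 i (trig_poly J \<theta>))" for i
    by (rule continuous_on_eq) (simp add: eq)
  have p: "fourier_deriv i j 1 = fourier_deriv i j 0" for i j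
    using fourier_deriv_periodic[of i j 0] by simp
  show ?thesis unfolding C_per_def
    using c d by (auto simp: eq p trig_poly_def fourier_deriv_periodic)
qed

lemma sum_sum_delta:
  assumes "finite J"
  shows "(\<Sum>j\<in>J. \<Sum>j'\<in>J. a j * b j' * (if j = j' then c j else 0)) = (\<Sum>j\<in>J. a j * b j * (c j :: real))"
  using assms by (intro sum.cong refl) (simp add: if_distrib[of "(*) _"] cong: if_cong)

text \<open>Parseval's identity for each derivative: the Sobolev norm is diagonal in the
  coefficients, so lying in the ball becomes an ellipsoid condition.\<close>

lemma trig_poly_in_sobolev_ball:
  assumes J: "finite J" "\<And>j. j \<in> J \<Longrightarrow> 1 \<le> fst j"
    and le: "(\<Sum>j\<in>J. sobolev_weight k (fst j) * (\<theta> j)\<^sup>2) \<le> r"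
  shows "trig_poly J \<theta> \<in> sobolev_ball k r"
proof -
  have "integral {0..1} (\<lambda>x. (deriv01 i (trig_poly J \<theta>) x)\<^sup>2) = (\<Sum>j\<in>J. (2 * pi * real (fst j)) ^ (2 * i) * (\<theta> j)\<^sup>2)" for i
  proof (rule integral_unique)
    have "((\<lambda>x. \<Sum>j\<in>J. \<Sum>j'\<in>J. \<theta> j * \<theta> j' * (fourier_deriv i j x * fourier_deriv i j' x)) has_integral
       (\<Sum>j\<in>J. \<Sum>j'\<in>J. \<theta> j * \<theta> j' * (if j = j' then (2 * pi * real (fst j)) ^ (2 * i) else 0))) {0..1}"
      by (intro has_integral_sum has_integral_mult_right fourier_deriv_orthogonal J)
    then have "((\<lambda>x. (\<Sum>j\<in>J. \<theta> j * fourier_deriv i j x)\<^sup>2) has_integral (\<Sum>j\<in>J. (2 * pi * real (fst j)) ^ (2 * i) * (\<theta> j)\<^sup>2)) {0..1}"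
      by (simp only: sum_sum_delta[OF J(1)])
         (simp add: power2_eq_square sum_product mult_ac)
    then show "((\<lambda>x. (deriv01 i (trig_poly J \<theta>) x)\<^sup>2) has_integral (\<Sum>j\<in>J. (2 * pi * real (fst j)) ^ (2 * i) * (\<theta> j)\<^sup>2)) {0..1}"
      by (rule has_integral_eq[rotated]) (simp add: deriv01_trig_poly)
  qed
  then have "(\<Sum>i=0..k. integral {0..1} (\<lambda>x. (deriv01 i (trig_poly J \<theta>) x)\<^sup>2)) = (\<Sum>j\<in>J. sobolev_weight k (fst j) * (\<theta> j)\<^sup>2)"
    unfolding sobolev_weight_def sum_distrib_right by (simp only:) (rule sum.swap)
  then show ?thesis using le trig_poly_in_C_per by (simp add: sobolev_ball_def)
qed

section \<open>Fourier coefficients and Bessel's inequality on the unit interval\<close>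

abbreviation unit_interval_measure :: "real measure" where
  "unit_interval_measure \<equiv> restrict_space lborel {0..1}"

lemma integral_unit_interval_measure:
  fixes f :: "real \<Rightarrow> real"
  assumes "continuous_on {0..1} f" "(f has_integral c) {0..1}"
  shows "integrable unit_interval_measure f" "(\<integral>x. f x \<partial>unit_interval_measure) = c"
proof -
  have i: "set_integrable lborel {0..1} f"
    by (rule borel_integrable_atLeastAtMost'[OF assms(1)])
  then show "integrable unit_interval_measure f"
    by (simp add: integrable_restrict_space set_integrable_def)
  have "(\<integral>x. f x \<partial>unit_interval_measure) = (LINT x:{0..1}|lborel. f x)"
    by (subst integral_restrict_space) (auto simp: set_lebesgue_integral_def)
  also have "\<dots> = integral {0..1} f" by (rule set_borel_integral_eq_integral(2)[OF i])
  also have "\<dots> = c" by (rule integral_unique[OF assms(2)])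
  finally show "(\<integral>x. f x \<partial>unit_interval_measure) = c" .
qed

definition fourier_coeff :: "(real \<Rightarrow> real) \<Rightarrow> nat \<times> bool \<Rightarrow> real" where
  "fourier_coeff f j = (\<integral>x. f x * fourier_fun j x \<partial>unit_interval_measure)"

lemma abs_fourier_fun_le: "\<bar>fourier_fun j x\<bar> \<le> 2"
proof -
  have "sqrt 2 * \<bar>cos y\<bar> \<le> 2 * 1" for y :: real
    using sqrt2_less_2 by (intro mult_mono) auto
  then show ?thesis by (simp add: fourier_deriv_def abs_mult)
qed

text \<open>Let \<open>h\<close> be the difference of \<open>f\<close> and the trigonometric
  polynomial. If \<open>h\<close> is not square integrable, the right side is infinite, so the
  default value of an undefined coefficient does no harm. Otherwise \<open>h\<close> minus its
  projection \<open>P\<close> has nonnegative squared norm.\<close>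

lemma bessel_inequality:
  assumes f: "f \<in> borel_measurable (restrict_space borel {0..1})"
    and J: "finite J" "\<And>j. j \<in> J \<Longrightarrow> 1 \<le> fst j"
  shows "(\<Sum>j\<in>J. ennreal ((fourier_coeff f j - \<theta> j)\<^sup>2)) \<le> (\<integral>\<^sup>+s\<in>{0..1}. ennreal ((f s - trig_poly J \<theta> s)\<^sup>2) \<partial>lborel)"
proof -
  let ?\<mu> = unit_interval_measure
  interpret \<mu>: finite_measure ?\<mu>
    by (intro finite_measureI) (simp add: emeasure_restrict_space)
  have sets: "sets ?\<mu> = sets (restrict_space borel {0..1})"
    by (simp add: sets_restrict_space)
  have fm[measurable]: "f \<in> borel_measurable ?\<mu>" using f by (simp add: measurable_cong_sets[OF sets refl])
  have cm: "g \<in> borel_measurable ?\<mu>" if "continuous_on UNIV g" for g :: "real \<Rightarrow> real"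
    using borel_measurable_continuous_onI[OF that] by (auto intro!: measurable_restrict_space1)
  have \<phi>m[measurable]: "fourier_fun j \<in> borel_measurable ?\<mu>" for j by (intro cm continuous_on_fourier_deriv)
  have Sm[measurable]: "trig_poly J \<theta> \<in> borel_measurable ?\<mu>"
    unfolding trig_poly_def[abs_def] by measurable
  define h where "h x = f x - trig_poly J \<theta> x" for x
  have hm[measurable]: "h \<in> borel_measurable ?\<mu>" unfolding h_def[abs_def] by measurable
  have R: "(\<integral>\<^sup>+s\<in>{0..1}. ennreal ((f s - trig_poly J \<theta> s)\<^sup>2) \<partial>lborel) = (\<integral>\<^sup>+s. ennreal ((h s)\<^sup>2) \<partial>?\<mu>)"
    by (simp add: nn_integral_restrict_space h_def)
  have ortho: "integrable ?\<mu> (\<lambda>x. fourier_fun j x * fourier_fun j' x)"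
     "(\<integral>x. fourier_fun j x * fourier_fun j' x \<partial>?\<mu>) = (if j = j' then 1 else 0)" if "1 \<le> fst j" for j j'
  proof -
    have "continuous_on {0..1} (\<lambda>x. fourier_fun j x * fourier_fun j' x)"
      by (intro continuous_intros continuous_on_fourier_deriv)
    from integral_unit_interval_measure[OF this fourier_deriv_orthogonal[OF that]]
    show "integrable ?\<mu> (\<lambda>x. fourier_fun j x * fourier_fun j' x)"
      "(\<integral>x. fourier_fun j x * fourier_fun j' x \<partial>?\<mu>) = (if j = j' then 1 else 0)" by simp_all
  qed
  show ?thesis
  proof (cases "(\<integral>\<^sup>+s. ennreal ((h s)\<^sup>2) \<partial>?\<mu>) = \<infinity>")
    case True
    then show ?thesis unfolding R by simp
  next
    case False
    have h2: "integrable ?\<mu> (\<lambda>s. (h s)\<^sup>2)"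
      using False by (intro integrableI_nonneg) (auto simp: less_top)
    have h1: "integrable ?\<mu> h"
    proof (rule Bochner_Integration.integrable_bound[of _ "\<lambda>s. 1 + (h s)\<^sup>2"])
      show "integrable ?\<mu> (\<lambda>s. 1 + (h s)\<^sup>2)" using h2 by auto
      have "\<bar>x\<bar> \<le> 1 + x\<^sup>2" for x :: real
      proof -
        have "0 \<le> (\<bar>x\<bar> - 1)\<^sup>2" by simp
        then have "2 * \<bar>x\<bar> \<le> 1 + x\<^sup>2" by (simp add: power2_diff)
        then show ?thesis by linarith
      qed
      then show "AE s in ?\<mu>. norm (h s) \<le> norm (1 + (h s)\<^sup>2)" by (auto intro: order.trans)
    qed simp
    have bdd: "integrable ?\<mu> (\<lambda>x. g x * fourier_fun j x)" if "integrable ?\<mu> g" for g j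
    proof (rule Bochner_Integration.integrable_bound[of _ "\<lambda>x. 2 * g x"])
      show "integrable ?\<mu> (\<lambda>x. 2 * g x)" using that by auto
      show "(\<lambda>x. g x * fourier_fun j x) \<in> borel_measurable ?\<mu>" using that by auto
      show "AE x in ?\<mu>. norm (g x * fourier_fun j x) \<le> norm (2 * g x)"
      proof (rule AE_I2)
        fix x
        show "norm (g x * fourier_fun j x) \<le> norm (2 * g x)"
          using mult_left_mono[OF abs_fourier_fun_le[of j x], of "\<bar>g x\<bar>"] by (simp add: abs_mult mult.commute)
      qed
    qed
    define d where "d j = (\<integral>x. h x * fourier_fun j x \<partial>?\<mu>)" for j
    have d: "fourier_coeff f j - \<theta> j = d j" if "j \<in> J" for j
    proof -
      have iS: "integrable ?\<mu> (\<lambda>x. trig_poly J \<theta> x * fourier_fun j x)"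
        unfolding trig_poly_def sum_distrib_right mult.assoc using ortho(1)[OF J(2)] by auto
      have "(\<integral>x. trig_poly J \<theta> x * fourier_fun j x \<partial>?\<mu>) = (\<Sum>j'\<in>J. \<theta> j' * (\<integral>x. fourier_fun j' x * fourier_fun j x \<partial>?\<mu>))"
        unfolding trig_poly_def sum_distrib_right mult.assoc using ortho(1)[OF J(2)]
        by (subst Bochner_Integration.integral_sum) auto
      also have "\<dots> = (\<Sum>j'\<in>J. \<theta> j' * (if j' = j then 1 else 0))"
        using ortho(2)[OF J(2)] by (intro sum.cong) auto
      also have "\<dots> = \<theta> j" using J(1) that by (simp add: if_distrib[of "(*) _"] cong: if_cong)
      finally have S: "(\<integral>x. trig_poly J \<theta> x * fourier_fun j x \<partial>?\<mu>) = \<theta> j" .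
      have "fourier_coeff f j = (\<integral>x. h x * fourier_fun j x + trig_poly J \<theta> x * fourier_fun j x \<partial>?\<mu>)"
        unfolding fourier_coeff_def by (simp add: h_def algebra_simps)
      also have "\<dots> = d j + \<theta> j" unfolding d_def S[symmetric]
        by (intro Bochner_Integration.integral_add bdd h1 iS)
      finally show ?thesis by simp
    qed
    define P where "P x = (\<Sum>j\<in>J. d j * fourier_fun j x)" for x
    have iP2: "integrable ?\<mu> (\<lambda>x. (P x)\<^sup>2)" and P2: "(\<integral>x. (P x)\<^sup>2 \<partial>?\<mu>) = (\<Sum>j\<in>J. (d j)\<^sup>2)"
    proof -
      have e: "(P x)\<^sup>2 = (\<Sum>j\<in>J. \<Sum>j'\<in>J. d j * d j' * (fourier_fun j x * fourier_fun j' x))" for x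
        by (simp add: P_def power2_eq_square sum_product mult_ac)
      show "integrable ?\<mu> (\<lambda>x. (P x)\<^sup>2)" unfolding e using ortho(1)[OF J(2)] by auto
      have "(\<integral>x. (P x)\<^sup>2 \<partial>?\<mu>) = (\<Sum>j\<in>J. \<Sum>j'\<in>J. d j * d j' * (if j = j' then 1 else 0))"
        unfolding e using ortho[OF J(2)] by (simp add: Bochner_Integration.integral_sum)
      then show "(\<integral>x. (P x)\<^sup>2 \<partial>?\<mu>) = (\<Sum>j\<in>J. (d j)\<^sup>2)"
        using sum_sum_delta[OF J(1), of d d "\<lambda>_. 1"] by (simp add: power2_eq_square)
    qed
    have hP: "h x * P x = (\<Sum>j\<in>J. d j * (h x * fourier_fun j x))" for x
      by (simp add: P_def sum_distrib_left mult_ac)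
    have ihP: "integrable ?\<mu> (\<lambda>x. h x * P x)" and ihPv: "(\<integral>x. h x * P x \<partial>?\<mu>) = (\<Sum>j\<in>J. (d j)\<^sup>2)"
      unfolding hP using bdd[OF h1] by (auto simp: Bochner_Integration.integral_sum d_def[symmetric] power2_eq_square)
    have "0 \<le> (\<integral>x. (h x - P x)\<^sup>2 \<partial>?\<mu>)" by (intro Bochner_Integration.integral_nonneg) auto
    also have "\<dots> = (\<integral>x. ((h x)\<^sup>2 - 2 * (h x * P x)) + (P x)\<^sup>2 \<partial>?\<mu>)"
      by (intro Bochner_Integration.integral_cong) (auto simp: power2_diff)
    also have "\<dots> = (\<integral>x. (h x)\<^sup>2 \<partial>?\<mu>) - 2 * (\<Sum>j\<in>J. (d j)\<^sup>2) + (\<Sum>j\<in>J. (d j)\<^sup>2)"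
      using h2 ihP iP2 by (simp add: ihPv P2)
    finally have "(\<Sum>j\<in>J. (d j)\<^sup>2) \<le> (\<integral>x. (h x)\<^sup>2 \<partial>?\<mu>)" by simp
    then have "ennreal (\<Sum>j\<in>J. (d j)\<^sup>2) \<le> (\<integral>\<^sup>+x. ennreal ((h x)\<^sup>2) \<partial>?\<mu>)"
      by (subst nn_integral_eq_integral[OF h2]) (auto intro: ennreal_leI)
    also have "ennreal (\<Sum>j\<in>J. (d j)\<^sup>2) = (\<Sum>j\<in>J. ennreal ((fourier_coeff f j - \<theta> j)\<^sup>2))"
      using d by (subst sum_ennreal[symmetric]) auto
    finally show ?thesis unfolding R .
  qed
qed

section \<open>Bayes risk of the Fourier coefficients\<close>

abbreviation normal_measure :: "real \<Rightarrow> real measure" where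
  "normal_measure \<tau> \<equiv> density lborel (normal_density 0 \<tau>)"

lemma integral_trig_poly:
  assumes "finite J"
  shows "integral {0..t} (trig_poly J \<theta>) = (\<Sum>j\<in>J. \<theta> j * integral {0..t} (fourier_fun j))"
  unfolding trig_poly_def[abs_def] using assms
  by (subst Henstock_Kurzweil_Integration.integral_sum)
     (auto intro!: integrable_continuous_real continuous_intros continuous_on_fourier_deriv)

lemma continuous_on_integral_fourier_fun:
  "continuous_on {0..T} (\<lambda>t. integral {0..t} (fourier_fun j))"
  by (intro indefinite_integral_continuous_1 integrable_continuous_real continuous_on_fourier_deriv)

lemma continuous_on_integral_trig_poly:
  assumes "finite J"
  shows "continuous_on {0..T} (\<lambda>t. integral {0..t} (trig_poly J \<theta>))"
  unfolding integral_trig_poly[OF assms]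
  by (intro continuous_intros continuous_on_integral_fourier_fun)

lemma measurable_trig_path:
  assumes "brownian_motion M w" "finite J" "sets A = sets (PiM J (\<lambda>_. borel))"
  shows "(\<lambda>z. \<lambda>t\<in>{0..T}. integral {0..t} (trig_poly J (fst z)) + s * w t (snd z)) \<in> A \<Otimes>\<^sub>M M \<rightarrow>\<^sub>M skorokhod_space T"
proof (rule measurable_skorokhod_space)
  have A: "sets (A \<Otimes>\<^sub>M M) = sets (PiM J (\<lambda>_. borel) \<Otimes>\<^sub>M M)"
    by (rule sets_pair_measure_cong[OF assms(3) refl])
  fix t assume "t \<in> {0..T}"
  then have [measurable]: "w t \<in> borel_measurable M"
    using assms(1) by (auto simp: brownian_motion_def)
  have "(\<lambda>z. integral {0..t} (trig_poly J (fst z)) + s * w t (snd z)) \<in> borel_measurable (PiM J (\<lambda>_. borel) \<Otimes>\<^sub>M M)"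
    unfolding integral_trig_poly[OF assms(2)] by measurable
  then show "(\<lambda>z. integral {0..t} (trig_poly J (fst z)) + s * w t (snd z)) \<in> borel_measurable (A \<Otimes>\<^sub>M M)"
    by (simp add: measurable_cong_sets[OF A refl])
next
  fix z assume "z \<in> space (A \<Otimes>\<^sub>M M)"
  then have "continuous_on {0..} (\<lambda>t. w t (snd z))"
    using assms(1) by (auto simp: brownian_motion_def space_pair_measure)
  then have "continuous_on {0..T} (\<lambda>t. w t (snd z))" by (rule continuous_on_subset) auto
  then show "cadlag_on {0..T} (\<lambda>t. integral {0..t} (trig_poly J (fst z)) + s * w t (snd z))"
    by (intro continuous_imp_cadlag_on continuous_intros continuous_on_integral_trig_poly assms(2))
qed

lemma sets_PiM_normal_measure: "sets (PiM J (\<lambda>j. normal_measure (\<tau> j))) = sets (PiM J (\<lambda>_. borel))"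
  by (intro sets_PiM_cong) auto

text \<open>Only the \<open>j\<close>-th coordinate is treated as unknown: conditionally on the other coordinates the
  model is one-dimensional.\<close>

lemma coordinate_bayes_risk:
  fixes M :: "'a measure" and \<tau> :: "nat \<times> bool \<Rightarrow> real"
  assumes M: "prob_space M" and w: "brownian_motion M w"
    and n: "1 \<le> n" and s: "0 < s" and \<tau>: "\<And>j. 0 < \<tau> j"
    and J: "finite J" "j \<in> J" "1 \<le> fst j"
    and g: "g \<in> borel_measurable (skorokhod_space (real n))" "\<And>y. \<bar>g y\<bar> \<le> B"
  shows "ennreal (1 / (1 / (\<tau> j)\<^sup>2 + real n / s\<^sup>2)) \<le>
    (\<integral>\<^sup>+\<theta>. (\<integral>\<^sup>+\<omega>. ennreal ((g (\<lambda>t\<in>{0..real n}. integral {0..t} (trig_poly J \<theta>) + s * w t \<omega>) - \<theta> j)\<^sup>2) \<partial>M)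
      \<partial>PiM J (\<lambda>j. normal_measure (\<tau> j)))"
proof -
  interpret prob_space M by (rule M)
  interpret P: product_prob_space "\<lambda>j. normal_measure (\<tau> j)"
    using prob_space_normal_density[OF \<tau>]
    by (auto simp: product_prob_space_def product_prob_space_axioms_def product_sigma_finite_def prob_space_imp_sigma_finite)
  define J' where "J' = J - {j}"
  have J': "finite J'" "j \<notin> J'" and ins: "J = insert j J'" using J by (auto simp: J'_def)
  define F where "F \<theta> = (\<integral>\<^sup>+\<omega>. ennreal ((g (\<lambda>t\<in>{0..real n}. integral {0..t} (trig_poly J \<theta>) + s * w t \<omega>) - \<theta> j)\<^sup>2) \<partial>M)" for \<theta>
  have "(\<lambda>z. g (\<lambda>t\<in>{0..real n}. integral {0..t} (trig_poly J (fst z)) + s * w t (snd z)))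
     \<in> borel_measurable (PiM J (\<lambda>j. normal_measure (\<tau> j)) \<Otimes>\<^sub>M M)"
    by (rule measurable_compose[OF measurable_trig_path[OF w J(1) sets_PiM_normal_measure] g(1)])
  moreover have "(\<lambda>z. fst z j) \<in> borel_measurable (PiM J (\<lambda>j. normal_measure (\<tau> j)) \<Otimes>\<^sub>M M)"
  proof -
    have "(\<lambda>z. fst z j) \<in> PiM J (\<lambda>j. normal_measure (\<tau> j)) \<Otimes>\<^sub>M M \<rightarrow>\<^sub>M normal_measure (\<tau> j)"
      using J(2) by measurable
    then show ?thesis by simp
  qed
  ultimately have "(\<lambda>z. ennreal ((g (\<lambda>t\<in>{0..real n}. integral {0..t} (trig_poly J (fst z)) + s * w t (snd z)) - fst z j)\<^sup>2))
     \<in> borel_measurable (PiM J (\<lambda>j. normal_measure (\<tau> j)) \<Otimes>\<^sub>M M)" by measurable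
  then have Fm: "F \<in> borel_measurable (PiM (insert j J') (\<lambda>j. normal_measure (\<tau> j)))"
    unfolding F_def[abs_def] ins[symmetric] by (intro borel_measurable_nn_integral) (simp add: split_beta')
  have ne: "emeasure (PiM J' (\<lambda>j. normal_measure (\<tau> j))) (space (PiM J' (\<lambda>j. normal_measure (\<tau> j)))) = 1"
    by (intro prob_space.emeasure_space_1 prob_space_PiM) (simp add: prob_space_normal_density \<tau>)
  have inner: "ennreal (1 / (1 / (\<tau> j)\<^sup>2 + real n / s\<^sup>2)) \<le> (\<integral>\<^sup>+x. F (\<theta>(j := x)) \<partial>normal_measure (\<tau> j))" for \<theta>
  proof -
    \<comment> \<open>With the other coefficients held fixed, their contribution is a known
      continuous drift.\<close>
    define \<Psi> where "\<Psi> t = (\<Sum>i\<in>J'. \<theta> i * integral {0..t} (fourier_fun i))" for t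
    have split: "integral {0..t} (trig_poly J (\<theta>(j := x))) = x * integral {0..t} (fourier_fun j) + \<Psi> t" for t x
    proof -
      have "(\<Sum>i\<in>J'. (\<theta>(j := x)) i * integral {0..t} (fourier_fun i)) = \<Psi> t"
        unfolding \<Psi>_def using J'(2) by (intro sum.cong) auto
      then show ?thesis unfolding integral_trig_poly[OF J(1)] unfolding ins using J' by simp
    qed
    have "continuous_on {0..real n} \<Psi>" unfolding \<Psi>_def[abs_def]
      by (intro continuous_intros continuous_on_integral_fourier_fun)
    moreover have "integral {0..real n} (\<lambda>t. (fourier_fun j t)\<^sup>2) \<le> real n"
      using integral_unique[OF fourier_fun_square_has_integral[OF J(3), of n]] by simp
    ultimately show ?thesis
      using brownian_bayes_risk[OF M w _ s \<tau>, of "real n" "fourier_fun j" "real n" \<Psi> g B j] n g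
      by (simp add: F_def split continuous_on_fourier_deriv)
  qed
  have "ennreal (1 / (1 / (\<tau> j)\<^sup>2 + real n / s\<^sup>2)) = (\<integral>\<^sup>+\<theta>. ennreal (1 / (1 / (\<tau> j)\<^sup>2 + real n / s\<^sup>2)) \<partial>PiM J' (\<lambda>j. normal_measure (\<tau> j)))"
    by (simp add: ne)
  also have "\<dots> \<le> (\<integral>\<^sup>+\<theta>. (\<integral>\<^sup>+x. F (\<theta>(j := x)) \<partial>normal_measure (\<tau> j)) \<partial>PiM J' (\<lambda>j. normal_measure (\<tau> j)))"
    by (intro nn_integral_mono inner)
  also have "\<dots> = (\<integral>\<^sup>+\<theta>. F \<theta> \<partial>PiM J (\<lambda>j. normal_measure (\<tau> j)))"
    unfolding ins by (rule P.product_nn_integral_insert[OF J' Fm, symmetric])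
  finally show ?thesis unfolding F_def .
qed

section \<open>Measurability of estimated coefficients and the risk under Brownian noise\<close>

lemma sets_unit_interval_measure: "sets unit_interval_measure = sets (restrict_space borel {0..1})"
  by (simp add: sets_restrict_space)

lemma sigma_finite_unit_interval_measure: "sigma_finite_measure unit_interval_measure"
  by (intro finite_measure.axioms(1) finite_measureI) (simp add: emeasure_restrict_space)

lemma estimator_measurable:
  assumes "E \<in> estimators T"
  shows "(\<lambda>(y, u). E y u) \<in> borel_measurable (skorokhod_space T \<Otimes>\<^sub>M unit_interval_measure)"
  using assms
  by (simp add: estimators_def measurable_cong_sets[OF sets_pair_measure_cong[OF refl sets_unit_interval_measure] refl])

lemma fourier_fun_measurable_unit: "fourier_fun j \<in> borel_measurable unit_interval_measure"
  using borel_measurable_continuous_onI[OF continuous_on_fourier_deriv[of UNIV 0 j]]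
  by (auto intro!: measurable_restrict_space1)

lemma fourier_coeff_measurable:
  assumes "E \<in> estimators T"
  shows "(\<lambda>y. fourier_coeff (E y) j) \<in> borel_measurable (skorokhod_space T)"
  unfolding fourier_coeff_def
proof (rule sigma_finite_measure.borel_measurable_lebesgue_integral[OF sigma_finite_unit_interval_measure])
  note [measurable] = estimator_measurable[OF assms] fourier_fun_measurable_unit
  show "(\<lambda>(y, x). E y x * fourier_fun j x) \<in> borel_measurable (skorokhod_space T \<Otimes>\<^sub>M unit_interval_measure)"
    by measurable
qed

lemma noise_law_brownian:
  assumes "brownian_motion M w"
  shows "noise_law M w L \<tau> Y T s 0 0 = distr M (skorokhod_space T) (\<lambda>\<omega>. \<lambda>t\<in>{0..T}. s * w t \<omega>)"
    and "(\<lambda>\<omega>. \<lambda>t\<in>{0..T}. s * w t \<omega>) \<in> M \<rightarrow>\<^sub>M skorokhod_space T"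
proof -
  show "noise_law M w L \<tau> Y T s 0 0 = distr M (skorokhod_space T) (\<lambda>\<omega>. \<lambda>t\<in>{0..T}. s * w t \<omega>)"
    by (simp add: noise_law_def)
  show "(\<lambda>\<omega>. \<lambda>t\<in>{0..T}. s * w t \<omega>) \<in> M \<rightarrow>\<^sub>M skorokhod_space T"
  proof (rule measurable_skorokhod_space)
    fix t assume "t \<in> {0..T}"
    then have [measurable]: "w t \<in> borel_measurable M"
      using assms by (auto simp: brownian_motion_def)
    show "(\<lambda>\<omega>. s * w t \<omega>) \<in> borel_measurable M" by measurable
  next
    fix \<omega> assume "\<omega> \<in> space M"
    then have "continuous_on {0..} (\<lambda>t. w t \<omega>)" using assms by (auto simp: brownian_motion_def)
    then have "continuous_on {0..T} (\<lambda>t. w t \<omega>)" by (rule continuous_on_subset) auto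
    then show "cadlag_on {0..T} (\<lambda>t. s * w t \<omega>)"
      by (intro continuous_imp_cadlag_on continuous_intros)
  qed
qed

text \<open>Pulls the risk back through two image measures, the noise law and the shift by the
  signal, to the probability space of \<open>w\<close>, where the Bayes bounds live. The shift maps
  cadlag paths to cadlag paths because the integrated signal is continuous.\<close>

lemma risk_trig_poly:
  assumes w: "brownian_motion M w" and J: "finite J" and E: "E \<in> estimators T"
  shows "risk T (noise_law M w L \<tau> Y T s 0 0) E (trig_poly J \<theta>) =
    (\<integral>\<^sup>+\<omega>. (\<integral>\<^sup>+u\<in>{0..1}. ennreal ((E (\<lambda>t\<in>{0..T}. integral {0..t} (trig_poly J \<theta>) + s * w t \<omega>) u - trig_poly J \<theta> u)\<^sup>2) \<partial>lborel) \<partial>M)"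
proof -
  let ?S = "trig_poly J \<theta>"
  define G where "G y = (\<integral>\<^sup>+u\<in>{0..1}. ennreal ((E y u - ?S u)\<^sup>2) \<partial>lborel)" for y
  have Sm[measurable]: "?S \<in> borel_measurable unit_interval_measure"
    unfolding trig_poly_def[abs_def] using fourier_fun_measurable_unit by measurable
  note [measurable] = estimator_measurable[OF E]
  have "G = (\<lambda>y. \<integral>\<^sup>+u. ennreal ((E y u - ?S u)\<^sup>2) \<partial>unit_interval_measure)"
    by (simp add: G_def[abs_def] nn_integral_restrict_space)
  also have "\<dots> \<in> borel_measurable (skorokhod_space T)"
    by (intro sigma_finite_measure.borel_measurable_nn_integral[OF sigma_finite_unit_interval_measure]) measurable
  finally have Gm: "G \<in> borel_measurable (skorokhod_space T)" .
  let ?Q = "noise_law M w L \<tau> Y T s 0 0"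
  let ?sh = "\<lambda>x. \<lambda>t\<in>{0..T}. integral {0..t} ?S + x t"
  have sh: "?sh \<in> ?Q \<rightarrow>\<^sub>M skorokhod_space T"
  proof (rule measurable_skorokhod_space)
    fix t assume "t \<in> {0..T}"
    then have "(\<lambda>x. x t) \<in> borel_measurable ?Q"
      using measurable_skorokhod_coord by (simp add: noise_law_def)
    then show "(\<lambda>x. integral {0..t} ?S + x t) \<in> borel_measurable ?Q" by measurable
  next
    fix x assume "x \<in> space ?Q"
    then have "cadlag_on {0..T} x" by (simp add: noise_law_def space_skorokhod_space)
    then show "cadlag_on {0..T} (\<lambda>t. integral {0..t} ?S + x t)"
      by (intro cadlag_on_add_continuous continuous_on_integral_trig_poly J)
  qed
  have "risk T ?Q E ?S = (\<integral>\<^sup>+y. G y \<partial>observation_law T ?Q ?S)" by (simp add: risk_def G_def)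
  also have "\<dots> = (\<integral>\<^sup>+x. G (?sh x) \<partial>?Q)"
    unfolding observation_law_def using Gm by (intro nn_integral_distr sh) simp
  also have "\<dots> = (\<integral>\<^sup>+\<omega>. G (?sh (\<lambda>t\<in>{0..T}. s * w t \<omega>)) \<partial>M)"
    unfolding noise_law_brownian(1)[OF w]
  proof (rule nn_integral_distr[OF noise_law_brownian(2)[OF w]])
    have "?sh \<in> skorokhod_space T \<rightarrow>\<^sub>M skorokhod_space T"
      using sh by (simp add: noise_law_def cong: measurable_cong_sets)
    from measurable_compose[OF this Gm]
    show "(\<lambda>x. G (?sh x)) \<in> borel_measurable (distr M (skorokhod_space T) (\<lambda>\<omega>. \<lambda>t\<in>{0..T}. s * w t \<omega>))"
      by simp
  qed
  also have "\<dots> = (\<integral>\<^sup>+\<omega>. G (\<lambda>t\<in>{0..T}. integral {0..t} ?S + s * w t \<omega>) \<partial>M)"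
    by (intro nn_integral_cong arg_cong[where f = G]) auto
  finally show ?thesis unfolding G_def .
qed

section \<open>Restriction of the prior to the Sobolev ball\<close>

text \<open>The exponential factor turns the centred normal density of variance
  \<open>\<tau>\<^sup>2\<close> into \<open>1 / sqrt q\<close> times that of variance
  \<open>\<tau>\<^sup>2 / q\<close>, where \<open>q = 1 - 2 * c * \<tau>\<^sup>2\<close>.\<close>

lemma gaussian_exp_square:
  assumes "0 < \<tau>" "2 * c * \<tau>\<^sup>2 < 1"
  shows "(\<integral>\<^sup>+x. ennreal (exp (c * x\<^sup>2)) \<partial>normal_measure \<tau>) = ennreal (1 / sqrt (1 - 2 * c * \<tau>\<^sup>2))"
proof -
  define q where "q = 1 - 2 * c * \<tau>\<^sup>2"
  have q: "0 < q" using assms(2) by (simp add: q_def)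
  have eq: "normal_density 0 \<tau> x * exp (c * x\<^sup>2) = 1 / sqrt q * normal_density 0 (\<tau> / sqrt q) x" for x
  proof -
    have "- x\<^sup>2 / (2 * \<tau>\<^sup>2) + c * x\<^sup>2 = - x\<^sup>2 / (2 * (\<tau> / sqrt q)\<^sup>2)"
      using assms(1) q by (simp add: power_divide q_def field_simps)
    moreover have "sqrt (2 * pi * \<tau>\<^sup>2) = sqrt q * sqrt (2 * pi * (\<tau> / sqrt q)\<^sup>2)"
      using q by (simp add: real_sqrt_mult[symmetric] power_divide)
    ultimately show ?thesis
      by (simp add: normal_density_def mult_exp_exp)
  qed
  have "(\<integral>\<^sup>+x. ennreal (exp (c * x\<^sup>2)) \<partial>normal_measure \<tau>) = (\<integral>\<^sup>+x. ennreal (normal_density 0 \<tau> x * exp (c * x\<^sup>2)) \<partial>lborel)"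
    by (subst nn_integral_density) (auto simp: ennreal_mult)
  also have "\<dots> = ennreal (1 / sqrt q) * (\<integral>\<^sup>+x. ennreal (normal_density 0 (\<tau> / sqrt q) x) \<partial>lborel)"
  proof -
    have "ennreal (normal_density 0 \<tau> x * exp (c * x\<^sup>2)) = ennreal (1 / sqrt q) * ennreal (normal_density 0 (\<tau> / sqrt q) x)" for x
      unfolding eq using q by (intro ennreal_mult) auto
    then show ?thesis by (simp add: nn_integral_cmult)
  qed
  also have "(\<integral>\<^sup>+x. ennreal (normal_density 0 (\<tau> / sqrt q) x) \<partial>lborel) = 1"
    using q assms(1) by (subst nn_integral_eq_integral) auto
  finally show ?thesis by (simp add: q_def)
qed

text \<open>Half of the estimate \<open>ln (1 - x) \<ge> - x - 2 * x\<^sup>2\<close> at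
  \<open>x = 2 * b\<close>. The linear term is exact, so the exponent in
  \<open>gaussian_product_tail\<close> is \<kappa> times the expected Sobolev norm up to second
  order.\<close>

lemma inverse_sqrt_le_exp:
  fixes b :: real
  assumes "0 \<le> b" "b \<le> 1 / 4"
  shows "1 / sqrt (1 - 2 * b) \<le> exp (b + 4 * b\<^sup>2)"
proof -
  have "- (2 * b) - 2 * (2 * b)\<^sup>2 \<le> ln (1 - 2 * b)"
    using assms by (intro ln_one_minus_pos_lower_bound) auto
  then have "exp (- (2 * b) - 2 * (2 * b)\<^sup>2) \<le> exp (ln (1 - 2 * b))" by simp
  also have "\<dots> = 1 - 2 * b" using assms by simp
  finally have "sqrt (exp (- (2 * b) - 2 * (2 * b)\<^sup>2)) \<le> sqrt (1 - 2 * b)" by simp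
  moreover have "sqrt (exp (- (2 * b) - 2 * (2 * b)\<^sup>2)) = exp (- (b + 4 * b\<^sup>2))"
  proof (rule real_sqrt_unique)
    show "(exp (- (b + 4 * b\<^sup>2)))\<^sup>2 = exp (- (2 * b) - 2 * (2 * b)\<^sup>2)"
      by (simp add: exp_double[symmetric] power_mult_distrib)
  qed simp
  ultimately have "exp (- (b + 4 * b\<^sup>2)) \<le> sqrt (1 - 2 * b)" by linarith
  then have "1 / sqrt (1 - 2 * b) \<le> 1 / exp (- (b + 4 * b\<^sup>2))"
    using assms by (intro divide_left_mono mult_pos_pos) auto
  then show ?thesis by (simp only: exp_minus divide_inverse mult_1_left inverse_inverse_eq)
qed

lemma sobolev_weight_ge_1: "1 \<le> sobolev_weight k l"
proof -
  have "(\<Sum>i\<in>{0}. (2 * pi * real l) ^ (2 * i)) \<le> sobolev_weight k l"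
    unfolding sobolev_weight_def by (intro sum_mono2) auto
  then show ?thesis by simp
qed

text \<open>A Chernoff bound for the truncated first moment of the squared norm and not merely for
  the probability of exceeding \<open>r\<close>, since off the ball the loss still grows with the
  norm.\<close>

lemma gaussian_product_tail:
  fixes a \<tau> :: "'i \<Rightarrow> real"
  assumes J: "finite J" and \<tau>: "\<And>j. 0 < \<tau> j" and a: "\<And>j. 0 \<le> a j" and r: "0 < r" "1 / r \<le> \<kappa>"
    and small: "\<And>j. j \<in> J \<Longrightarrow> \<kappa> * a j * (\<tau> j)\<^sup>2 \<le> 1 / 4"
  shows "(\<integral>\<^sup>+\<theta>. ennreal (if r < (\<Sum>j\<in>J. a j * (\<theta> j)\<^sup>2) then (\<Sum>j\<in>J. a j * (\<theta> j)\<^sup>2) else 0) \<partial>PiM J (\<lambda>j. normal_measure (\<tau> j)))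
    \<le> ennreal (r * exp (- \<kappa> * r + (\<Sum>j\<in>J. \<kappa> * a j * (\<tau> j)\<^sup>2 + 4 * (\<kappa> * a j * (\<tau> j)\<^sup>2)\<^sup>2)))"
proof -
  interpret P: product_sigma_finite "\<lambda>j. normal_measure (\<tau> j)"
    using prob_space_normal_density[OF \<tau>]
    by (auto simp: product_sigma_finite_def prob_space_imp_sigma_finite)
  have l0: "0 < \<kappa>" using r by (auto intro: less_le_trans[of 0 "1 / r"])
  \<comment> \<open>From \<open>T / r \<le> exp (T / r - 1)\<close>, and
    \<open>1 / r \<le> \<kappa>\<close> permits replacing \<open>1 / r\<close> by \<kappa> when
    \<open>T > r\<close>. In this way the exponential absorbs the factor \<open>T\<close> at the
    price of a constant \<open>r\<close>.\<close>
  have pt: "(if r < T then T else 0) \<le> r * exp (- \<kappa> * r) * exp (\<kappa> * T)" for T :: real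
  proof (cases "r < T")
    case True
    have "T / r = 1 + (T / r - 1)" by simp
    also have "\<dots> \<le> exp (T / r - 1)" by (rule exp_ge_add_one_self)
    also have "\<dots> = exp ((T - r) * (1 / r))" using r(1) by (simp add: field_simps)
    also have "\<dots> \<le> exp ((T - r) * \<kappa>)" using True r by (simp only: exp_le_cancel_iff) (intro mult_left_mono, auto)
    finally have "T \<le> r * exp ((T - r) * \<kappa>)" using r(1) by (simp add: field_simps)
    also have "\<dots> = r * exp (- \<kappa> * r) * exp (\<kappa> * T)" by (simp add: exp_add[symmetric] algebra_simps)
    finally show ?thesis using True by simp
  qed (use r in auto)
  have "(\<integral>\<^sup>+\<theta>. ennreal (if r < (\<Sum>j\<in>J. a j * (\<theta> j)\<^sup>2) then (\<Sum>j\<in>J. a j * (\<theta> j)\<^sup>2) else 0) \<partial>PiM J (\<lambda>j. normal_measure (\<tau> j)))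
    \<le> (\<integral>\<^sup>+\<theta>. ennreal (r * exp (- \<kappa> * r)) * (\<Prod>j\<in>J. ennreal (exp (\<kappa> * a j * (\<theta> j)\<^sup>2))) \<partial>PiM J (\<lambda>j. normal_measure (\<tau> j)))"
  proof (rule nn_integral_mono)
    fix \<theta> :: "'i \<Rightarrow> real"
    have "exp (\<kappa> * (\<Sum>j\<in>J. a j * (\<theta> j)\<^sup>2)) = (\<Prod>j\<in>J. exp (\<kappa> * a j * (\<theta> j)\<^sup>2))"
      by (simp add: exp_sum[OF J, symmetric] sum_distrib_left mult.assoc)
    then have "ennreal (r * exp (- \<kappa> * r)) * (\<Prod>j\<in>J. ennreal (exp (\<kappa> * a j * (\<theta> j)\<^sup>2)))
      = ennreal (r * exp (- \<kappa> * r) * exp (\<kappa> * (\<Sum>j\<in>J. a j * (\<theta> j)\<^sup>2)))"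
      using r by (simp add: prod_ennreal ennreal_mult prod_nonneg)
    then show "ennreal (if r < (\<Sum>j\<in>J. a j * (\<theta> j)\<^sup>2) then (\<Sum>j\<in>J. a j * (\<theta> j)\<^sup>2) else 0)
      \<le> ennreal (r * exp (- \<kappa> * r)) * (\<Prod>j\<in>J. ennreal (exp (\<kappa> * a j * (\<theta> j)\<^sup>2)))"
      using ennreal_leI[OF pt[of "\<Sum>j\<in>J. a j * (\<theta> j)\<^sup>2"]] by simp
  qed
  also have "\<dots> = ennreal (r * exp (- \<kappa> * r)) * (\<integral>\<^sup>+\<theta>. (\<Prod>j\<in>J. ennreal (exp (\<kappa> * a j * (\<theta> j)\<^sup>2))) \<partial>PiM J (\<lambda>j. normal_measure (\<tau> j)))"
  proof (rule nn_integral_cmult)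
    have "(\<lambda>\<theta>. \<Prod>j\<in>J. ennreal (exp (\<kappa> * a j * (\<theta> j)\<^sup>2))) \<in> borel_measurable (PiM J (\<lambda>_. borel))"
      by measurable
    then show "(\<lambda>\<theta>. \<Prod>j\<in>J. ennreal (exp (\<kappa> * a j * (\<theta> j)\<^sup>2))) \<in> borel_measurable (PiM J (\<lambda>j. normal_measure (\<tau> j)))"
      by (subst measurable_cong_sets[OF sets_PiM_cong[OF refl] refl]) auto
  qed
  also have "(\<integral>\<^sup>+\<theta>. (\<Prod>j\<in>J. ennreal (exp (\<kappa> * a j * (\<theta> j)\<^sup>2))) \<partial>PiM J (\<lambda>j. normal_measure (\<tau> j)))
     = (\<Prod>j\<in>J. \<integral>\<^sup>+x. ennreal (exp (\<kappa> * a j * x\<^sup>2)) \<partial>normal_measure (\<tau> j))"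
    by (rule P.product_nn_integral_prod[OF J]) auto
  also have "\<dots> \<le> (\<Prod>j\<in>J. ennreal (exp (\<kappa> * a j * (\<tau> j)\<^sup>2 + 4 * (\<kappa> * a j * (\<tau> j)\<^sup>2)\<^sup>2)))"
  proof (rule prod_mono_ennreal)
    fix j assume j: "j \<in> J"
    have "(\<integral>\<^sup>+x. ennreal (exp (\<kappa> * a j * x\<^sup>2)) \<partial>normal_measure (\<tau> j)) = ennreal (1 / sqrt (1 - 2 * (\<kappa> * a j * (\<tau> j)\<^sup>2)))"
      using gaussian_exp_square[OF \<tau>[of j], of "\<kappa> * a j"] small[OF j] by (simp add: mult.assoc)
    also have "\<dots> \<le> ennreal (exp (\<kappa> * a j * (\<tau> j)\<^sup>2 + 4 * (\<kappa> * a j * (\<tau> j)\<^sup>2)\<^sup>2))"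
      using l0 a[of j] small[OF j] by (intro ennreal_leI inverse_sqrt_le_exp) auto
    finally show "(\<integral>\<^sup>+x. ennreal (exp (\<kappa> * a j * x\<^sup>2)) \<partial>normal_measure (\<tau> j)) \<le> ennreal (exp (\<kappa> * a j * (\<tau> j)\<^sup>2 + 4 * (\<kappa> * a j * (\<tau> j)\<^sup>2)\<^sup>2))" .
  qed
  also have "(\<Prod>j\<in>J. ennreal (exp (\<kappa> * a j * (\<tau> j)\<^sup>2 + 4 * (\<kappa> * a j * (\<tau> j)\<^sup>2)\<^sup>2)))
     = ennreal (exp (\<Sum>j\<in>J. \<kappa> * a j * (\<tau> j)\<^sup>2 + 4 * (\<kappa> * a j * (\<tau> j)\<^sup>2)\<^sup>2))"
    by (simp add: prod_ennreal exp_sum[OF J])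
  also have "ennreal (r * exp (- \<kappa> * r)) * ennreal (exp (\<Sum>j\<in>J. \<kappa> * a j * (\<tau> j)\<^sup>2 + 4 * (\<kappa> * a j * (\<tau> j)\<^sup>2)\<^sup>2))
     = ennreal (r * exp (- \<kappa> * r + (\<Sum>j\<in>J. \<kappa> * a j * (\<tau> j)\<^sup>2 + 4 * (\<kappa> * a j * (\<tau> j)\<^sup>2)\<^sup>2)))"
    unfolding exp_add[of "- \<kappa> * r"] using r by (simp add: ennreal_mult mult.assoc)
  finally show ?thesis by (simp add: mult_left_mono)
qed

text \<open>The sum of the coordinate bounds is at most the Bayes risk of the clipped coefficient
  estimates, and that risk is split by whether the prior draw lies in the ball. Inside, Bessel's
  inequality compares with the integrated risk of \<open>E\<close>; outside, the crude bound on the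
  clipped loss meets \<open>gaussian_product_tail\<close>.\<close>

lemma minimax_lower_bound_finite_sample:
  fixes M :: "'a measure" and \<tau>' :: "nat \<times> bool \<Rightarrow> real"
  assumes M: "prob_space M" and w: "brownian_motion M w"
    and n: "1 \<le> n" and s: "0 < s" and \<tau>': "\<And>j. 0 < \<tau>' j"
    and J: "finite J" "\<And>j. j \<in> J \<Longrightarrow> 1 \<le> fst j"
    and E: "E \<in> estimators (real n)"
    and Q: "noise_law M w L \<tau> Y (real n) s 0 0 \<in> QQ"
    and r: "0 < r" "1 / r \<le> \<kappa>"
    and small: "\<And>j. j \<in> J \<Longrightarrow> \<kappa> * sobolev_weight k (fst j) * (\<tau>' j)\<^sup>2 \<le> 1 / 4"
  shows "ennreal (\<Sum>j\<in>J. 1 / (1 / (\<tau>' j)\<^sup>2 + real n / s\<^sup>2)) \<le>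
    (SUP S\<in>sobolev_ball k r. robust_risk (real n) QQ E S) +
    ennreal (2 * (real (card J) + 1) * (r * exp (- \<kappa> * r + (\<Sum>j\<in>J. \<kappa> * sobolev_weight k (fst j) * (\<tau>' j)\<^sup>2
      + 4 * (\<kappa> * sobolev_weight k (fst j) * (\<tau>' j)\<^sup>2)\<^sup>2))))"
    (is "_ \<le> ?R + ennreal (2 * (real (card J) + 1) * ?tail)")
proof -
  interpret prob_space M by (rule M)
  let ?P = "PiM J (\<lambda>j. normal_measure (\<tau>' j))"
  interpret P: prob_space ?P
    by (intro prob_space_PiM) (simp add: prob_space_normal_density \<tau>')
  define a where "a j = sobolev_weight k (fst j)" for j :: "nat \<times> bool"
  have a1: "1 \<le> a j" for j by (simp add: a_def sobolev_weight_ge_1)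
  \<comment> \<open>Weights are at least 1, so every coefficient of a function in the ball lies in
    this interval, and clipping moves the estimate no farther from it.\<close>
  define g where "g j y = max (- sqrt r) (min (sqrt r) (fourier_coeff (E y) j))" for j y
  have gm: "g j \<in> borel_measurable (skorokhod_space (real n))" for j
    unfolding g_def[abs_def] using fourier_coeff_measurable[OF E] by measurable
  have gb: "\<bar>g j y\<bar> \<le> sqrt r" for j y
    using r(1) by (auto simp: g_def abs_le_iff max_def min_def)
  define path where "path \<theta> \<omega> = (\<lambda>t\<in>{0..real n}. integral {0..t} (trig_poly J \<theta>) + s * w t \<omega>)" for \<theta> \<omega>
  define T where "T \<theta> = (\<Sum>j\<in>J. a j * (\<theta> j)\<^sup>2)" for \<theta>
  have a0: "0 \<le> a j" for j using a1[of j] by linarith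
  have sq_le_T: "(\<theta> j)\<^sup>2 \<le> T \<theta>" if "j \<in> J" for \<theta> j
  proof -
    have "1 * (\<theta> j)\<^sup>2 \<le> a j * (\<theta> j)\<^sup>2" by (intro mult_right_mono a1) auto
    also have "\<dots> \<le> T \<theta>" unfolding T_def using that J(1)
      by (intro member_le_sum) (auto intro!: mult_nonneg_nonneg a0)
    finally show ?thesis by simp
  qed
  have pm: "(\<lambda>z. path (fst z) (snd z)) \<in> ?P \<Otimes>\<^sub>M M \<rightarrow>\<^sub>M skorokhod_space (real n)"
    unfolding path_def by (rule measurable_trig_path[OF w J(1) sets_PiM_normal_measure])
  have cm: "(\<lambda>\<theta>. \<theta> j) \<in> borel_measurable ?P" if "j \<in> J" for j
    using that by (subst measurable_cong_sets[OF sets_PiM_normal_measure refl]) auto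
  have jm: "(\<lambda>z. ennreal ((g j (path (fst z) (snd z)) - fst z j)\<^sup>2)) \<in> borel_measurable (?P \<Otimes>\<^sub>M M)" if "j \<in> J" for j
    using measurable_compose[OF pm gm[of j]] measurable_compose[OF measurable_fst cm[OF that]]
    by measurable
  have jm1: "(\<lambda>\<omega>. ennreal ((g j (path \<theta> \<omega>) - \<theta> j)\<^sup>2)) \<in> borel_measurable M" if "j \<in> J" "\<theta> \<in> space ?P" for j \<theta>
    using measurable_compose[OF measurable_Pair1'[OF that(2)] jm[OF that(1)]] by simp
  have jm2: "(\<lambda>\<theta>. \<integral>\<^sup>+\<omega>. ennreal ((g j (path \<theta> \<omega>) - \<theta> j)\<^sup>2) \<partial>M) \<in> borel_measurable ?P" if "j \<in> J" for j
    using jm[OF that] by (intro borel_measurable_nn_integral) (simp add: split_beta')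
  have Tm: "T \<in> borel_measurable ?P"
    unfolding T_def[abs_def] using cm by (intro borel_measurable_sum borel_measurable_times borel_measurable_power) auto
  have pw: "(\<Sum>j\<in>J. \<integral>\<^sup>+\<omega>. ennreal ((g j (path \<theta> \<omega>) - \<theta> j)\<^sup>2) \<partial>M)
     \<le> ?R + ennreal (2 * (real (card J) + 1)) * ennreal (if r < T \<theta> then T \<theta> else 0)"
    if \<theta>: "\<theta> \<in> space ?P" for \<theta>
  proof (cases "r < T \<theta>")
    case False
    have abs_le: "\<bar>\<theta> j\<bar> \<le> sqrt r" if "j \<in> J" for j
      using sq_le_T[OF that, of \<theta>] False by (intro real_le_rsqrt) auto
    have clip: "(g j y - \<theta> j)\<^sup>2 \<le> (fourier_coeff (E y) j - \<theta> j)\<^sup>2" if "j \<in> J" for j y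
      using abs_le[OF that] r(1) by (intro abs_le_square_iff[THEN iffD1]) (auto simp: g_def max_def min_def abs_if split: if_splits)
    have "trig_poly J \<theta> \<in> sobolev_ball k r"
      using False by (intro trig_poly_in_sobolev_ball J) (auto simp: T_def a_def)
    then have R: "risk (real n) (noise_law M w L \<tau> Y (real n) s 0 0) E (trig_poly J \<theta>) \<le> ?R"
      using Q unfolding robust_risk_def by (intro SUP_upper2[where i = "trig_poly J \<theta>"] SUP_upper)
    have em: "E y \<in> borel_measurable (restrict_space borel {0..1})" if "y \<in> space (skorokhod_space (real n))" for y
      using measurable_compose[OF measurable_Pair1'[OF that], of "\<lambda>(y, s). E y s"] E by (simp add: estimators_def)
    have pth: "path \<theta> \<omega> \<in> space (skorokhod_space (real n))" if "\<omega> \<in> space M" for \<omega>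
      using measurable_space[OF pm, of "(\<theta>, \<omega>)"] \<theta> that by (simp add: space_pair_measure)
    have "(\<Sum>j\<in>J. \<integral>\<^sup>+\<omega>. ennreal ((g j (path \<theta> \<omega>) - \<theta> j)\<^sup>2) \<partial>M) = (\<integral>\<^sup>+\<omega>. (\<Sum>j\<in>J. ennreal ((g j (path \<theta> \<omega>) - \<theta> j)\<^sup>2)) \<partial>M)"
      by (rule nn_integral_sum[symmetric]) (rule jm1[OF _ \<theta>])
    also have "\<dots> \<le> (\<integral>\<^sup>+\<omega>. (\<integral>\<^sup>+u\<in>{0..1}. ennreal ((E (path \<theta> \<omega>) u - trig_poly J \<theta> u)\<^sup>2) \<partial>lborel) \<partial>M)"
    proof (rule nn_integral_mono)
      fix \<omega> assume "\<omega> \<in> space M"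
      have "(\<Sum>j\<in>J. ennreal ((g j (path \<theta> \<omega>) - \<theta> j)\<^sup>2)) \<le> (\<Sum>j\<in>J. ennreal ((fourier_coeff (E (path \<theta> \<omega>)) j - \<theta> j)\<^sup>2))"
        by (intro sum_mono ennreal_leI clip)
      also have "\<dots> \<le> (\<integral>\<^sup>+u\<in>{0..1}. ennreal ((E (path \<theta> \<omega>) u - trig_poly J \<theta> u)\<^sup>2) \<partial>lborel)"
        by (intro bessel_inequality J em pth \<open>\<omega> \<in> space M\<close>)
      finally show "(\<Sum>j\<in>J. ennreal ((g j (path \<theta> \<omega>) - \<theta> j)\<^sup>2)) \<le> (\<integral>\<^sup>+u\<in>{0..1}. ennreal ((E (path \<theta> \<omega>) u - trig_poly J \<theta> u)\<^sup>2) \<partial>lborel)" .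
    qed
    also have "\<dots> \<le> ?R"
      using R unfolding risk_trig_poly[OF w J(1) E] path_def .
    finally show ?thesis using False by simp
  next
    case True
    have "(g j y - \<theta> j)\<^sup>2 \<le> 2 * (r + (\<theta> j)\<^sup>2)" for j y
    proof -
      have "(g j y)\<^sup>2 \<le> (sqrt r)\<^sup>2" using gb[of j y] by (intro power2_le_iff_abs_le[THEN iffD2]) (auto simp: r(1) less_imp_le)
      then have "(g j y)\<^sup>2 \<le> r" using r(1) by simp
      moreover have "0 \<le> (g j y + \<theta> j)\<^sup>2" by simp
      ultimately show ?thesis by (simp add: power2_eq_square algebra_simps)
    qed
    then have "(\<integral>\<^sup>+\<omega>. ennreal ((g j (path \<theta> \<omega>) - \<theta> j)\<^sup>2) \<partial>M) \<le> (\<integral>\<^sup>+\<omega>. ennreal (2 * (r + (\<theta> j)\<^sup>2)) \<partial>M)" for j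
      by (intro nn_integral_mono ennreal_leI)
    then have "(\<integral>\<^sup>+\<omega>. ennreal ((g j (path \<theta> \<omega>) - \<theta> j)\<^sup>2) \<partial>M) \<le> ennreal (2 * (r + (\<theta> j)\<^sup>2))" for j
      by (simp add: emeasure_space_1)
    then have "(\<Sum>j\<in>J. \<integral>\<^sup>+\<omega>. ennreal ((g j (path \<theta> \<omega>) - \<theta> j)\<^sup>2) \<partial>M) \<le> (\<Sum>j\<in>J. ennreal (2 * (r + (\<theta> j)\<^sup>2)))"
      by (intro sum_mono)
    also have "\<dots> = ennreal (\<Sum>j\<in>J. 2 * (r + (\<theta> j)\<^sup>2))"
      using r(1) by (intro sum_ennreal) auto
    \<comment> \<open>Off the ball \<open>r < T \<theta>\<close>, so each of the
      \<open>card J\<close> summands \<open>r\<close> is absorbed into one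
      \<open>T \<theta>\<close>; the squared coefficients together cost one more.\<close>
    also have "\<dots> \<le> ennreal (2 * (real (card J) + 1) * T \<theta>)"
    proof (rule ennreal_leI)
      have "(\<Sum>j\<in>J. (\<theta> j)\<^sup>2) \<le> T \<theta>"
        unfolding T_def using a1 by (intro sum_mono) (simp add: mult_le_cancel_right1)
      moreover have "real (card J) * r \<le> real (card J) * T \<theta>" using True by (intro mult_left_mono) auto
      moreover have "(\<Sum>j\<in>J. 2 * (r + (\<theta> j)\<^sup>2)) = 2 * (real (card J) * r + (\<Sum>j\<in>J. (\<theta> j)\<^sup>2))"
        by (simp add: sum_distrib_left[symmetric] sum.distrib)
      ultimately show "(\<Sum>j\<in>J. 2 * (r + (\<theta> j)\<^sup>2)) \<le> 2 * (real (card J) + 1) * T \<theta>"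
        by (simp add: algebra_simps)
    qed
    also have "\<dots> = ennreal (2 * (real (card J) + 1)) * ennreal (if r < T \<theta> then T \<theta> else 0)"
      using True r(1) by (simp add: ennreal_mult)
    finally show ?thesis by (rule order.trans) simp
  qed
  have tail: "(\<integral>\<^sup>+\<theta>. ennreal (if r < T \<theta> then T \<theta> else 0) \<partial>?P) \<le> ennreal ?tail"
    unfolding T_def a_def
    by (rule gaussian_product_tail[where a = "\<lambda>j. sobolev_weight k (fst j)", OF J(1) \<tau>' a0[unfolded a_def] r small])
  have "ennreal (\<Sum>j\<in>J. 1 / (1 / (\<tau>' j)\<^sup>2 + real n / s\<^sup>2)) = (\<Sum>j\<in>J. ennreal (1 / (1 / (\<tau>' j)\<^sup>2 + real n / s\<^sup>2)))"
    by (rule sum_ennreal[symmetric]) simp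
  also have "\<dots> \<le> (\<Sum>j\<in>J. \<integral>\<^sup>+\<theta>. (\<integral>\<^sup>+\<omega>. ennreal ((g j (path \<theta> \<omega>) - \<theta> j)\<^sup>2) \<partial>M) \<partial>?P)"
    unfolding path_def by (intro sum_mono coordinate_bayes_risk[OF M w n s \<tau>' J(1) _ J(2) gm gb])
  also have "\<dots> = (\<integral>\<^sup>+\<theta>. (\<Sum>j\<in>J. \<integral>\<^sup>+\<omega>. ennreal ((g j (path \<theta> \<omega>) - \<theta> j)\<^sup>2) \<partial>M) \<partial>?P)"
    by (rule nn_integral_sum[symmetric]) (rule jm2)
  also have "\<dots> \<le> (\<integral>\<^sup>+\<theta>. ?R + ennreal (2 * (real (card J) + 1)) * ennreal (if r < T \<theta> then T \<theta> else 0) \<partial>?P)"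
    by (intro nn_integral_mono pw)
  also have "\<dots> = ?R + ennreal (2 * (real (card J) + 1)) * (\<integral>\<^sup>+\<theta>. ennreal (if r < T \<theta> then T \<theta> else 0) \<partial>?P)"
    using Tm by (simp add: nn_integral_add nn_integral_cmult P.emeasure_space_1)
  also have "\<dots> \<le> ?R + ennreal (2 * (real (card J) + 1)) * ennreal ?tail"
    by (intro add_left_mono mult_left_mono tail) simp
  also have "\<dots> = ?R + ennreal (2 * (real (card J) + 1) * ?tail)"
    using r(1) by (simp add: ennreal_mult)
  finally show ?thesis .
qed

section \<open>Pinsker's prior\<close>

text \<open>For prior variance \<open>((N / l) ^ k - 1) / v\<close> the bound for one coefficient is
  \<open>(1 - (l / N) ^ k) / v\<close>. This is \<open>v\<close> times the sum of these bounds, with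
  one coefficient per frequency.\<close>

definition pinsker_variance_sum :: "nat \<Rightarrow> nat \<Rightarrow> real" where
  "pinsker_variance_sum k N = (\<Sum>l\<in>{1..<N}. 1 - (real l / real N) ^ k)"

text \<open>For the same prior, \<open>v\<close> times its expected squared Sobolev norm, again with
  one coefficient per frequency; cosine and sine together double both sums.\<close>

definition pinsker_weight_sum :: "nat \<Rightarrow> nat \<Rightarrow> real" where
  "pinsker_weight_sum k N = (\<Sum>l\<in>{1..<N}. sobolev_weight k l * ((real N / real l) ^ k - 1))"

lemma sobolev_weight_le:
  assumes "1 \<le> l"
  shows "sobolev_weight k l \<le> (real k + 1) * (2 * pi) ^ (2 * k) * real l ^ (2 * k)"
proof -
  have "1 * 1 \<le> (2 * pi) * real l" using assms pi_gt3 by (intro mult_mono) auto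
  then have "(2 * pi * real l) ^ (2 * i) \<le> (2 * pi * real l) ^ (2 * k)" if "i \<le> k" for i
    using that by (intro power_increasing) auto
  then have "sobolev_weight k l \<le> (\<Sum>i=0..k. (2 * pi * real l) ^ (2 * k))"
    unfolding sobolev_weight_def by (intro sum_mono) auto
  then show ?thesis by (simp add: power_mult_distrib add.commute)
qed

text \<open>A single term is of order at most \<open>N ^ (2 * k)\<close>, whereas the whole sum has
  order \<open>N ^ (2 * k + 1)\<close>. Each coefficient thus carries only a share of order
  \<open>1 / N\<close> of the expected norm, which admits a Chernoff parameter \<kappa> of order
  \<open>N\<close>.\<close>

lemma pinsker_weight_term_le:
  assumes "l \<in> {1..<N}"
  shows "0 \<le> sobolev_weight k l * ((real N / real l) ^ k - 1)"
    and "sobolev_weight k l * ((real N / real l) ^ k - 1) \<le> (real k + 1) * (2 * pi) ^ (2 * k) * real N ^ (2 * k)"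
proof -
  have ge: "1 \<le> (real N / real l) ^ k" using assms by (intro one_le_power) auto
  then show "0 \<le> sobolev_weight k l * ((real N / real l) ^ k - 1)"
    using sobolev_weight_ge_1[of k l] by (intro mult_nonneg_nonneg) auto
  have "sobolev_weight k l * ((real N / real l) ^ k - 1)
      \<le> ((real k + 1) * (2 * pi) ^ (2 * k) * real l ^ (2 * k)) * (real N / real l) ^ k"
    using assms ge by (intro mult_mono sobolev_weight_le) auto
  also have "\<dots> = ((real k + 1) * (2 * pi) ^ (2 * k)) * (real l ^ k * real N ^ k)"
    using assms by (simp add: power_divide power_even_eq power2_eq_square)
  also have "\<dots> \<le> ((real k + 1) * (2 * pi) ^ (2 * k)) * (real N ^ k * real N ^ k)"
    using assms by (intro mult_left_mono mult_right_mono power_mono) auto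
  also have "\<dots> = (real k + 1) * (2 * pi) ^ (2 * k) * real N ^ (2 * k)"
    by (simp add: power_even_eq power2_eq_square)
  finally show "sobolev_weight k l * ((real N / real l) ^ k - 1) \<le> (real k + 1) * (2 * pi) ^ (2 * k) * real N ^ (2 * k)" .
qed

text \<open>\<open>minimax_lower_bound_finite_sample\<close> with Pinsker's variances. Hypothesis
  \<open>W\<close> keeps the expected squared norm a fixed fraction below \<open>r\<close>,
  \<open>NB\<close> bounds the share of each coefficient, and \<open>Nr\<close> makes the Chernoff
  parameter large enough.\<close>

lemma pinsker_finite_sample:
  fixes M :: "'a measure"
  assumes M: "prob_space M" and w: "brownian_motion M w"
    and n: "1 \<le> n" and \<sigma>: "0 < \<sigma>" and k: "1 \<le> k" and N: "1 \<le> N"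
    and E: "E \<in> estimators (real n)"
    and Q: "noise_law M w L \<tau> Y (real n) (sqrt \<sigma>) 0 0 \<in> QQ"
    and v: "v = real n / \<sigma>"
    and r: "0 < r" and \<delta>: "0 < \<delta>" "\<delta> \<le> 1" and B: "0 < B"
    and W: "2 * pinsker_weight_sum k N / v \<le> (1 - \<delta> / 2) * r"
    and NB: "(real k + 1) * (2 * pi) ^ (2 * k) * real N ^ (2 * k + 1) / v \<le> B"
    and Nr: "1 / r \<le> \<delta> / (16 * B) * real N"
  shows "ennreal (2 * pinsker_variance_sum k N / v) \<le>
    (SUP S\<in>sobolev_ball k r. robust_risk (real n) QQ E S) +
    ennreal (2 * (2 * real N + 1) * (r * exp (- (\<delta> / (16 * B) * r * \<delta> / 4) * real N)))"
proof -
  \<comment> \<open>Chosen so that \<open>c * B = \<delta> / 16\<close>: then every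
    \<open>b j\<close> is at most \<open>\<delta> / 16\<close>, and the second-order term
    \<open>4 * (b j)\<^sup>2\<close> at most \<open>\<delta> / 4 * b j\<close>.\<close>
  define c where "c = \<delta> / (16 * B)"
  define \<kappa> where "\<kappa> = c * real N"
  have c: "0 < c" "c * B = \<delta> / 16" using \<delta> B by (auto simp: c_def)
  have \<kappa>: "0 < \<kappa>" "1 / r \<le> \<kappa>"
    using c(1) N Nr by (simp add: \<kappa>_def, simp only: \<kappa>_def c_def)
  have v0: "0 < v" using n \<sigma> by (simp add: v)
  define J where "J = {1..<N} \<times> (UNIV :: bool set)"
  have J: "finite J" "\<And>j. j \<in> J \<Longrightarrow> 1 \<le> fst j" by (auto simp: J_def)
  define q where "q l = (real N / real l) ^ k" for l
  have q: "1 < q l" if "l \<in> {1..<N}" for l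
    unfolding q_def using that k by (intro one_less_power) auto
  \<comment> \<open>the least favourable variances; the value \<open>1\<close> outside \<open>J\<close> only keeps all of them positive\<close>
  define \<tau>' :: "nat \<times> bool \<Rightarrow> real" where "\<tau>' j = (if j \<in> J then sqrt ((q (fst j) - 1) / v) else 1)" for j
  have \<tau>'0: "0 < \<tau>' j" for j using q v0 by (auto simp: \<tau>'_def J_def)
  have \<tau>'2: "(\<tau>' j)\<^sup>2 = (q (fst j) - 1) / v" if "j \<in> J" for j
    using that q[of "fst j"] v0 by (auto simp: \<tau>'_def J_def)
  have sumJ: "(\<Sum>j\<in>J. f (fst j)) = 2 * (\<Sum>l\<in>{1..<N}. f l)" for f :: "nat \<Rightarrow> real"
  proof -
    have "(\<Sum>j\<in>J. f (fst j)) = (\<Sum>l\<in>{1..<N}. \<Sum>b\<in>(UNIV :: bool set). f l)"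
      unfolding J_def by (subst sum.cartesian_product) (simp add: split_beta')
    then show ?thesis by (simp add: sum_distrib_left)
  qed
  have card: "real (card J) \<le> 2 * real N"
    by (simp add: J_def card_cartesian_product)
  define b where "b j = \<kappa> * sobolev_weight k (fst j) * (\<tau>' j)\<^sup>2" for j
  have b_eq: "b j = \<kappa> * (sobolev_weight k (fst j) * (q (fst j) - 1)) / v" if "j \<in> J" for j
    using \<tau>'2[OF that] by (simp add: b_def)
  have b0: "0 \<le> b j" for j
    unfolding b_def using \<kappa> sobolev_weight_ge_1[of k "fst j"] by (intro mult_nonneg_nonneg) auto
  have b_le: "b j \<le> \<delta> / 16" if "j \<in> J" for j
  proof -
    have "b j \<le> \<kappa> * ((real k + 1) * (2 * pi) ^ (2 * k) * real N ^ (2 * k)) / v"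
      unfolding b_eq[OF that] q_def using that \<kappa> v0
      by (intro divide_right_mono mult_left_mono pinsker_weight_term_le) (auto simp: J_def)
    also have "\<dots> = c * ((real k + 1) * (2 * pi) ^ (2 * k) * real N ^ (2 * k + 1) / v)"
      by (simp add: \<kappa>_def)
    also have "\<dots> \<le> c * B" using c by (intro mult_left_mono NB) auto
    finally show ?thesis using c by simp
  qed
  have b_sum: "(\<Sum>j\<in>J. b j) \<le> \<kappa> * ((1 - \<delta> / 2) * r)"
  proof -
    have "(\<Sum>j\<in>J. b j) = \<kappa> * (2 * pinsker_weight_sum k N / v)"
    proof -
      have "(\<Sum>j\<in>J. b j) = (\<Sum>j\<in>J. \<kappa> / v * (sobolev_weight k (fst j) * (q (fst j) - 1)))"
        by (intro sum.cong refl) (simp add: b_eq)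
      also have "\<dots> = \<kappa> / v * (2 * (\<Sum>l\<in>{1..<N}. sobolev_weight k l * (q l - 1)))"
        using sumJ[of "\<lambda>l. sobolev_weight k l * (q l - 1)"] by (simp only: sum_distrib_left[symmetric])
      finally show ?thesis by (simp add: pinsker_weight_sum_def q_def)
    qed
    also have "\<dots> \<le> \<kappa> * ((1 - \<delta> / 2) * r)" using \<kappa> by (intro mult_left_mono W) auto
    finally show ?thesis .
  qed
  have "(\<Sum>j\<in>J. b j + 4 * (b j)\<^sup>2) \<le> (\<Sum>j\<in>J. (1 + \<delta> / 4) * b j)"
  proof (rule sum_mono)
    fix j assume "j \<in> J"
    then have "b j * b j \<le> \<delta> / 16 * b j" by (intro mult_right_mono b_le b0)
    then show "b j + 4 * (b j)\<^sup>2 \<le> (1 + \<delta> / 4) * b j" by (simp add: power2_eq_square algebra_simps)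
  qed
  also have "\<dots> = (1 + \<delta> / 4) * (\<Sum>j\<in>J. b j)" by (simp add: sum_distrib_left)
  also have "\<dots> \<le> (1 + \<delta> / 4) * (\<kappa> * ((1 - \<delta> / 2) * r))" using \<delta> by (intro mult_left_mono b_sum) auto
  also have "\<dots> = ((1 + \<delta> / 4) * (1 - \<delta> / 2)) * (\<kappa> * r)" by (simp add: mult_ac)
  \<comment> \<open>The product equals \<open>1 - \<delta> / 4 - \<delta>\<^sup>2 / 8\<close>. The
    margin left below \<open>\<kappa> * r\<close> is a quarter of
    \<open>\<delta> * \<kappa> * r\<close>, hence linear in \<open>N\<close>.\<close>
  also have "\<dots> \<le> (1 - \<delta> / 4) * (\<kappa> * r)"
    using \<kappa> r \<delta> by (intro mult_right_mono) (auto simp: algebra_simps)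
  finally have ex: "- \<kappa> * r + (\<Sum>j\<in>J. b j + 4 * (b j)\<^sup>2) \<le> - (c * r * \<delta> / 4) * real N"
    by (simp add: \<kappa>_def algebra_simps)
  have lhs: "(\<Sum>j\<in>J. 1 / (1 / (\<tau>' j)\<^sup>2 + real n / (sqrt \<sigma>)\<^sup>2)) = 2 * pinsker_variance_sum k N / v"
  proof -
    have "(\<Sum>j\<in>J. 1 / (1 / (\<tau>' j)\<^sup>2 + real n / (sqrt \<sigma>)\<^sup>2)) = (\<Sum>j\<in>J. (1 - (real (fst j) / real N) ^ k) / v)"
    proof (rule sum.cong[OF refl])
      fix j assume j: "j \<in> J"
      then have q1: "1 < q (fst j)" and l: "1 \<le> fst j" using q by (auto simp: J_def)
      have "1 / (1 / (\<tau>' j)\<^sup>2 + real n / (sqrt \<sigma>)\<^sup>2) = 1 / (v / (q (fst j) - 1) + v)"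
        using \<sigma> by (simp add: \<tau>'2[OF j] v)
      also have "v / (q (fst j) - 1) + v = v * q (fst j) / (q (fst j) - 1)"
        using q1 by (simp add: field_simps)
      also have "1 / (v * q (fst j) / (q (fst j) - 1)) = (1 - 1 / q (fst j)) / v"
        using q1 v0 by (simp add: field_simps)
      also have "1 / q (fst j) = (real (fst j) / real N) ^ k"
        by (simp add: q_def power_divide)
      finally show "1 / (1 / (\<tau>' j)\<^sup>2 + real n / (sqrt \<sigma>)\<^sup>2) = (1 - (real (fst j) / real N) ^ k) / v" .
    qed
    also have "\<dots> = 2 * (\<Sum>l\<in>{1..<N}. (1 - (real l / real N) ^ k) / v)"
      by (rule sumJ)
    finally show ?thesis
      by (simp only: pinsker_variance_sum_def sum_divide_distrib sum_distrib_left times_divide_eq_right)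
  qed
  have "ennreal (2 * pinsker_variance_sum k N / v) \<le> (SUP S\<in>sobolev_ball k r. robust_risk (real n) QQ E S)
     + ennreal (2 * (real (card J) + 1) * (r * exp (- \<kappa> * r + (\<Sum>j\<in>J. b j + 4 * (b j)\<^sup>2))))"
    unfolding b_def lhs[symmetric]
  proof (rule minimax_lower_bound_finite_sample[OF M w n _ \<tau>'0 J E Q r \<kappa>(2)])
    show "0 < sqrt \<sigma>" using \<sigma> by simp
    show "\<kappa> * sobolev_weight k (fst j) * (\<tau>' j)\<^sup>2 \<le> 1 / 4" if "j \<in> J" for j
      using b_le[OF that] \<delta> unfolding b_def by linarith
  qed
  also have "\<dots> \<le> (SUP S\<in>sobolev_ball k r. robust_risk (real n) QQ E S) +
    ennreal (2 * (2 * real N + 1) * (r * exp (- (c * r * \<delta> / 4) * real N)))"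
    using r card ex by (intro add_left_mono ennreal_leI mult_mono) auto
  finally show ?thesis unfolding c_def .
qed

section \<open>Asymptotics of the variance and weight sums\<close>

text \<open>Telescoping: \<open>(m + 1) ^ (p + 1) - m ^ (p + 1)\<close> factors into
  \<open>p + 1\<close> terms, each between \<open>m ^ p\<close> and
  \<open>(m + 1) ^ p\<close>.\<close>

lemma power_sum_bounds:
  "real N ^ Suc p / real (Suc p) - real N ^ p \<le> (\<Sum>l\<in>{1..<N}. real l ^ p)"
  "(\<Sum>l\<in>{1..<N}. real l ^ p) \<le> real N ^ Suc p / real (Suc p)"
proof -
  have step: "real (Suc p) * real m ^ p \<le> real (Suc m) ^ Suc p - real m ^ Suc p"
     "real (Suc m) ^ Suc p - real m ^ Suc p \<le> real (Suc p) * real (Suc m) ^ p" for m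
  proof -
    have eq: "real (Suc m) ^ Suc p - real m ^ Suc p = (\<Sum>i<Suc p. real (Suc m) ^ i * real m ^ (p - i))"
      using diff_power_eq_sum[of "real (Suc m)" p "real m"] by simp
    have "(\<Sum>i<Suc p. real m ^ p) \<le> (\<Sum>i<Suc p. real (Suc m) ^ i * real m ^ (p - i))"
    proof (rule sum_mono)
      fix i assume "i \<in> {..<Suc p}"
      then have "real m ^ p = real m ^ i * real m ^ (p - i)" by (simp add: power_add[symmetric])
      also have "\<dots> \<le> real (Suc m) ^ i * real m ^ (p - i)" by (intro mult_right_mono power_mono) auto
      finally show "real m ^ p \<le> real (Suc m) ^ i * real m ^ (p - i)" .
    qed
    then show "real (Suc p) * real m ^ p \<le> real (Suc m) ^ Suc p - real m ^ Suc p" unfolding eq by simp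
    have "(\<Sum>i<Suc p. real (Suc m) ^ i * real m ^ (p - i)) \<le> (\<Sum>i<Suc p. real (Suc m) ^ p)"
    proof (rule sum_mono)
      fix i assume "i \<in> {..<Suc p}"
      then have "real (Suc m) ^ p = real (Suc m) ^ i * real (Suc m) ^ (p - i)" by (simp add: power_add[symmetric] del: of_nat_Suc)
      moreover have "real (Suc m) ^ i * real m ^ (p - i) \<le> real (Suc m) ^ i * real (Suc m) ^ (p - i)"
        by (intro mult_left_mono power_mono) auto
      ultimately show "real (Suc m) ^ i * real m ^ (p - i) \<le> real (Suc m) ^ p" by simp
    qed
    then show "real (Suc m) ^ Suc p - real m ^ Suc p \<le> real (Suc p) * real (Suc m) ^ p" unfolding eq by simp
  qed
  have "real N ^ Suc p \<le> real (Suc p) * ((\<Sum>l\<in>{1..<N}. real l ^ p) + real N ^ p) \<and>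
    real (Suc p) * (\<Sum>l\<in>{1..<N}. real l ^ p) \<le> real N ^ Suc p"
  proof (induction N)
    case (Suc N)
    show ?case
    \<comment> \<open>The sum starts at 1, so the step from 0 to 1 adds no term.\<close>
    proof (cases "N = 0")
      case True
      then show ?thesis by simp
    next
      case False
      then have s: "(\<Sum>l\<in>{1..<Suc N}. real l ^ p) = (\<Sum>l\<in>{1..<N}. real l ^ p) + real N ^ p"
        by (subst sum.atLeastLessThan_Suc) auto
      show ?thesis using Suc.IH step[of N] unfolding s by (simp only: distrib_left) linarith
    qed
  qed simp
  then show "real N ^ Suc p / real (Suc p) - real N ^ p \<le> (\<Sum>l\<in>{1..<N}. real l ^ p)"
    "(\<Sum>l\<in>{1..<N}. real l ^ p) \<le> real N ^ Suc p / real (Suc p)"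
    by (auto simp: divide_simps algebra_simps simp del: of_nat_Suc power_Suc)
qed

lemma power_sum_asymp:
  "(\<lambda>N. (\<Sum>l\<in>{1..<N}. real l ^ p) / real N ^ Suc p) \<longlonglongrightarrow> 1 / real (Suc p)"
proof (rule tendsto_sandwich)
  show "\<forall>\<^sub>F N in sequentially. 1 / real (Suc p) - 1 / real N \<le> (\<Sum>l\<in>{1..<N}. real l ^ p) / real N ^ Suc p"
  proof (rule eventually_sequentiallyI[of 1])
    fix N :: nat assume "1 \<le> N"
    then have "(real N ^ Suc p / real (Suc p) - real N ^ p) / real N ^ Suc p = 1 / real (Suc p) - 1 / real N"
      by (simp add: diff_divide_distrib)
    moreover have "(real N ^ Suc p / real (Suc p) - real N ^ p) / real N ^ Suc p \<le> (\<Sum>l\<in>{1..<N}. real l ^ p) / real N ^ Suc p"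
      by (intro divide_right_mono power_sum_bounds) simp
    ultimately show "1 / real (Suc p) - 1 / real N \<le> (\<Sum>l\<in>{1..<N}. real l ^ p) / real N ^ Suc p" by simp
  qed
  show "\<forall>\<^sub>F N in sequentially. (\<Sum>l\<in>{1..<N}. real l ^ p) / real N ^ Suc p \<le> 1 / real (Suc p)"
  proof (rule eventually_sequentiallyI[of 1])
    fix N :: nat assume N: "1 \<le> N"
    have "(\<Sum>l\<in>{1..<N}. real l ^ p) / real N ^ Suc p \<le> (real N ^ Suc p / real (Suc p)) / real N ^ Suc p"
      by (intro divide_right_mono power_sum_bounds) simp
    also have "\<dots> = 1 / real (Suc p)" using N by simp
    finally show "(\<Sum>l\<in>{1..<N}. real l ^ p) / real N ^ Suc p \<le> 1 / real (Suc p)" .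
  qed
  have "(\<lambda>N. 1 / real (Suc p) - 1 / real N) \<longlonglongrightarrow> 1 / real (Suc p) - 0"
    by (intro tendsto_diff tendsto_const lim_1_over_n)
  then show "(\<lambda>N. 1 / real (Suc p) - 1 / real N) \<longlonglongrightarrow> 1 / real (Suc p)" by simp
qed simp

text \<open>The limit is the integral of \<open>1 - x ^ k\<close> over the unit interval.\<close>

lemma pinsker_variance_sum_asymp:
  "(\<lambda>N. pinsker_variance_sum k N / real N) \<longlonglongrightarrow> real k / (real k + 1)"
proof -
  have "(\<lambda>N. (1 - 1 / real N) - (\<Sum>l\<in>{1..<N}. real l ^ k) / real N ^ Suc k) \<longlonglongrightarrow> (1 - 0) - 1 / real (Suc k)"
    by (intro tendsto_diff tendsto_const lim_1_over_n power_sum_asymp)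
  moreover have "(1 - 0) - 1 / real (Suc k) = real k / (real k + 1)" by (simp add: field_simps)
  moreover have "\<forall>\<^sub>F N in sequentially. (1 - 1 / real N) - (\<Sum>l\<in>{1..<N}. real l ^ k) / real N ^ Suc k = pinsker_variance_sum k N / real N"
  proof (rule eventually_sequentiallyI[of 1])
    fix N :: nat assume N: "1 \<le> N"
    have "pinsker_variance_sum k N = (real N - 1) - (\<Sum>l\<in>{1..<N}. real l ^ k) / real N ^ k"
      using N by (simp add: pinsker_variance_sum_def sum_subtractf power_divide sum_divide_distrib of_nat_diff)
    then show "(1 - 1 / real N) - (\<Sum>l\<in>{1..<N}. real l ^ k) / real N ^ Suc k = pinsker_variance_sum k N / real N"
      using N by (simp add: diff_divide_distrib mult.commute)
  qed
  ultimately show ?thesis using Lim_transform_eventually by fastforce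
qed

text \<open>Only the derivative of order \<open>k\<close> matters: orders \<open>i < k\<close>
  contribute \<open>O(N ^ (2 * k))\<close>. For \<open>i = k\<close> the normalised sum tends to the
  integral of \<open>x ^ k - x ^ (2 * k)\<close> over the unit interval.\<close>

lemma pinsker_weight_sum_asymp:
  assumes k: "1 \<le> k"
  shows "(\<lambda>N. pinsker_weight_sum k N / real N ^ (2 * k + 1)) \<longlonglongrightarrow>
    (2 * pi) ^ (2 * k) * (real k / ((real k + 1) * (2 * real k + 1)))"
proof -
  define U where "U i N = (\<Sum>l\<in>{1..<N}. real l ^ (2 * i) * ((real N / real l) ^ k - 1))" for i N
  have W: "pinsker_weight_sum k N = (\<Sum>i=0..k. (2 * pi) ^ (2 * i) * U i N)" for N
    unfolding pinsker_weight_sum_def sobolev_weight_def U_def sum_distrib_right sum_distrib_left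
    by (subst sum.swap) (simp add: power_mult_distrib mult_ac)
  have low: "(\<lambda>N. U i N / real N ^ (2 * k + 1)) \<longlonglongrightarrow> 0" if "i < k" for i
  proof (rule tendsto_sandwich[OF _ _ tendsto_const lim_1_over_n])
    have bounds: "0 \<le> real l ^ (2 * i) * ((real N / real l) ^ k - 1)"
      "real l ^ (2 * i) * ((real N / real l) ^ k - 1) \<le> real N ^ (2 * k - 1)" if l: "l \<in> {1..<N}" for l N
    proof -
      have ge: "1 \<le> (real N / real l) ^ k" using l by (intro one_le_power) auto
      then show "0 \<le> real l ^ (2 * i) * ((real N / real l) ^ k - 1)" by (intro mult_nonneg_nonneg) auto
      have "real l ^ (2 * i) \<le> real l ^ (2 * (k - 1))"
        using l \<open>i < k\<close> by (intro power_increasing) auto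
      also have "\<dots> = real l ^ (k - 1) * real l ^ (k - 1)" by (simp add: power_even_eq power2_eq_square)
      also have "\<dots> \<le> real N ^ (k - 1) * real l ^ k"
        using l by (intro mult_mono power_mono power_increasing) auto
      finally have "real l ^ (2 * i) \<le> real N ^ (k - 1) * real l ^ k" .
      then have "real l ^ (2 * i) * ((real N / real l) ^ k - 1) \<le> (real N ^ (k - 1) * real l ^ k) * (real N / real l) ^ k"
        using ge by (intro mult_mono) auto
      also have "\<dots> = real N ^ (k - 1) * real N ^ k" using l by (simp add: power_divide)
      also have "\<dots> = real N ^ (2 * k - 1)" using k by (simp add: power_add[symmetric] mult_2)
      finally show "real l ^ (2 * i) * ((real N / real l) ^ k - 1) \<le> real N ^ (2 * k - 1)" .
    qed
    show "\<forall>\<^sub>F N in sequentially. 0 \<le> U i N / real N ^ (2 * k + 1)"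
      unfolding U_def by (intro always_eventually allI divide_nonneg_nonneg sum_nonneg bounds) auto
    show "\<forall>\<^sub>F N in sequentially. U i N / real N ^ (2 * k + 1) \<le> 1 / real N"
    proof (rule eventually_sequentiallyI[of 1])
      fix N :: nat assume N: "1 \<le> N"
      have "U i N \<le> (\<Sum>l\<in>{1..<N}. real N ^ (2 * k - 1))" unfolding U_def by (intro sum_mono bounds)
      also have "\<dots> \<le> real N * real N ^ (2 * k - 1)" by (simp add: mult_right_mono)
      also have "\<dots> = real N ^ (2 * k)" using k by (simp add: power_Suc[symmetric])
      finally have "U i N / real N ^ (2 * k + 1) \<le> real N ^ (2 * k) / real N ^ (2 * k + 1)"
        by (intro divide_right_mono) auto
      also have "\<dots> = 1 / real N" using N by simp
      finally show "U i N / real N ^ (2 * k + 1) \<le> 1 / real N" .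
    qed
  qed
  have top: "(\<lambda>N. U k N / real N ^ (2 * k + 1)) \<longlonglongrightarrow> 1 / real (Suc k) - 1 / real (Suc (2 * k))"
  proof (rule Lim_transform_eventually[OF tendsto_diff[OF power_sum_asymp[of k] power_sum_asymp[of "2 * k"]]])
    show "\<forall>\<^sub>F N in sequentially. (\<Sum>l\<in>{1..<N}. real l ^ k) / real N ^ Suc k - (\<Sum>l\<in>{1..<N}. real l ^ (2 * k)) / real N ^ Suc (2 * k)
       = U k N / real N ^ (2 * k + 1)"
    proof (rule eventually_sequentiallyI[of 1])
      fix N :: nat assume N: "1 \<le> N"
      have "U k N = (\<Sum>l\<in>{1..<N}. real N ^ k * real l ^ k - real l ^ (2 * k))"
        unfolding U_def by (intro sum.cong refl) (auto simp: power_divide power_even_eq power2_eq_square right_diff_distrib)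
      also have "\<dots> = real N ^ k * (\<Sum>l\<in>{1..<N}. real l ^ k) - (\<Sum>l\<in>{1..<N}. real l ^ (2 * k))"
        by (simp add: sum_subtractf sum_distrib_left)
      finally have U: "U k N = real N ^ k * (\<Sum>l\<in>{1..<N}. real l ^ k) - (\<Sum>l\<in>{1..<N}. real l ^ (2 * k))" .
      have e: "real N ^ (2 * k + 1) = real N ^ k * real N ^ Suc k" by (simp add: power_add[symmetric] mult_2)
      have "real N ^ k * S / real N ^ (2 * k + 1) = S / real N ^ Suc k" for S :: real
        unfolding e using N by simp
      then show "(\<Sum>l\<in>{1..<N}. real l ^ k) / real N ^ Suc k - (\<Sum>l\<in>{1..<N}. real l ^ (2 * k)) / real N ^ Suc (2 * k)
         = U k N / real N ^ (2 * k + 1)"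
        unfolding U diff_divide_distrib by simp
    qed
  qed
  have "(\<lambda>N. \<Sum>i=0..k. (2 * pi) ^ (2 * i) * (U i N / real N ^ (2 * k + 1))) \<longlonglongrightarrow>
     (\<Sum>i=0..k. (2 * pi) ^ (2 * i) * (if i = k then 1 / real (Suc k) - 1 / real (Suc (2 * k)) else 0))"
    by (intro tendsto_sum tendsto_mult tendsto_const) (use low top in auto)
  moreover have "(\<Sum>i=0..k. (2 * pi) ^ (2 * i) * (if i = k then 1 / real (Suc k) - 1 / real (Suc (2 * k)) else 0))
     = (2 * pi) ^ (2 * k) * (1 / real (Suc k) - 1 / real (Suc (2 * k)))"
    by (simp add: if_distrib[of "(*) _"] cong: if_cong)
  moreover have "1 / real (Suc k) - 1 / real (Suc (2 * k)) = real k / ((real k + 1) * (2 * real k + 1))"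
    by (simp add: field_simps)
  ultimately show ?thesis unfolding W by (simp add: sum_divide_distrib)
qed

section \<open>The sharp constant\<close>

text \<open>The factor \<open>A\<close> for which the cutoff \<open>N = A v powr (1 / (2 k + 1))\<close> gives the prior an expected
  squared Sobolev norm tending to \<open>\<rho>\<close>.\<close>

definition sharp_cutoff :: "nat \<Rightarrow> real \<Rightarrow> real" where
  "sharp_cutoff k \<rho> =
     (\<rho> / (2 * ((2 * pi) ^ (2 * k) * (real k / ((real k + 1) * (2 * real k + 1)))))) powr (1 / (2 * real k + 1))"

lemma sharp_cutoff_pos:
  assumes "1 \<le> k" "0 < \<rho>"
  shows "0 < sharp_cutoff k \<rho>"
  using assms by (simp add: sharp_cutoff_def)

lemma powr_root_power:
  fixes x :: real
  assumes "0 < x"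
  shows "(x powr (1 / (2 * real k + 1))) ^ m = x powr (real m / (2 * real k + 1))"
  using assms by (simp add: powr_realpow[symmetric] powr_powr)

lemma sharp_cutoff_power:
  assumes "1 \<le> k" "0 < \<rho>"
  shows "2 * ((2 * pi) ^ (2 * k) * (real k / ((real k + 1) * (2 * real k + 1)))) * sharp_cutoff k \<rho> ^ (2 * k + 1) = \<rho>"
proof -
  let ?w = "2 * ((2 * pi) ^ (2 * k) * (real k / ((real k + 1) * (2 * real k + 1))))"
  have w: "0 < ?w" using assms by simp
  have "sharp_cutoff k \<rho> ^ (2 * k + 1) = (\<rho> / ?w) powr (real (2 * k + 1) / (2 * real k + 1))"
    unfolding sharp_cutoff_def using w assms(2) by (intro powr_root_power divide_pos_pos)
  also have "real (2 * k + 1) / (2 * real k + 1) = 1" by simp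
  also have "(\<rho> / ?w) powr 1 = \<rho> / ?w" using w assms(2) by simp
  finally have "?w * sharp_cutoff k \<rho> ^ (2 * k + 1) = ?w * (\<rho> / ?w)" by (rule arg_cong)
  then show ?thesis using w assms(1) by simp
qed

text \<open>With \<open>a\<close>, \<open>b\<close>, \<open>p\<close> as in the proof,
  \<open>sharp_cutoff k r\<close> is \<open>((2 * k + 1) * r / (a * b ^ (2 * k))) powr p\<close>.
  Multiplying by \<open>a\<close> and using \<open>2 * k * p = 1 - p\<close> gives
  \<open>(a / b) powr (1 - p)\<close>, and \<open>a / b\<close> is the ratio in Pinsker's
  constant.\<close>

lemma pinsker_constant_eq:
  assumes "1 \<le> k" "0 < r"
  shows "2 * (real k / (real k + 1)) * sharp_cutoff k r = pinsker_constant k r"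
proof -
  define a b p where "a = 2 * real k / (real k + 1)" and "b = 2 * pi" and "p = 1 / (2 * real k + 1)"
  have pos: "0 < a" "0 < b" "0 < (2 * real k + 1) * r" using assms by (auto simp: a_def b_def)
  have p: "1 - p = 2 * real k / (2 * real k + 1)" "2 * real k * p = 1 - p"
    by (auto simp: p_def field_simps)
  have "r / (2 * ((2 * pi) ^ (2 * k) * (real k / ((real k + 1) * (2 * real k + 1)))))
     = ((2 * real k + 1) * r) * inverse a * inverse (b ^ (2 * k))"
    using assms by (simp add: a_def b_def field_simps)
  also have "inverse (b ^ (2 * k)) = b powr (- (2 * real k))"
    using pos by (simp add: powr_minus powr_realpow[symmetric])
  finally have "sharp_cutoff k r = ((2 * real k + 1) * r) powr p * inverse a powr p * (b powr (- (2 * real k))) powr p"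
    using pos unfolding sharp_cutoff_def p_def[symmetric] by (simp add: powr_mult)
  also have "inverse a powr p = a powr (- p)" using pos by (simp add: powr_minus inverse_powr)
  also have "(b powr (- (2 * real k))) powr p = b powr (- (1 - p))"
    by (simp add: powr_powr p(2)[symmetric])
  finally have "2 * (real k / (real k + 1)) * sharp_cutoff k r
     = ((2 * real k + 1) * r) powr p * ((a powr 1 * a powr (- p)) * b powr (- (1 - p)))"
    using pos by (simp add: a_def)
  also have "a powr 1 * a powr (- p) = a powr (1 - p)" by (subst powr_add[symmetric]) simp
  also have "a powr (1 - p) * b powr (- (1 - p)) = (a / b) powr (1 - p)"
  proof -
    have "a powr z * b powr (- z) = (a / b) powr z" for z
      using pos by (simp add: powr_minus_divide powr_divide)
    then show ?thesis .
  qed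
  also have "a / b = real k / ((real k + 1) * pi)" by (simp add: a_def b_def)
  finally show ?thesis unfolding pinsker_constant_def p(1)[symmetric] p_def[symmetric] .
qed

lemma power_times_exp_decay:
  assumes "0 < c"
  shows "(\<lambda>N. real N ^ m * exp (- c * real N)) \<longlonglongrightarrow> 0"
proof -
  have "filterlim (\<lambda>N. c * real N) at_top sequentially"
    by (rule filterlim_tendsto_pos_mult_at_top[OF tendsto_const assms filterlim_real_sequentially])
  from filterlim_compose[OF tendsto_power_div_exp_0 this]
  have "(\<lambda>N. (c * real N) ^ m / exp (c * real N)) \<longlonglongrightarrow> 0" .
  from tendsto_mult[OF tendsto_const[of "1 / c ^ m"] this]
  have "(\<lambda>N. 1 / c ^ m * ((c * real N) ^ m / exp (c * real N))) \<longlonglongrightarrow> 0" by simp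
  moreover have "1 / c ^ m * ((c * real N) ^ m / exp (c * real N)) = real N ^ m * exp (- c * real N)" for N
    using assms by (simp add: power_mult_distrib exp_minus divide_inverse)
  ultimately show ?thesis by simp
qed

theorem theorem4p5:
  fixes M :: "'a measure"
    and w L :: "real \<Rightarrow> 'a \<Rightarrow> real"
    and \<tau> Y :: "nat \<Rightarrow> 'a \<Rightarrow> real"
    and \<nu> \<eta> :: "real measure"
    and \<sigma>lo \<sigma>hi :: "nat \<Rightarrow> real"
    and k :: nat and r :: real
  assumes "semi_markov_noise M w L \<tau> Y \<nu> \<eta>"
    and "\<And>n. 1 \<le> n \<Longrightarrow> 0 < \<sigma>lo n \<and> \<sigma>lo n \<le> \<sigma>hi n"
    and "\<And>e::real. 0 < e \<Longrightarrow> filterlim (\<lambda>n. real n powr e * \<sigma>lo n) at_top sequentially"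
    and "\<And>e::real. 0 < e \<Longrightarrow> (\<lambda>n. \<sigma>hi n / real n powr e) \<longlonglongrightarrow> 0"
    and "1 \<le> k" and "0 < r"
  shows "liminf (\<lambda>n.
           ennreal ((real n / \<sigma>hi n) powr (2 * real k / (2 * real k + 1))) *
           (INF E\<in>estimators (real n). SUP S\<in>sobolev_ball k r.
              robust_risk (real n) (noise_family M w L \<tau> Y \<eta> (real n) (\<sigma>lo n) (\<sigma>hi n)) E S))
         \<ge> ennreal (pinsker_constant k r)"
proof -
  interpret semi_markov_noise M w L \<tau> Y \<nu> \<eta> by (rule assms(1))
  have M: "prob_space M" by unfold_locales
  note k = assms(5) and r = assms(6)
  define QQ where "QQ n = noise_family M w L \<tau> Y \<eta> (real n) (\<sigma>lo n) (\<sigma>hi n)" for n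
  define v where "v n = real n / \<sigma>hi n" for n
  \<comment> \<open>The order of the cutoff frequency: \<open>u n ^ (2 * k + 1)\<close> is
    \<open>v n\<close>, and \<open>u n ^ (2 * k)\<close> is the normalising rate of the
    theorem.\<close>
  define u where "u n = v n powr (1 / (2 * real k + 1))" for n
  define R where "R n = (INF E\<in>estimators (real n). SUP S\<in>sobolev_ball k r. robust_risk (real n) (QQ n) E S)" for n
  define F where "F n = ennreal (v n powr (2 * real k / (2 * real k + 1))) * R n" for n
  have \<sigma>: "0 < \<sigma>hi n" if "1 \<le> n" for n using assms(2)[OF that] by auto
  have v0: "0 < v n" if "1 \<le> n" for n using \<sigma>[OF that] that by (simp add: v_def)
  have u0: "0 < u n" if "1 \<le> n" for n using v0[OF that] by (simp add: u_def)
  have u_pow: "u n ^ (2 * k + 1) = v n" if "1 \<le> n" for n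
    using powr_root_power[OF v0[OF that], of k "2 * k + 1"] v0[OF that] by (simp add: u_def add.commute)
  have u_pow': "v n powr (2 * real k / (2 * real k + 1)) = u n ^ (2 * k)" if "1 \<le> n" for n
    using powr_root_power[OF v0[OF that], of k "2 * k"] by (simp add: u_def)
  have Q: "noise_law M w L \<tau> Y (real n) (sqrt (\<sigma>hi n)) 0 0 \<in> QQ n" if "1 \<le> n" for n
  proof -
    have "noise_variance \<eta> (sqrt (\<sigma>hi n)) 0 0 = \<sigma>hi n" using \<sigma>[OF that] by (simp add: noise_variance_def)
    then show ?thesis unfolding QQ_def noise_family_def using assms(2)[OF that] by fastforce
  qed
  have v_top: "filterlim v at_top sequentially"
  proof -
    have "(\<lambda>n. \<sigma>hi n / real n powr 1) \<longlonglongrightarrow> 0" by (rule assms(4)) simp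
    then have "filterlim (\<lambda>n. inverse (\<sigma>hi n / real n powr 1)) at_top sequentially"
      by (rule filterlim_inverse_at_top) (use \<sigma> in \<open>auto intro!: eventually_sequentiallyI[of 1]\<close>)
    then show ?thesis by (simp add: v_def[abs_def])
  qed
  have u_top: "filterlim u at_top sequentially"
  proof -
    have "filterlim (\<lambda>x::real. x powr (1 / (2 * real k + 1))) at_top at_top"
      by (rule real_powr_at_top) simp
    from filterlim_compose[OF this v_top] show ?thesis by (simp add: u_def[abs_def])
  qed
  \<comment> \<open>The expected squared norm will tend to \<open>(1 - \<delta>) * r\<close>, which
    is strictly below the threshold \<open>(1 - \<delta> / 2) * r\<close> of
    \<open>pinsker_finite_sample\<close>, so its condition holds eventually.\<close>
  have main: "ennreal (2 * (real k / (real k + 1)) * sharp_cutoff k ((1 - \<delta>) * r)) \<le> liminf F"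
    if \<delta>: "0 < \<delta>" "\<delta> < 1" for \<delta>
  proof -
    define A where "A = sharp_cutoff k ((1 - \<delta>) * r)"
    define \<omega> where "\<omega> = (2 * pi) ^ (2 * k) * (real k / ((real k + 1) * (2 * real k + 1)))"
    have A: "0 < A" "2 * \<omega> * A ^ (2 * k + 1) = (1 - \<delta>) * r"
      using sharp_cutoff_pos[OF k] sharp_cutoff_power[OF k] r \<delta> by (auto simp: A_def \<omega>_def)
    \<comment> \<open>Rounding down costs at most 1, which disappears in the ratio of
      \<open>N n\<close> to \<open>u n\<close>.\<close>
    define N where "N n = nat \<lfloor>A * u n\<rfloor>" for n
    have N_le: "real (N n) \<le> A * u n" and N_ge: "A * u n - 1 \<le> real (N n)" if "1 \<le> n" for n
      using A(1) u0[OF that] unfolding N_def by (auto simp: of_nat_nat)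
    have N_top: "filterlim N at_top sequentially"
    proof -
      have "filterlim (\<lambda>n. A * u n) at_top sequentially"
        by (rule filterlim_tendsto_pos_mult_at_top[OF tendsto_const A(1) u_top])
      then show ?thesis unfolding N_def[abs_def]
        by (intro filterlim_compose[OF filterlim_nat_sequentially] filterlim_compose[OF filterlim_floor_sequentially])
    qed
    have Nu: "(\<lambda>n. real (N n) / u n) \<longlonglongrightarrow> A"
    proof (rule tendsto_sandwich)
      show "\<forall>\<^sub>F n in sequentially. A - inverse (u n) \<le> real (N n) / u n"
      proof (rule eventually_sequentiallyI[of 1])
        fix n :: nat assume n: "1 \<le> n"
        then have "A - inverse (u n) = (A * u n - 1) / u n" using u0[OF n] by (simp add: field_simps)
        also have "\<dots> \<le> real (N n) / u n" using u0[OF n] N_ge[OF n] by (intro divide_right_mono) auto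
        finally show "A - inverse (u n) \<le> real (N n) / u n" .
      qed
      show "\<forall>\<^sub>F n in sequentially. real (N n) / u n \<le> A"
        using N_le u0 by (intro eventually_sequentiallyI[of 1]) (simp add: divide_le_eq)
      have "(\<lambda>n. A - inverse (u n)) \<longlonglongrightarrow> A - 0"
        by (intro tendsto_diff tendsto_const filterlim_compose[OF tendsto_inverse_0_at_top[OF filterlim_ident] u_top])
      then show "(\<lambda>n. A - inverse (u n)) \<longlonglongrightarrow> A" by simp
    qed simp
    \<comment> \<open>The bound \<open>NB\<close> at the unrounded cutoff \<open>A * u n\<close>,
      where \<open>u n ^ (2 * k + 1)\<close> cancels against \<open>v n\<close>.\<close>
    define B where "B = (real k + 1) * (2 * pi) ^ (2 * k) * A ^ (2 * k + 1)"
    have B: "0 < B" using A(1) by (simp add: B_def)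
    have NB: "(real k + 1) * (2 * pi) ^ (2 * k) * real (N n) ^ (2 * k + 1) / v n \<le> B" if n: "1 \<le> n" for n
    proof -
      have "real (N n) ^ (2 * k + 1) \<le> (A * u n) ^ (2 * k + 1)" by (intro power_mono N_le n) simp
      also have "\<dots> = A ^ (2 * k + 1) * v n" unfolding power_mult_distrib u_pow[OF n] ..
      finally have "(real k + 1) * (2 * pi) ^ (2 * k) * real (N n) ^ (2 * k + 1)
         \<le> (real k + 1) * (2 * pi) ^ (2 * k) * (A ^ (2 * k + 1) * v n)" by (intro mult_left_mono) auto
      then show ?thesis using v0[OF n] by (simp add: B_def divide_le_eq mult.assoc)
    qed
    have W_lim: "(\<lambda>n. 2 * pinsker_weight_sum k (N n) / v n) \<longlonglongrightarrow> (1 - \<delta>) * r"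
    proof -
      have "(\<lambda>n. 2 * (pinsker_weight_sum k (N n) / real (N n) ^ (2 * k + 1)) * (real (N n) / u n) ^ (2 * k + 1))
         \<longlonglongrightarrow> 2 * \<omega> * A ^ (2 * k + 1)"
        unfolding \<omega>_def
        by (intro tendsto_mult tendsto_const tendsto_power Nu filterlim_compose[OF pinsker_weight_sum_asymp[OF k] N_top])
      moreover have "\<forall>\<^sub>F n in sequentially. 2 * (pinsker_weight_sum k (N n) / real (N n) ^ (2 * k + 1)) * (real (N n) / u n) ^ (2 * k + 1)
         = 2 * pinsker_weight_sum k (N n) / v n"
        using eventually_ge_at_top[of 1] filterlim_at_top[THEN iffD1, OF N_top, rule_format, of 1]
      proof eventually_elim
        case (elim n)
        then show ?case unfolding power_divide u_pow[OF elim(1)] by simp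
      qed
      ultimately show ?thesis unfolding A(2) by (rule Lim_transform_eventually)
    qed
    define c where "c = \<delta> / (16 * B) * r * \<delta> / 4"
    have c: "0 < c" using \<delta> B r by (simp add: c_def)
    define rem where "rem m = 2 * (2 * real m + 1) * (r * exp (- c * real m))" for m
    \<comment> \<open>A negative \<open>x n\<close> does no harm: \<open>ennreal\<close> maps it to
      0, which is still a lower bound.\<close>
    define x where "x n = 2 * pinsker_variance_sum k (N n) / v n - rem (N n)" for n
    have lower: "\<forall>\<^sub>F n in sequentially. ennreal (u n ^ (2 * k) * x n) \<le> F n"
    proof -
      have "(1 - \<delta>) * r < (1 - \<delta> / 2) * r" using \<delta> r by (intro mult_strict_right_mono) auto
      then have "\<forall>\<^sub>F n in sequentially. 2 * pinsker_weight_sum k (N n) / v n < (1 - \<delta> / 2) * r"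
        by (rule order_tendstoD(2)[OF W_lim])
      moreover have "\<forall>\<^sub>F n in sequentially. 1 / r \<le> \<delta> / (16 * B) * real (N n)"
      proof -
        have "filterlim (\<lambda>n. \<delta> / (16 * B) * real (N n)) at_top sequentially"
          using \<delta> B by (intro filterlim_tendsto_pos_mult_at_top[OF tendsto_const _ filterlim_compose[OF filterlim_real_sequentially N_top]]) simp
        then show ?thesis by (simp add: filterlim_at_top)
      qed
      ultimately show ?thesis
        using eventually_ge_at_top[of 1] filterlim_at_top[THEN iffD1, OF N_top, rule_format, of 1]
      proof eventually_elim
        case (elim n)
        note n = elim(3)
        have "ennreal (x n) \<le> (SUP S\<in>sobolev_ball k r. robust_risk (real n) (QQ n) E S)" if E: "E \<in> estimators (real n)" for E
        proof -
          have "ennreal (2 * pinsker_variance_sum k (N n) / v n) \<le>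
            (SUP S\<in>sobolev_ball k r. robust_risk (real n) (QQ n) E S) + ennreal (rem (N n))"
            unfolding rem_def c_def
            by (rule pinsker_finite_sample[OF M brownian n \<sigma>[OF n] k elim(4) E Q[OF n] v_def r \<delta>(1) less_imp_le[OF \<delta>(2)] B
                  less_imp_le[OF elim(1)] NB[OF n] elim(2)])
          moreover have "0 \<le> rem (N n)" using r by (simp add: rem_def)
          ultimately show ?thesis
            unfolding x_def by (simp add: ennreal_minus[symmetric] ennreal_minus_le_iff add.commute)
        qed
        then have "ennreal (x n) \<le> R n" unfolding R_def by (intro INF_greatest)
        then have "ennreal (u n ^ (2 * k)) * ennreal (x n) \<le> F n"
          unfolding F_def u_pow'[OF n] by (intro mult_left_mono) auto
        then show ?case using u0[OF n] by (simp add: ennreal_mult')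
      qed
    qed
    have lim: "(\<lambda>n. u n ^ (2 * k) * x n) \<longlonglongrightarrow> 2 * (real k / (real k + 1)) * A"
    proof -
      have "(\<lambda>m. 4 * r * (real m ^ (2 * k + 1) * exp (- c * real m)) + 2 * r * (real m ^ (2 * k) * exp (- c * real m))) \<longlonglongrightarrow> 4 * r * 0 + 2 * r * 0"
        by (intro tendsto_add tendsto_mult tendsto_const power_times_exp_decay c)
      moreover have "4 * r * (real m ^ (2 * k + 1) * exp (- c * real m)) + 2 * r * (real m ^ (2 * k) * exp (- c * real m)) = real m ^ (2 * k) * rem m" for m
        by (simp add: rem_def algebra_simps)
      ultimately have rem0: "(\<lambda>m. real m ^ (2 * k) * rem m) \<longlonglongrightarrow> 0" by simp
      \<comment> \<open>Everything is expressed through \<open>N n\<close> and the ratio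
        \<open>N n / u n\<close>, which tends to \<open>A\<close>. The remainder decays
        exponentially in \<open>N n\<close> and thus survives multiplication by the polynomial
        rate.\<close>
      have "(\<lambda>n. 2 * (pinsker_variance_sum k (N n) / real (N n)) * (real (N n) / u n)
           - (1 / (real (N n) / u n)) ^ (2 * k) * (real (N n) ^ (2 * k) * rem (N n)))
         \<longlonglongrightarrow> 2 * (real k / (real k + 1)) * A - (1 / A) ^ (2 * k) * 0"
        using A(1)
        by (intro tendsto_diff tendsto_mult tendsto_power tendsto_divide tendsto_const Nu
            filterlim_compose[OF pinsker_variance_sum_asymp N_top] filterlim_compose[OF rem0 N_top]) auto
      moreover have "\<forall>\<^sub>F n in sequentially. 2 * (pinsker_variance_sum k (N n) / real (N n)) * (real (N n) / u n)
           - (1 / (real (N n) / u n)) ^ (2 * k) * (real (N n) ^ (2 * k) * rem (N n)) = u n ^ (2 * k) * x n"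
        using eventually_ge_at_top[of 1] filterlim_at_top[THEN iffD1, OF N_top, rule_format, of 1]
      proof eventually_elim
        case (elim n)
        have v: "v n = u n ^ (2 * k) * u n" using u_pow[OF elim(1)] by (simp add: mult.commute)
        have "2 * (pinsker_variance_sum k (N n) / real (N n)) * (real (N n) / u n) = u n ^ (2 * k) * (2 * pinsker_variance_sum k (N n) / v n)"
          unfolding v using elim u0[OF elim(1)] by simp
        moreover have "(1 / (real (N n) / u n)) ^ (2 * k) * (real (N n) ^ (2 * k) * rem (N n)) = u n ^ (2 * k) * rem (N n)"
          using elim by (simp add: power_divide)
        ultimately show ?case by (simp add: x_def right_diff_distrib)
      qed
      ultimately show ?thesis by (simp add: Lim_transform_eventually)
    qed
    have "ennreal (2 * (real k / (real k + 1)) * A) = liminf (\<lambda>n. ennreal (u n ^ (2 * k) * x n))"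
      using tendsto_ennrealI[OF lim] by (intro lim_imp_Liminf[symmetric]) auto
    also have "\<dots> \<le> liminf F" by (rule Liminf_mono[OF lower])
    finally show ?thesis unfolding A_def .
  qed
  have "ennreal (pinsker_constant k r) \<le> liminf F"
  \<comment> \<open>The left side of \<open>main\<close> is continuous in \<delta>, and its limit
    for \<delta> to 0 is Pinsker's constant by \<open>pinsker_constant_eq\<close>.\<close>
  proof (rule tendsto_upperbound)
    have "((\<lambda>\<delta>. 2 * (real k / (real k + 1)) * sharp_cutoff k ((1 - \<delta>) * r)) \<longlongrightarrow> 2 * (real k / (real k + 1)) * sharp_cutoff k ((1 - 0) * r)) (at_right 0)"
      unfolding sharp_cutoff_def using k r by (intro tendsto_intros) auto
    then show "((\<lambda>\<delta>. ennreal (2 * (real k / (real k + 1)) * sharp_cutoff k ((1 - \<delta>) * r))) \<longlongrightarrow> ennreal (pinsker_constant k r)) (at_right 0)"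
      using pinsker_constant_eq[OF k r] by (intro tendsto_ennrealI) simp
    show "\<forall>\<^sub>F \<delta> in at_right 0. ennreal (2 * (real k / (real k + 1)) * sharp_cutoff k ((1 - \<delta>) * r)) \<le> liminf F"
      using main by (intro eventually_at_rightI[of 0 1]) auto
  qed simp
  then show ?thesis unfolding F_def R_def QQ_def v_def .
qed

end
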